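(* Let $r>0$ and let $g$ be a $C^\infty$ Riemannian metric on the ball $B(O,r)\subseteq\mathbb{R}^2$, with coordinates $(x,y)$, whose Gauss curvature $k$ satisfies $k>0$ in $B(O,r)\setminus\{O\}$. Suppose that $X:(B(O,r),g)\to(\mathbb{R}^3,g_{can})$ is a $C^{1,1}$ isometric embedding of the form $$X:(x,y)\longmapsto (x,y,u(x,y)),$$ where $u(0,0)=0$ and $u_x(0,0)=u_y(0,0)=0$. Assume in addition that there are constants $C_0>0$ and $\rho\in(0,r)$ such that $\Delta u=u_{xx}+u_{yy}>C_0$ in $B(O,\rho)\setminus\{O\}$ (nothing is required at $O$ itself). Then $X\in C^\infty(B(O,r))$.
   Context: $B(O,r)$ is the open ball in $\mathbb{R}^2$ of radius $r$ centred at the origin $O=(0,0)$, and $g_{can}$ is the standard flat metric on $\mathbb{R}^3$. The coordinates $x,y$ on the ball are those in which $g$ is smooth. Isometric means $X^*g_{can}=g$, i.e. here $g=dx^2+dy^2+du^2$. A $C^{1,1}$ map is a $C^1$ map whose first derivatives are locally Lipschitz. *)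

theory Defs
  imports "HOL-Analysis.Analysis"
begin

section \<open>Regularity classes on open sets\<close>

text \<open>The sets are meant to be open: derivatives are taken at points, not within the set.\<close>

primrec Ck_on :: "nat \<Rightarrow> 'a::real_normed_vector set \<Rightarrow> ('a \<Rightarrow> 'b::real_normed_vector) \<Rightarrow> bool" where
  "Ck_on 0 S f \<longleftrightarrow> continuous_on S f"
| "Ck_on (Suc n) S f \<longleftrightarrow>
     (\<forall>x\<in>S. f differentiable (at x)) \<and> (\<forall>v. Ck_on n S (\<lambda>x. frechet_derivative f (at x) v))"

definition smooth_on :: "'a::real_normed_vector set \<Rightarrow> ('a \<Rightarrow> 'b::real_normed_vector) \<Rightarrow> bool" where
  "smooth_on S f \<longleftrightarrow> (\<forall>n. Ck_on n S f)"

definition locally_lipschitz_on :: "'a::metric_space set \<Rightarrow> ('a \<Rightarrow> 'b::metric_space) \<Rightarrow> bool" where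
  "locally_lipschitz_on S f \<longleftrightarrow> (\<forall>x\<in>S. \<exists>e>0. \<exists>L. L-lipschitz_on (ball x e \<inter> S) f)"

definition C11_on :: "'a::real_normed_vector set \<Rightarrow> ('a \<Rightarrow> 'b::real_normed_vector) \<Rightarrow> bool" where
  "C11_on S f \<longleftrightarrow>
     Ck_on 1 S f \<and> (\<forall>v. locally_lipschitz_on S (\<lambda>x. frechet_derivative f (at x) v))"


section \<open>Partial derivatives\<close>

definition has_partial :: "'n \<Rightarrow> (real^'n \<Rightarrow> real) \<Rightarrow> real \<Rightarrow> real^'n \<Rightarrow> bool" where
  "has_partial i f d p \<longleftrightarrow> ((\<lambda>t. f (p + t *\<^sub>R axis i 1)) has_real_derivative d) (at 0)"

text \<open>The value is meaningful only where some \<open>d\<close> satisfies \<open>has_partial i f d p\<close>.\<close>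

definition partial :: "'n \<Rightarrow> (real^'n \<Rightarrow> real) \<Rightarrow> real^'n \<Rightarrow> real" where
  "partial i f p = deriv (\<lambda>t. f (p + t *\<^sub>R axis i 1)) 0"


section \<open>Riemannian metrics in a single chart\<close>

definition riemannian_metric_on :: "(real^'n) set \<Rightarrow> (real^'n \<Rightarrow> real^'n^'n) \<Rightarrow> bool" where
  "riemannian_metric_on U g \<longleftrightarrow> smooth_on U g \<and>
     (\<forall>p\<in>U. transpose (g p) = g p \<and> (\<forall>v. v \<noteq> 0 \<longrightarrow> v \<bullet> (g p *v v) > 0))"

text \<open>\<open>christoffel g k i j\<close> is $\Gamma^k_{ij}$, for the Levi-Civita connection of \<open>g\<close>.\<close>

definition christoffel ::
  "(real^'n \<Rightarrow> real^'n^'n) \<Rightarrow> 'n \<Rightarrow> 'n \<Rightarrow> 'n \<Rightarrow> real^'n \<Rightarrow> real" where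
  "christoffel g k i j p =
     (\<Sum>l\<in>UNIV. matrix_inv (g p) $ k $ l *
        (partial i (\<lambda>q. g q $ j $ l) p + partial j (\<lambda>q. g q $ i $ l) p
         - partial l (\<lambda>q. g q $ i $ j) p)) / 2"

text \<open>\<open>riemann g l k i j\<close> is the \<open>l\<close>-th component of $R(\partial_i,\partial_j)\partial_k$, with the
  convention $R(Y,Z) = \nabla_Y\nabla_Z - \nabla_Z\nabla_Y - \nabla_{[Y,Z]}$.\<close>

definition riemann ::
  "(real^'n \<Rightarrow> real^'n^'n) \<Rightarrow> 'n \<Rightarrow> 'n \<Rightarrow> 'n \<Rightarrow> 'n \<Rightarrow> real^'n \<Rightarrow> real" where
  "riemann g l k i j p =
     partial i (christoffel g l j k) p - partial j (christoffel g l i k) p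
     + (\<Sum>m\<in>UNIV. christoffel g l i m p * christoffel g m j k p
                  - christoffel g l j m p * christoffel g m i k p)"

text \<open>$\langle R(\partial_1,\partial_2)\partial_2,\partial_1\rangle / \det g$, which is positive on
  round spheres.\<close>

definition gauss_curvature :: "(real^2 \<Rightarrow> real^2^2) \<Rightarrow> real^2 \<Rightarrow> real" where
  "gauss_curvature g p = (\<Sum>l\<in>UNIV. g p $ 1 $ l * riemann g l 2 1 2 p) / det (g p)"


section \<open>Isometric embeddings into Euclidean space\<close>

definition C1_embedding_on ::
  "'a::real_normed_vector set \<Rightarrow> ('a \<Rightarrow> 'b::real_normed_vector) \<Rightarrow> bool" where
  "C1_embedding_on U X \<longleftrightarrow> Ck_on 1 U X \<and>
     (\<forall>p\<in>U. inj (frechet_derivative X (at p))) \<and> (\<exists>Y. homeomorphism U (X ` U) X Y)"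

text \<open>The second conjunct is $X^*g_{can} = g$.\<close>

definition isometric_embedding_on ::
  "(real^'n) set \<Rightarrow> (real^'n \<Rightarrow> real^'n^'n) \<Rightarrow> (real^'n \<Rightarrow> real^'m) \<Rightarrow> bool" where
  "isometric_embedding_on U g X \<longleftrightarrow> C1_embedding_on U X \<and>
     (\<forall>p\<in>U. \<forall>v w. frechet_derivative X (at p) v \<bullet> frechet_derivative X (at p) w
                      = v \<bullet> (g p *v w))"


section \<open>A lower bound on the Laplacian of a function of class $C^{1,1}$\<close>

text \<open>The pure second derivatives of such a function exist almost everywhere only, so the
  inequality $f_{xx} + f_{yy} > c$ is read almost everywhere.  This is implied by its validity
  at every point of \<open>S\<close>.\<close>

definition laplacian_gt_on :: "(real^2) set \<Rightarrow> (real^2 \<Rightarrow> real) \<Rightarrow> real \<Rightarrow> bool" where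
  "laplacian_gt_on S f c \<longleftrightarrow>
     (AE p in lborel. p \<in> S \<longrightarrow>
        (\<exists>a b. has_partial 1 (partial 1 f) a p \<and> has_partial 2 (partial 2 f) b p \<and> a + b > c))"

end

theory Submission
  imports Defs
begin

text \<open>
  Let $V = (p,q)$ be the gradient of \<open>u\<close>.  The embedding is isometric iff $g = 1 + V V^T$, so the
  products $p^2$, $pq$, $q^2$ are smooth.  They determine \<open>V\<close> up to a sign at each point, and the
  theorem says that the continuous choice of this sign is a smooth one.  Where $V \<noteq> 0$ this is clear:
  locally $p = \<plusminus>\sqrt{p^2}$ and $q = pq / p$, or the same with the roles exchanged.

  At a zero \<open>z\<close> of \<open>V\<close> the 2-jets of the products are quadratic forms $a, b, c$ with $a, c \ge 0$ and
  $ac = b^2$, and the curvature of \<open>g\<close> at \<open>z\<close> is a linear expression in their coefficients, because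
  the first derivatives of \<open>g\<close> vanish there (\<open>gauss_curvature_at_critical_point\<close>).  Nonnegative
  curvature forces $a = l_1^2$, $b = l_1 l_2$, $c = l_2^2$ for linear forms $l_1$, $l_2$, the rows of a
  matrix \<open>L\<close> (\<open>jets_factor\<close>, \<open>jets\<close>).  Thus $V(z + v) = \<plusminus> L v + o(|v|)$ with a sign that may
  depend on \<open>v\<close>, and the curvature is $\det L - (l_{12} - l_{21})^2$.

  \<^item> If \<open>L\<close> is invertible, as it is when the curvature is positive, the sign is constant on a
    punctured disc, so components of \<open>V\<close> change sign across \<open>z\<close> (\<open>smooth_near_nondegenerate\<close>).
  \<^item> Otherwise \<open>z\<close> is the origin, the curvature is nonnegative by continuity, so \<open>L\<close> is symmetric, and
    $L = c\, n n^T$ with $c \ge 0$ after a change of sign.  The danger is a kink, $V \approx c |n \cdot v|\, n$.  The sign is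
    constant in the sectors around \<open>n\<close> and around $-n$.  Away from the origin \<open>u\<close> is already smooth and
    $\Delta u \ge C_0$; in a sector with $V \approx \tau (n \cdot v) n$ and $\tau \le 0$ this contradicts
    the maximum principle (\<open>no_nonpositive_sector\<close>).  So $c > 0$ and the component of \<open>V\<close> along \<open>n\<close>
    changes sign across the origin (\<open>smooth_near_degenerate\<close>).

  In both cases smoothness follows from \<open>smooth_at_sign_change_of_root\<close>: a continuous \<open>P\<close> with $P^2$
  smooth, with a nonzero second derivative of $P^2$ in some direction and with a change of sign in
  that direction, is smooth, and so is every continuous \<open>Q\<close> for which $PQ$ is smooth.  Its proof writes the zero set of \<open>P\<close> as a smooth
  graph and divides by the defining function (\<open>smooth_on_implicit_function\<close>,
  \<open>smooth_on_division\<close>).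
\<close>

section \<open>Calculus of the classes $C^k$\<close>

lemma Ck_on_imp_continuous_on: "Ck_on n S f \<Longrightarrow> continuous_on S f"
  by (cases n) (auto intro!: differentiable_imp_continuous_on simp: differentiable_on_def
      differentiable_at_withinI)

lemma Ck_on_SucD: "Ck_on (Suc n) S f \<Longrightarrow> Ck_on n S f"
proof (induction n arbitrary: f)
  case 0
  then show ?case
    using Ck_on_imp_continuous_on Ck_on.simps(1) by blast
next
  case (Suc n)
  then show ?case by (metis Ck_on.simps(2))
qed

lemma Ck_on_subset: "Ck_on n S f \<Longrightarrow> T \<subseteq> S \<Longrightarrow> Ck_on n T f"
  by (induction n arbitrary: f) (auto intro: continuous_on_subset)

text \<open>Openness is essential: the derivative at a point of \<open>S\<close> only sees values in a neighbourhood.\<close>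

lemma Ck_on_cong:
  assumes "open S" "\<And>x. x \<in> S \<Longrightarrow> f x = g x" "Ck_on n S f"
  shows "Ck_on n S g"
  using assms(2,3)
proof (induction n arbitrary: f g)
  case 0
  then show ?case using continuous_on_cong by force
next
  case (Suc n)
  have D: "(g has_derivative frechet_derivative f (at x)) (at x)" if "x \<in> S" for x
  proof -
    have "(f has_derivative frechet_derivative f (at x)) (at x)"
      using Suc.prems that frechet_derivative_works by auto
    then show ?thesis
      using has_derivative_transform_within_open[OF _ \<open>open S\<close> that] Suc.prems by blast
  qed
  have "frechet_derivative f (at x) = frechet_derivative g (at x)" if "x \<in> S" for x
    using D[OF that] frechet_derivative_at by blast
  then have "Ck_on n S (\<lambda>x. frechet_derivative g (at x) v)" for v
    using Suc.IH[of "\<lambda>x. frechet_derivative f (at x) v"] Suc.prems by simp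
  then show ?case using D unfolding Ck_on.simps differentiable_def by blast
qed

lemma Ck_on_SucI:
  assumes "open S" "\<And>x. x \<in> S \<Longrightarrow> (f has_derivative f' x) (at x)"
    and "\<And>v. Ck_on n S (\<lambda>x. f' x v)"
  shows "Ck_on (Suc n) S f"
proof -
  have "f' x = frechet_derivative f (at x)" if "x \<in> S" for x
    using assms(2)[OF that] frechet_derivative_at by blast
  then have "Ck_on n S (\<lambda>x. frechet_derivative f (at x) v)" for v
    using Ck_on_cong[OF assms(1) _ assms(3)[of v]] by simp
  then show ?thesis using assms(2) unfolding Ck_on.simps differentiable_def by blast
qed

lemma Ck_on_SucE:
  assumes "Ck_on (Suc n) S f"
  shows "\<And>x. x \<in> S \<Longrightarrow> (f has_derivative frechet_derivative f (at x)) (at x)"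
    and "\<And>v. Ck_on n S (\<lambda>x. frechet_derivative f (at x) v)" and "Ck_on n S f"
  using assms Ck_on_SucD[OF assms] by (auto simp: frechet_derivative_works[symmetric])

lemma Ck_on_local:
  assumes "\<And>x. x \<in> S \<Longrightarrow> \<exists>T. open T \<and> x \<in> T \<and> Ck_on n T f"
  shows "Ck_on n S f"
  using assms
proof (induction n arbitrary: f)
  case 0
  have "continuous (at x) f" if "x \<in> S" for x
    using 0[OF that] continuous_on_eq_continuous_at by (metis Ck_on.simps(1))
  then show ?case by (simp add: continuous_at_imp_continuous_on)
next
  case (Suc n)
  have "f differentiable (at x)" if "x \<in> S" for x
    using Suc.prems[OF that] by auto
  moreover have "Ck_on n S (\<lambda>x. frechet_derivative f (at x) v)" for v
  proof (rule Suc.IH)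
    fix x assume "x \<in> S"
    then obtain T where "open T" "x \<in> T" "Ck_on (Suc n) T f" using Suc.prems by blast
    then show "\<exists>T. open T \<and> x \<in> T \<and> Ck_on n T (\<lambda>x. frechet_derivative f (at x) v)"
      by (intro exI[of _ T]) simp
  qed
  ultimately show ?case by simp
qed

lemma Ck_on_const: "open S \<Longrightarrow> Ck_on n S (\<lambda>x. c)"
proof (induction n arbitrary: c)
  case (Suc n)
  then show ?case by (intro Ck_on_SucI[where f'="\<lambda>_ _. 0"]) auto
qed auto

lemma Ck_on_compose_linear:
  assumes "open S" "bounded_linear h" "Ck_on n S f"
  shows "Ck_on n S (\<lambda>x. h (f x))"
  using assms(3)
proof (induction n arbitrary: f)
  case 0
  then show ?case using assms(2) by (simp add: bounded_linear.continuous_on)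
next
  case (Suc n)
  show ?case
    by (rule Ck_on_SucI[OF assms(1) bounded_linear.has_derivative[OF assms(2)]])
      (use Ck_on_SucE[OF Suc.prems] Suc.IH in auto)
qed

lemma Ck_on_linear:
  assumes "open S" "bounded_linear h"
  shows "Ck_on n S h"
proof (cases n)
  case 0
  then show ?thesis using assms(2) by (simp add: linear_continuous_on)
next
  case (Suc m)
  then show ?thesis
    using Ck_on_SucI[OF assms(1), of h "\<lambda>_. h" m] assms bounded_linear_imp_has_derivative Ck_on_const
    by blast
qed

lemma Ck_on_add:
  assumes "open S" "Ck_on n S f" "Ck_on n S g"
  shows "Ck_on n S (\<lambda>x. f x + g x)"
  using assms(2,3)
proof (induction n arbitrary: f g)
  case 0
  then show ?case by (simp add: continuous_on_add)
next
  case (Suc n)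
  show ?case
    by (rule Ck_on_SucI[OF assms(1) has_derivative_add])
      (use Ck_on_SucE[OF Suc.prems(1)] Ck_on_SucE[OF Suc.prems(2)] Suc.IH in auto)
qed

lemma Ck_on_bilinear:
  assumes "open S" "bounded_bilinear h" "Ck_on n S f" "Ck_on n S g"
  shows "Ck_on n S (\<lambda>x. h (f x) (g x))"
  using assms(3,4)
proof (induction n arbitrary: f g)
  case 0
  then show ?case using assms(2) by (simp add: bounded_bilinear.continuous_on)
next
  case (Suc n)
  note f = Ck_on_SucE[OF Suc.prems(1)] and g = Ck_on_SucE[OF Suc.prems(2)]
  show ?case
    by (rule Ck_on_SucI[OF assms(1) bounded_bilinear.FDERIV[OF assms(2) f(1) g(1)]])
      (auto intro!: Ck_on_add assms f g Suc.IH)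
qed

lemma Ck_on_sum:
  assumes "open S" "\<And>i. i \<in> I \<Longrightarrow> Ck_on n S (f i)"
  shows "Ck_on n S (\<lambda>x. \<Sum>i\<in>I. f i x)"
  using assms(2)
  by (induction I rule: infinite_finite_induct) (auto intro!: Ck_on_const Ck_on_add assms(1))

lemma Ck_on_inverse:
  fixes f :: "_ \<Rightarrow> real"
  assumes "open S" "Ck_on n S f" "\<And>x. x \<in> S \<Longrightarrow> f x \<noteq> 0"
  shows "Ck_on n S (\<lambda>x. inverse (f x))"
  using assms(2)
proof (induction n)
  case 0
  then show ?case using assms(3) by (simp add: continuous_on_inverse)
next
  case (Suc n)
  note f = Ck_on_SucE[OF Suc.prems(1)]
  have "Ck_on n S (\<lambda>x. (-1) * (inverse (f x) * frechet_derivative f (at x) v * inverse (f x)))" for v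
    by (intro Ck_on_bilinear[OF assms(1) bounded_bilinear_mult] Suc.IH f Ck_on_const assms(1))
  then show ?case
    by (intro Ck_on_SucI[OF assms(1) Deriv.has_derivative_inverse[OF assms(3) f(1)]]) auto
qed

lemma Ck_on_sqrt:
  assumes "open S" "Ck_on n S f" "\<And>x. x \<in> S \<Longrightarrow> f x > 0"
  shows "Ck_on n S (\<lambda>x. sqrt (f x))"
  using assms(2)
proof (induction n)
  case 0
  then show ?case by (simp add: continuous_on_real_sqrt)
next
  case (Suc n)
  note f = Ck_on_SucE[OF Suc.prems(1)]
  have "Ck_on n S (\<lambda>x. frechet_derivative f (at x) v * (1/2 * inverse (sqrt (f x))))" for v
    by (intro Ck_on_bilinear[OF assms(1) bounded_bilinear_mult] Suc.IH f Ck_on_const assms(1)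
        Ck_on_inverse) (use assms(3) in force)
  then show ?case
    by (intro Ck_on_SucI[OF assms(1) has_derivative_real_sqrt[OF assms(3) f(1)]])
      (auto simp: field_simps)
qed

text \<open>The chain rule produces the derivative of \<open>h\<close> in the direction \<open>D f(x) v\<close>, which moves with
  \<open>x\<close>, whereas the induction is over derivatives in fixed directions.  Expanding the moving direction
  in the basis of the finite-dimensional middle space turns it into a sum of products that the
  induction hypothesis covers.\<close>

lemma Ck_on_compose:
  fixes f :: "'a::real_normed_vector \<Rightarrow> 'b::euclidean_space" and h :: "'b \<Rightarrow> 'c::real_normed_vector"
  assumes "open S" "open T" "f ` S \<subseteq> T" "Ck_on n S f" "Ck_on n T h"
  shows "Ck_on n S (\<lambda>x. h (f x))"
  using assms(4,5)
proof (induction n arbitrary: h)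
  case 0
  then show ?case using assms(3) by (auto intro: continuous_on_compose2)
next
  case (Suc n)
  note f = Ck_on_SucE[OF Suc.prems(1)] and h = Ck_on_SucE[OF Suc.prems(2)]
  have D: "((\<lambda>x. h (f x)) has_derivative
      (\<lambda>v. frechet_derivative h (at (f x)) (frechet_derivative f (at x) v))) (at x)" if "x \<in> S" for x
    using has_derivative_compose[OF f(1) h(1)] that assms(3) by blast
  have E: "frechet_derivative h (at (f x)) (frechet_derivative f (at x) v) =
     (\<Sum>b\<in>Basis. (frechet_derivative f (at x) v \<bullet> b) *\<^sub>R frechet_derivative h (at (f x)) b)"
    if "x \<in> S" for x v
  proof -
    interpret bounded_linear "frechet_derivative h (at (f x))"
      using h(1) that assms(3) has_derivative_bounded_linear by blast
    show ?thesis
      by (subst euclidean_representation[symmetric]) (simp add: sum scale)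
  qed
  have "Ck_on n S (\<lambda>x. \<Sum>b\<in>Basis. (frechet_derivative f (at x) v \<bullet> b) *\<^sub>R
      frechet_derivative h (at (f x)) b)" for v
    by (intro Ck_on_sum Ck_on_bilinear[OF assms(1) bounded_bilinear_scaleR] assms(1) Suc.IH f h
        Ck_on_compose_linear[OF assms(1) bounded_linear_inner_left])
  then have "Ck_on n S (\<lambda>x. frechet_derivative h (at (f x)) (frechet_derivative f (at x) v))" for v
    by (rule Ck_on_cong[OF assms(1), rotated]) (simp add: E)
  from Ck_on_SucI[OF assms(1) D this] show ?case .
qed

text \<open>Differentiation under the integral sign, iterated.  The parameter interval is open and larger
  than $[0,1]$ because \<open>Ck_on\<close> only speaks of derivatives on open sets.\<close>

lemma Ck_on_integral:
  fixes F :: "'a::euclidean_space \<times> real \<Rightarrow> 'b::euclidean_space"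
  assumes "open U" "open I" "{0..1} \<subseteq> I" "Ck_on n (U \<times> I) F"
  shows "Ck_on n U (\<lambda>z. integral {0..1} (\<lambda>s. F (z, s)))"
  using assms(4)
proof (induction n arbitrary: F)
  case 0
  have "continuous_on U (\<lambda>z. integral (cbox 0 1) (\<lambda>s. F (z, s)))"
  proof (rule integral_continuous_on_param)
    show "continuous_on (U \<times> cbox 0 1) (\<lambda>(z, s). F (z, s))"
      using continuous_on_subset[OF 0[unfolded Ck_on.simps(1)], of "U \<times> {0..1}"] assms(3)
      by (auto simp: split_beta)
  qed
  then show ?case by simp
next
  case (Suc n)
  note F = Ck_on_SucE[OF Suc.prems(1)]
  let ?D = "\<lambda>z s. Blinfun (\<lambda>v. frechet_derivative F (at (z, s)) (v, 0))"
  have bl: "bounded_linear (\<lambda>v. frechet_derivative F (at (z, s)) (v, 0))" if "z \<in> U" "s \<in> I" for z s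
    using has_derivative_bounded_linear[OF F(1)] that
      bounded_linear_compose[OF _ bounded_linear_Pair[OF bounded_linear_ident bounded_linear_zero]]
    by blast
  have ap: "blinfun_apply (?D z s) = (\<lambda>v. frechet_derivative F (at (z, s)) (v, 0))" if "z \<in> U" "s \<in> I" for z s
    using bl[OF that] bounded_linear_Blinfun_apply by blast
  have D: "((\<lambda>z. F (z, s)) has_derivative blinfun_apply (?D z s)) (at z)" if "z \<in> U" "s \<in> I" for z s
    unfolding ap[OF that]
    by (rule has_derivative_compose[OF has_derivative_Pair[OF has_derivative_ident has_derivative_const] F(1)])
       (use that in auto)
  have contF: "continuous_on (U \<times> I) F" using F(3) Ck_on_imp_continuous_on by blast
  have contD: "continuous_on (U \<times> I) (\<lambda>(z, s). ?D z s)"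
  proof (rule continuous_on_blinfun_componentwise)
    fix i :: 'a assume "i \<in> Basis"
    show "continuous_on (U \<times> I) (\<lambda>x. blinfun_apply (case x of (z, s) \<Rightarrow> ?D z s) i)"
      using Ck_on_imp_continuous_on[OF F(2)[of "(i, 0)"]]
      by (rule continuous_on_eq) (auto simp: ap)
  qed
  have cp: "continuous_on A (Pair x)" for A :: "real set" and x :: 'a
    using continuous_on_Pair[OF continuous_on_const continuous_on_id, of A x] by simp
  have int: "(\<lambda>s. ?D z s) integrable_on {0..1}" if "z \<in> U" for z
  proof (rule integrable_continuous_real)
    show "continuous_on {0..1} (?D z)"
    proof -
      have "continuous_on {0..1} (\<lambda>s. (\<lambda>(z, s). ?D z s) (z, s))"
        by (rule continuous_on_compose2[OF contD cp]) (use that assms(3) in \<open>auto simp: subset_iff\<close>)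
      then show ?thesis by (simp only: prod.case)
    qed
  qed
  have der: "((\<lambda>z. integral {0..1} (\<lambda>s. F (z, s))) has_derivative
      (\<lambda>v. integral {0..1} (\<lambda>s. frechet_derivative F (at (z, s)) (v, 0)))) (at z)" if zU: "z \<in> U" for z
  proof -
    obtain e where e: "e > 0" "ball z e \<subseteq> U" using assms(1) zU open_contains_ball by blast
    have *: "((\<lambda>z. integral (cbox 0 1) (\<lambda>s. F (z, s))) has_derivative integral (cbox 0 1) (?D z)) (at z within ball z e)"
    proof (rule leibniz_rule[where f="\<lambda>z s. F (z, s)" and fx="?D" and a=0 and b=1])
      show "((\<lambda>x. F (x, t)) has_derivative blinfun_apply (?D x t)) (at x within ball z e)"
        if "x \<in> ball z e" "t \<in> cbox 0 1" for x t
        by (rule has_derivative_at_withinI[OF D]) (use that e assms(3) in \<open>auto simp: subset_iff\<close>)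
      show "(\<lambda>s. F (x, s)) integrable_on cbox 0 1" if "x \<in> ball z e" for x
      proof (rule integrable_continuous)
        show "continuous_on (cbox 0 1) (\<lambda>s. F (x, s))"
          by (rule continuous_on_compose2[OF contF cp]) (use that e assms(3) in \<open>auto simp: subset_iff\<close>)
      qed
      show "continuous_on (ball z e \<times> cbox 0 1) (\<lambda>(x, y). ?D x y)"
        by (rule continuous_on_subset[OF contD]) (use e assms(3) in auto)
    qed (use e in auto)
    have **: "blinfun_apply (integral (cbox 0 1) (?D z)) v =
        integral {0..1} (\<lambda>s. frechet_derivative F (at (z, s)) (v, 0))" for v
    proof -
      have "blinfun_apply (integral (cbox 0 1) (?D z)) v = integral {0..1} (\<lambda>s. blinfun_apply (?D z s) v)"
        using integral_linear[OF int[OF zU] blinfun.bounded_linear_left[of v]] by (simp add: o_def)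
      also have "\<dots> = integral {0..1} (\<lambda>s. frechet_derivative F (at (z, s)) (v, 0))"
        by (rule integral_cong) (use zU assms(3) in \<open>auto simp: ap\<close>)
      finally show ?thesis .
    qed
    have "((\<lambda>z. integral (cbox 0 1) (\<lambda>s. F (z, s))) has_derivative
      (\<lambda>v. integral {0..1} (\<lambda>s. frechet_derivative F (at (z, s)) (v, 0)))) (at z within ball z e)"
      by (rule has_derivative_eq_rhs[OF *]) (rule ext, rule **)
    then show ?thesis using e(1) by (simp only: at_within_open[OF _ open_ball] centre_in_ball cbox_interval)
  qed
  show ?case
    by (rule Ck_on_SucI[OF assms(1) der]) (auto intro!: Suc.IH F)
qed

section \<open>Calculus of smooth functions\<close>

lemma smooth_on_subset: "smooth_on S f \<Longrightarrow> T \<subseteq> S \<Longrightarrow> smooth_on T f"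
  unfolding smooth_on_def using Ck_on_subset by blast

lemma smooth_on_cong: "open S \<Longrightarrow> (\<And>x. x \<in> S \<Longrightarrow> f x = g x) \<Longrightarrow> smooth_on S f \<Longrightarrow> smooth_on S g"
  unfolding smooth_on_def using Ck_on_cong by blast

lemma smooth_on_local:
  assumes "\<And>x. x \<in> S \<Longrightarrow> \<exists>T. open T \<and> x \<in> T \<and> smooth_on T f"
  shows "smooth_on S f"
  using assms unfolding smooth_on_def by (metis Ck_on_local)

lemma smooth_on_imp_continuous_on: "smooth_on S f \<Longrightarrow> continuous_on S f"
  unfolding smooth_on_def using Ck_on_imp_continuous_on by blast

lemma smooth_on_has_derivative:
  "smooth_on S f \<Longrightarrow> x \<in> S \<Longrightarrow> (f has_derivative frechet_derivative f (at x)) (at x)"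
  unfolding smooth_on_def using Ck_on_SucE(1) by blast

lemma smooth_on_derivative: "smooth_on S f \<Longrightarrow> smooth_on S (\<lambda>x. frechet_derivative f (at x) v)"
  unfolding smooth_on_def using Ck_on_SucE(2) by blast

lemma smooth_on_const: "open S \<Longrightarrow> smooth_on S (\<lambda>x. c)"
  by (simp add: smooth_on_def Ck_on_const)

lemma smooth_on_linear: "open S \<Longrightarrow> bounded_linear h \<Longrightarrow> smooth_on S h"
  by (simp add: smooth_on_def Ck_on_linear)

lemma smooth_on_compose_linear:
  "open S \<Longrightarrow> bounded_linear h \<Longrightarrow> smooth_on S f \<Longrightarrow> smooth_on S (\<lambda>x. h (f x))"
  by (simp add: smooth_on_def Ck_on_compose_linear)

lemma smooth_on_add: "open S \<Longrightarrow> smooth_on S f \<Longrightarrow> smooth_on S g \<Longrightarrow> smooth_on S (\<lambda>x. f x + g x)"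
  by (simp add: smooth_on_def Ck_on_add)

lemma smooth_on_uminus: "open S \<Longrightarrow> smooth_on S f \<Longrightarrow> smooth_on S (\<lambda>x. - f x)"
  using smooth_on_compose_linear[OF _ bounded_linear_minus[OF bounded_linear_ident]] .

lemma smooth_on_diff:
  assumes "open S" "smooth_on S f" "smooth_on S g" shows "smooth_on S (\<lambda>x. f x - g x)"
  using smooth_on_add[OF assms(1,2) smooth_on_uminus[OF assms(1,3)]] by simp

lemma smooth_on_scaleR:
  "open S \<Longrightarrow> smooth_on S f \<Longrightarrow> smooth_on S g \<Longrightarrow> smooth_on S (\<lambda>x. f x *\<^sub>R g x)"
  by (simp add: smooth_on_def Ck_on_bilinear[OF _ bounded_bilinear_scaleR])

lemma smooth_on_mult:
  fixes f g :: "_ \<Rightarrow> real"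
  shows "open S \<Longrightarrow> smooth_on S f \<Longrightarrow> smooth_on S g \<Longrightarrow> smooth_on S (\<lambda>x. f x * g x)"
  by (simp add: smooth_on_def Ck_on_bilinear[OF _ bounded_bilinear_mult])

lemma smooth_on_sum:
  "open S \<Longrightarrow> (\<And>i. i \<in> I \<Longrightarrow> smooth_on S (f i)) \<Longrightarrow> smooth_on S (\<lambda>x. \<Sum>i\<in>I. f i x)"
  by (simp add: smooth_on_def Ck_on_sum)

lemma smooth_on_divide:
  fixes f g :: "_ \<Rightarrow> real"
  assumes "open S" "smooth_on S f" "smooth_on S g" "\<And>x. x \<in> S \<Longrightarrow> g x \<noteq> 0"
  shows "smooth_on S (\<lambda>x. f x / g x)"
proof -
  have "smooth_on S (\<lambda>x. inverse (g x))" using assms by (simp add: smooth_on_def Ck_on_inverse)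
  from smooth_on_mult[OF assms(1,2) this] show ?thesis by (simp add: divide_inverse)
qed

lemma smooth_on_sqrt:
  "open S \<Longrightarrow> smooth_on S f \<Longrightarrow> (\<And>x. x \<in> S \<Longrightarrow> f x > 0) \<Longrightarrow> smooth_on S (\<lambda>x. sqrt (f x))"
  by (simp add: smooth_on_def Ck_on_sqrt)

lemma smooth_on_compose:
  fixes f :: "'a::real_normed_vector \<Rightarrow> 'b::euclidean_space"
  shows "open S \<Longrightarrow> open T \<Longrightarrow> f ` S \<subseteq> T \<Longrightarrow> smooth_on S f \<Longrightarrow> smooth_on T h \<Longrightarrow>
    smooth_on S (\<lambda>x. h (f x))"
  unfolding smooth_on_def using Ck_on_compose by blast

section \<open>The division theorem and sign changes of square roots\<close>

lemma has_real_derivative_along_line: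
  assumes "(f has_derivative f') (at (w + s *\<^sub>R e))"
  shows "((\<lambda>s. f (w + s *\<^sub>R e)) has_real_derivative f' e) (at s)"
proof -
  have "((\<lambda>s. w + s *\<^sub>R e) has_derivative (\<lambda>h. h *\<^sub>R e)) (at s)"
    by (auto intro!: derivative_eq_intros)
  from has_derivative_compose[OF this assms]
  have "((\<lambda>s. f (w + s *\<^sub>R e)) has_derivative (\<lambda>h. f' (h *\<^sub>R e))) (at s)" .
  moreover have "(\<lambda>h. f' (h *\<^sub>R e)) = (*) (f' e)"
    using linear_scale[OF has_derivative_linear[OF assms]] by (auto simp: fun_eq_iff)
  ultimately show ?thesis by (simp add: has_field_derivative_def)
qed

text \<open>At a zero of the differentiable factor, mere convergence of the other factor is enough for the
  product rule.  This is the form in which the mean value theorem yields the derivative of an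
  implicit function: the second factor is a difference quotient of which only the limit is known.\<close>

lemma has_derivative_mult_vanishing:
  fixes \<phi> \<psi> :: "'a::real_normed_vector \<Rightarrow> real"
  assumes \<phi>: "(\<phi> has_derivative \<phi>') (at z)" "\<phi> z = 0" and \<psi>: "(\<psi> \<longlongrightarrow> c) (at z)"
  shows "((\<lambda>x. \<phi> x * \<psi> x) has_derivative (\<lambda>v. \<phi>' v * c)) (at z)"
proof -
  interpret bounded_linear \<phi>' using \<phi>(1) by (rule has_derivative_bounded_linear)
  obtain K where K: "\<And>v. norm (\<phi>' v) \<le> norm v * K" using bounded by blast
  let ?r = "\<lambda>y. (\<phi> y - \<phi> z - \<phi>' (y - z)) /\<^sub>R norm (y - z)"
  have r: "(?r \<longlongrightarrow> 0) (at z)" using \<phi>(1) by (simp add: has_derivative_at_within)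
  have b: "((\<lambda>y. \<phi>' (y - z) / norm (y - z) * (\<psi> y - c)) \<longlongrightarrow> 0) (at z)"
  proof (rule Lim_null_comparison)
    show "\<forall>\<^sub>F y in at z. norm (\<phi>' (y - z) / norm (y - z) * (\<psi> y - c)) \<le> K * \<bar>\<psi> y - c\<bar>"
      unfolding eventually_at_filter
    proof (rule always_eventually, intro allI impI)
      fix y assume "y \<noteq> z"
      then have "\<bar>\<phi>' (y - z)\<bar> / norm (y - z) \<le> K" using K[of "y - z"] by (simp add: field_simps)
      from this show "norm (\<phi>' (y - z) / norm (y - z) * (\<psi> y - c)) \<le> K * \<bar>\<psi> y - c\<bar>"
        using mult_right_mono[OF \<open>\<bar>\<phi>' (y - z)\<bar> / norm (y - z) \<le> K\<close> abs_ge_zero[of "\<psi> y - c"]] by (simp add: abs_mult)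
    qed
    show "((\<lambda>y. K * \<bar>\<psi> y - c\<bar>) \<longlongrightarrow> 0) (at z)"
      using tendsto_mult_right_zero[OF tendsto_rabs_zero[OF LIM_zero[OF \<psi>]]] .
  qed
  have "((\<lambda>y. ?r y * \<psi> y + \<phi>' (y - z) / norm (y - z) * (\<psi> y - c)) \<longlongrightarrow> 0 * c + 0) (at z)"
    by (intro tendsto_intros r b \<psi>)
  moreover have "?r y * \<psi> y + \<phi>' (y - z) / norm (y - z) * (\<psi> y - c) =
     (\<phi> y * \<psi> y - \<phi> z * \<psi> z - \<phi>' (y - z) * c) /\<^sub>R norm (y - z)" for y
    using \<phi>(2) by (simp add: divide_simps) (simp add: algebra_simps)
  ultimately have "((\<lambda>y. (\<phi> y * \<psi> y - \<phi> z * \<psi> z - \<phi>' (y - z) * c) /\<^sub>R norm (y - z)) \<longlongrightarrow> 0) (at z)"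
    by simp
  then show ?thesis
    by (simp add: has_derivative_at_within bounded_linear_mult_left bounded_linear_compose[OF bounded_linear_mult_left bounded_linear_axioms])
qed

definition perp :: "'a::real_inner \<Rightarrow> 'a \<Rightarrow> 'a" where
  "perp e z = z - (z \<bullet> e) *\<^sub>R e"

lemma bounded_linear_perp: "bounded_linear (perp e)"
  unfolding perp_def[abs_def] by (intro bounded_linear_intros)

lemma perp_add_axis: "perp e z + (z \<bullet> e) *\<^sub>R e = z"
  by (simp add: perp_def)

lemma perp_inner: "norm e = 1 \<Longrightarrow> perp e z \<bullet> e = 0"
  by (simp add: perp_def inner_diff_left norm_eq_1)

lemma inner_on_line: "norm e = 1 \<Longrightarrow> (perp e z + s *\<^sub>R e) \<bullet> e = s"
  by (simp add: perp_inner inner_add_left norm_eq_1)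

lemma perp_on_line: "norm e = 1 \<Longrightarrow> perp e (perp e z + s *\<^sub>R e) = perp e z"
  unfolding perp_def[of e "perp e z + s *\<^sub>R e"] inner_on_line by simp

text \<open>Open cylinders with axis \<open>e\<close>: segments in direction \<open>e\<close> over a ball of the orthogonal complement.  They are the
  neighbourhoods over which a hypersurface transversal to \<open>e\<close> is a graph.\<close>

definition cylinder :: "'a::real_inner \<Rightarrow> real \<Rightarrow> real \<Rightarrow> 'a set" where
  "cylinder e \<epsilon> \<delta> = {z. \<bar>z \<bullet> e\<bar> < \<epsilon> \<and> norm (perp e z) < \<delta>}"

lemma open_cylinder: "open (cylinder e \<epsilon> \<delta>)"
  unfolding cylinder_def perp_def
  by (intro open_Collect_conj open_Collect_less continuous_intros)

lemma line_in_cylinder: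
  "norm e = 1 \<Longrightarrow> z \<in> cylinder e \<epsilon> \<delta> \<Longrightarrow> \<bar>s\<bar> < \<epsilon> \<Longrightarrow> perp e z + s *\<^sub>R e \<in> cylinder e \<epsilon> \<delta>"
  by (simp add: cylinder_def inner_on_line perp_on_line)

lemma mean_value_between:
  fixes f f' :: "real \<Rightarrow> real"
  assumes "\<And>x. min a b \<le> x \<Longrightarrow> x \<le> max a b \<Longrightarrow> (f has_real_derivative f' x) (at x)"
  shows "\<exists>\<xi>. min a b \<le> \<xi> \<and> \<xi> \<le> max a b \<and> f b - f a = (b - a) * f' \<xi>"
proof (cases a b rule: linorder_cases)
  case less
  then show ?thesis using MVT2[OF less, of f f'] assms by (auto intro: less_imp_le)
next
  case equal
  then show ?thesis by auto
next
  case greater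
  obtain \<xi> where "b < \<xi>" "\<xi> < a" "f a - f b = (a - b) * f' \<xi>"
    using MVT2[OF greater, of f f'] assms greater by auto
  then show ?thesis using greater by (intro exI[of _ \<xi>]) (auto simp: algebra_simps)
qed

text \<open>Let \<open>\<gamma>\<close> be the height, along \<open>e\<close>, of the zero of \<open>t\<close> on the line through \<open>z\<close>.  The mean value
  theorem on such lines gives
  $\gamma(y) - \gamma(z) = - t(\pi y + \gamma(z) e) / D_e t(\xi)$, where $\pi$ is the projection along \<open>e\<close>.
  With $D_e t \ge m$ this shows that \<open>\<gamma>\<close> is continuous, then, as $\xi$ tends to the zero, that it is
  differentiable with the usual formula.  The formula expresses the derivative of \<open>\<gamma>\<close> by \<open>\<gamma>\<close> itself, so
  each order of differentiability gives the next one.\<close>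

lemma smooth_on_implicit_function:
  fixes t \<gamma> :: "'a::euclidean_space \<Rightarrow> real"
  assumes e: "norm e = 1" and m: "m > 0"
    and t: "smooth_on (cylinder e \<epsilon> \<delta>) t"
    and mono: "\<And>z. z \<in> cylinder e \<epsilon> \<delta> \<Longrightarrow> m \<le> frechet_derivative t (at z) e"
    and \<gamma>: "\<And>z. z \<in> cylinder e \<epsilon> \<delta> \<Longrightarrow> \<bar>\<gamma> z\<bar> < \<epsilon>"
    and zero: "\<And>z. z \<in> cylinder e \<epsilon> \<delta> \<Longrightarrow> t (perp e z + \<gamma> z *\<^sub>R e) = 0"
  shows "smooth_on (cylinder e \<epsilon> \<delta>) \<gamma>"
proof -
  let ?N = "cylinder e \<epsilon> \<delta>"
  define \<pi> where "\<pi> = perp e"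
  define \<kappa> where "\<kappa> z = \<pi> z + \<gamma> z *\<^sub>R e" for z
  note N = open_cylinder[of e \<epsilon> \<delta>]
  note inN = line_in_cylinder[OF e, folded \<pi>_def] and bl\<pi> = bounded_linear_perp[of e, folded \<pi>_def]
  have \<kappa>N: "\<kappa> z \<in> ?N" if "z \<in> ?N" for z using inN[OF that \<gamma>[OF that]] by (simp add: \<kappa>_def)
  have t0: "t (\<kappa> z) = 0" if "z \<in> ?N" for z using zero[OF that] by (simp add: \<kappa>_def \<pi>_def)
  have Dt: "(t has_derivative frechet_derivative t (at z)) (at z)" if "z \<in> ?N" for z
    using smooth_on_has_derivative[OF t that] .
  have D: "(\<gamma> has_derivative (\<lambda>v. - frechet_derivative t (at (\<kappa> z)) (\<pi> v) *
      inverse (frechet_derivative t (at (\<kappa> z)) e))) (at z)" if zN: "z \<in> ?N" for z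
  proof -
    let ?d = "\<lambda>z. frechet_derivative t (at z) e"
    have "\<exists>\<xi>. \<bar>\<xi>\<bar> < \<epsilon> \<and> \<bar>\<xi> - \<gamma> z\<bar> \<le> \<bar>\<gamma> y - \<gamma> z\<bar> \<and>
        - t (\<pi> y + \<gamma> z *\<^sub>R e) = (\<gamma> y - \<gamma> z) * ?d (\<pi> y + \<xi> *\<^sub>R e)" if yN: "y \<in> ?N" for y
    proof -
      have der: "((\<lambda>s. t (\<pi> y + s *\<^sub>R e)) has_real_derivative ?d (\<pi> y + s *\<^sub>R e)) (at s)"
        if "\<bar>s\<bar> < \<epsilon>" for s
        using has_real_derivative_along_line Dt[OF inN[OF yN that]] by blast
      have "\<exists>\<xi>. min (\<gamma> z) (\<gamma> y) \<le> \<xi> \<and> \<xi> \<le> max (\<gamma> z) (\<gamma> y) \<and>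
          t (\<pi> y + \<gamma> y *\<^sub>R e) - t (\<pi> y + \<gamma> z *\<^sub>R e) = (\<gamma> y - \<gamma> z) * ?d (\<pi> y + \<xi> *\<^sub>R e)"
        by (rule mean_value_between[OF der]) (use \<gamma>[OF zN] \<gamma>[OF yN] in auto)
      then obtain \<xi> where \<xi>: "min (\<gamma> z) (\<gamma> y) \<le> \<xi>" "\<xi> \<le> max (\<gamma> z) (\<gamma> y)"
        "- t (\<pi> y + \<gamma> z *\<^sub>R e) = (\<gamma> y - \<gamma> z) * ?d (\<pi> y + \<xi> *\<^sub>R e)"
        using t0[OF yN] by (auto simp: \<kappa>_def)
      have "\<bar>\<xi>\<bar> < \<epsilon>" "\<bar>\<xi> - \<gamma> z\<bar> \<le> \<bar>\<gamma> y - \<gamma> z\<bar>"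
        using \<xi>(1,2) \<gamma>[OF zN] \<gamma>[OF yN] by auto
      then show ?thesis using \<xi>(3) by blast
    qed
    then obtain \<xi> where \<xi>: "\<And>y. y \<in> ?N \<Longrightarrow> \<bar>\<xi> y\<bar> < \<epsilon>"
        "\<And>y. y \<in> ?N \<Longrightarrow> \<bar>\<xi> y - \<gamma> z\<bar> \<le> \<bar>\<gamma> y - \<gamma> z\<bar>"
        "\<And>y. y \<in> ?N \<Longrightarrow> - t (\<pi> y + \<gamma> z *\<^sub>R e) = (\<gamma> y - \<gamma> z) * ?d (\<pi> y + \<xi> y *\<^sub>R e)"
      by metis
    let ?\<phi> = "\<lambda>y. - t (\<pi> y + \<gamma> z *\<^sub>R e)" and ?\<psi> = "\<lambda>y. inverse (?d (\<pi> y + \<xi> y *\<^sub>R e))"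
    have \<phi>: "(?\<phi> has_derivative (\<lambda>v. - frechet_derivative t (at (\<kappa> z)) (\<pi> v))) (at z)"
    proof -
      have "((\<lambda>y. \<pi> y + \<gamma> z *\<^sub>R e) has_derivative \<pi>) (at z)"
        using has_derivative_add[OF bounded_linear_imp_has_derivative[OF bl\<pi>] has_derivative_const] by simp
      from has_derivative_compose[OF this] Dt[OF \<kappa>N[OF zN]] show ?thesis
        by (intro has_derivative_minus) (simp add: \<kappa>_def)
    qed
    have d_pos: "?d (\<pi> y + \<xi> y *\<^sub>R e) \<ge> m" if "y \<in> ?N" for y using mono inN \<xi>(1) that by blast
    have \<gamma>eq: "\<gamma> y = \<gamma> z + ?\<phi> y * ?\<psi> y" if "y \<in> ?N" for y
      using \<xi>(3)[OF that] d_pos[OF that] m by (simp add: field_simps)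
    have evN: "\<forall>\<^sub>F y in at z. y \<in> ?N" using eventually_at_topological N zN by blast
    have \<phi>0: "(?\<phi> \<longlongrightarrow> 0) (at z)"
    proof -
      have "?\<phi> z = 0" using t0[OF zN] by (simp add: \<kappa>_def)
      then show ?thesis using has_derivative_continuous[OF \<phi>] by (simp add: continuous_at)
    qed
    have \<gamma>0: "((\<lambda>y. \<gamma> y - \<gamma> z) \<longlongrightarrow> 0) (at z)"
    proof (rule Lim_null_comparison)
      show "\<forall>\<^sub>F y in at z. norm (\<gamma> y - \<gamma> z) \<le> \<bar>?\<phi> y\<bar> * inverse m"
        using evN
      proof eventually_elim
        case (elim y)
        have "\<bar>?\<psi> y\<bar> \<le> inverse m" using d_pos[OF elim] m by (simp add: le_imp_inverse_le)
        then show ?case unfolding \<gamma>eq[OF elim] by (simp add: abs_mult mult_left_mono del: abs_inverse)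
      qed
      show "((\<lambda>y. \<bar>?\<phi> y\<bar> * inverse m) \<longlongrightarrow> 0) (at z)"
        using tendsto_mult_left_zero[OF tendsto_rabs_zero[OF \<phi>0]] .
    qed
    have "((\<lambda>y. \<xi> y - \<gamma> z) \<longlongrightarrow> 0) (at z)"
    proof (rule Lim_null_comparison[OF _ tendsto_rabs_zero[OF \<gamma>0]])
      show "\<forall>\<^sub>F y in at z. norm (\<xi> y - \<gamma> z) \<le> \<bar>\<gamma> y - \<gamma> z\<bar>"
        using evN by eventually_elim (use \<xi>(2) in auto)
    qed
    then have "(\<xi> \<longlongrightarrow> \<gamma> z) (at z)" by (simp add: LIM_zero_iff)
    moreover have "(\<pi> \<longlongrightarrow> \<pi> z) (at z)"
      using linear_continuous_at[OF bl\<pi>] by (simp add: continuous_at)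
    ultimately have "((\<lambda>y. \<pi> y + \<xi> y *\<^sub>R e) \<longlongrightarrow> \<kappa> z) (at z)"
      unfolding \<kappa>_def by (intro tendsto_intros)
    moreover have "continuous (at (\<kappa> z)) ?d"
      using smooth_on_imp_continuous_on[OF smooth_on_derivative[OF t]] N \<kappa>N[OF zN]
        continuous_on_eq_continuous_at by blast
    ultimately have "((\<lambda>y. ?d (\<pi> y + \<xi> y *\<^sub>R e)) \<longlongrightarrow> ?d (\<kappa> z)) (at z)"
      using isCont_tendsto_compose by blast
    then have \<psi>: "(?\<psi> \<longlongrightarrow> inverse (?d (\<kappa> z))) (at z)"
      by (rule tendsto_inverse) (use mono[OF \<kappa>N[OF zN]] m in auto)
    have "((\<lambda>y. \<gamma> z + ?\<phi> y * ?\<psi> y) has_derivative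
        (\<lambda>v. - frechet_derivative t (at (\<kappa> z)) (\<pi> v) * inverse (?d (\<kappa> z)))) (at z)"
      using has_derivative_add[OF has_derivative_const has_derivative_mult_vanishing[OF \<phi> _ \<psi>]] t0[OF zN]
      by (simp add: \<kappa>_def)
    then show ?thesis
      by (rule has_derivative_transform_within_open[OF _ N zN]) (use \<gamma>eq in force)
  qed
  have t_Ck: "Ck_on n ?N (\<lambda>z. frechet_derivative t (at z) v)" for n v
    using smooth_on_derivative[OF t] by (simp add: smooth_on_def)
  have "Ck_on n ?N \<gamma>" for n
  proof (induction n)
    case 0
    show ?case using has_derivative_continuous[OF D] by (simp add: continuous_at_imp_continuous_on)
  next
    case (Suc n)
    have \<kappa>: "Ck_on n ?N \<kappa>" unfolding \<kappa>_def
      by (intro Ck_on_add N Ck_on_linear bl\<pi> Suc Ck_on_compose_linear[OF N bounded_linear_scaleR_left])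
    have c: "Ck_on n ?N (\<lambda>z. frechet_derivative t (at (\<kappa> z)) v)" for v
      by (rule Ck_on_compose[OF N N _ \<kappa> t_Ck]) (use \<kappa>N in auto)
    show ?case
    proof (rule Ck_on_SucI[OF N D])
      fix v
      show "Ck_on n ?N (\<lambda>z. - frechet_derivative t (at (\<kappa> z)) (\<pi> v) *
              inverse (frechet_derivative t (at (\<kappa> z)) e))"
        using mono \<kappa>N m
        by (intro Ck_on_bilinear[OF N bounded_bilinear_mult] Ck_on_inverse N c
          Ck_on_compose_linear[OF N bounded_linear_minus[OF bounded_linear_ident]]) force
    qed
  qed
  then show ?thesis by (simp add: smooth_on_def)
qed

text \<open>Hadamard's lemma for the graph \<open>z \<bullet> e = \<gamma> z\<close>: by the fundamental theorem of calculus on the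
  segment from the graph to \<open>z\<close>, the quotient is the mean of $D_e f$ over that segment, and a parameter
  integral of a smooth function is smooth.\<close>

lemma smooth_on_division:
  fixes f \<gamma> :: "'a::euclidean_space \<Rightarrow> real"
  assumes e: "norm e = 1"
    and f: "smooth_on (cylinder e \<epsilon> \<delta>) f"
    and \<gamma>: "smooth_on (cylinder e \<epsilon> \<delta>) \<gamma>" "\<And>z. z \<in> cylinder e \<epsilon> \<delta> \<Longrightarrow> \<bar>\<gamma> z\<bar> < \<epsilon>"
    and zero: "\<And>z. z \<in> cylinder e \<epsilon> \<delta> \<Longrightarrow> f (perp e z + \<gamma> z *\<^sub>R e) = 0"
  obtains g where "smooth_on (cylinder e \<epsilon> \<delta>) g"
    and "\<And>z. z \<in> cylinder e \<epsilon> \<delta> \<Longrightarrow> f z = (z \<bullet> e - \<gamma> z) * g z"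
    and "\<And>z. z \<in> cylinder e \<epsilon> \<delta> \<Longrightarrow> z \<bullet> e = \<gamma> z \<Longrightarrow> g z = frechet_derivative f (at z) e"
proof
  let ?N = "cylinder e \<epsilon> \<delta>"
  define \<pi> where "\<pi> = perp e"
  note N = open_cylinder[of e \<epsilon> \<delta>]
  note inN = line_in_cylinder[OF e, folded \<pi>_def] and bl\<pi> = bounded_linear_perp[of e, folded \<pi>_def]
    and z_eq = perp_add_axis[of e, folded \<pi>_def]
  let ?Df = "\<lambda>w. frechet_derivative f (at w) e"
  \<comment> \<open>the height at time \<open>s\<close> on the segment from the graph to \<open>z\<close>\<close>
  define h where "h z s = (1 - s) * \<gamma> z + s * (z \<bullet> e)" for z s
  define g where "g z = integral {0..1} (\<lambda>s. ?Df (\<pi> z + h z s *\<^sub>R e))" for z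
  show "smooth_on ?N g"
  proof (rule smooth_on_local)
    fix z0 assume z0: "z0 \<in> ?N"
    \<comment> \<open>a height between those of the end points of the segment at \<open>z0\<close> and that of the cylinder\<close>
    define c where "c = (max \<bar>\<gamma> z0\<bar> \<bar>z0 \<bullet> e\<bar> + \<epsilon>) / 2"
    have c: "\<bar>\<gamma> z0\<bar> < c" "\<bar>z0 \<bullet> e\<bar> < c" "c < \<epsilon>" "0 < c"
      using \<gamma>(2)[OF z0] z0 by (auto simp: c_def cylinder_def)
    define U where "U = ?N \<inter> {z. \<bar>z \<bullet> e\<bar> < c} \<inter> (?N \<inter> (\<lambda>z. \<bar>\<gamma> z\<bar>) -` {..<c})"
    have "continuous_on ?N (\<lambda>z. \<bar>\<gamma> z\<bar>)"
      using smooth_on_imp_continuous_on[OF \<gamma>(1)] by (intro continuous_intros)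
    note pre = continuous_open_preimage[OF this N open_lessThan]
    have strip: "open {z. \<bar>z \<bullet> e\<bar> < c}" by (intro open_Collect_less continuous_intros)
    have oU: "open U" unfolding U_def by (rule open_Int[OF open_Int[OF N strip] pre])
    \<comment> \<open>the segment stays in the cylinder when prolonged by the fraction \<open>\<eta>\<close> at both ends\<close>
    define \<eta> where "\<eta> = (\<epsilon> / c - 1) / 2"
    have \<eta>: "\<eta> > 0" "(1 + 2 * \<eta>) * c = \<epsilon>" using c by (simp_all add: \<eta>_def field_simps)
    let ?I = "{-\<eta><..<1+\<eta>}"
    have hlt: "\<bar>h z s\<bar> < \<epsilon>" if "z \<in> U" "s \<in> ?I" for z s
    proof -
      have "\<bar>1 - s\<bar> + \<bar>s\<bar> \<le> 1 + 2 * \<eta>" using that \<eta> by auto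
      have "\<bar>h z s\<bar> \<le> \<bar>1 - s\<bar> * \<bar>\<gamma> z\<bar> + \<bar>s\<bar> * \<bar>z \<bullet> e\<bar>"
        unfolding h_def by (metis abs_mult abs_triangle_ineq)
      also have "\<dots> < \<bar>1 - s\<bar> * c + \<bar>s\<bar> * c"
      proof (cases "s = 0")
        case True then show ?thesis using that by (simp add: U_def)
      next
        case False
        then have "\<bar>s\<bar> * \<bar>z \<bullet> e\<bar> < \<bar>s\<bar> * c" using that by (simp add: U_def)
        moreover have "\<bar>1 - s\<bar> * \<bar>\<gamma> z\<bar> \<le> \<bar>1 - s\<bar> * c" using that by (intro mult_left_mono) (auto simp: U_def)
        ultimately show ?thesis by linarith
      qed
      also have "\<dots> = (\<bar>1 - s\<bar> + \<bar>s\<bar>) * c" by (simp add: algebra_simps)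
      also have "\<dots> \<le> (1 + 2 * \<eta>) * c" using \<open>\<bar>1 - s\<bar> + \<bar>s\<bar> \<le> 1 + 2 * \<eta>\<close> c by (intro mult_right_mono) auto
      finally show ?thesis using \<eta> by simp
    qed
    have UN: "U \<subseteq> ?N" by (auto simp: U_def)
    have oUI: "open (U \<times> ?I)" by (intro open_Times oU) auto
    have fstU: "smooth_on (U \<times> ?I) (\<lambda>p. \<gamma> (fst p))"
      by (rule smooth_on_compose[OF oUI oU _ smooth_on_linear[OF oUI bounded_linear_fst] smooth_on_subset[OF \<gamma>(1) UN]]) auto
    have sndI: "smooth_on (U \<times> ?I) snd" by (rule smooth_on_linear[OF oUI bounded_linear_snd])
    have inner: "smooth_on (U \<times> ?I) (\<lambda>p. fst p \<bullet> e)"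
      by (rule smooth_on_compose_linear[OF oUI bounded_linear_inner_left
            smooth_on_linear[OF oUI bounded_linear_fst]])
    have proj: "smooth_on (U \<times> ?I) (\<lambda>p. \<pi> (fst p))"
      by (rule smooth_on_compose_linear[OF oUI bl\<pi> smooth_on_linear[OF oUI bounded_linear_fst]])
    have hs: "smooth_on (U \<times> ?I) (\<lambda>p. h (fst p) (snd p))" unfolding h_def
      by (rule smooth_on_add smooth_on_mult smooth_on_diff oUI fstU sndI inner smooth_on_const)+
    have ps: "smooth_on (U \<times> ?I) (\<lambda>p. \<pi> (fst p) + h (fst p) (snd p) *\<^sub>R e)"
      by (rule smooth_on_add smooth_on_scaleR oUI hs proj smooth_on_const)+
    have "smooth_on (U \<times> ?I) (\<lambda>p. ?Df (\<pi> (fst p) + h (fst p) (snd p) *\<^sub>R e))"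
      by (rule smooth_on_compose[OF oUI N _ ps smooth_on_derivative[OF f]]) (use inN hlt UN in auto)
    then have "Ck_on n U (\<lambda>z. integral {0..1} (\<lambda>s. ?Df (\<pi> (fst (z, s)) + h (fst (z, s)) (snd (z, s)) *\<^sub>R e)))" for n
      by (intro Ck_on_integral[OF oU, of ?I]) (use \<eta> in \<open>auto simp: smooth_on_def\<close>)
    then have "smooth_on U g" by (simp add: smooth_on_def g_def[abs_def])
    moreover have "z0 \<in> U" using c z0 by (auto simp: U_def)
    ultimately show "\<exists>T. open T \<and> z0 \<in> T \<and> smooth_on T g" using oU by blast
  qed
  show "f z = (z \<bullet> e - \<gamma> z) * g z" if z: "z \<in> ?N" for z
  proof -
    have hlt: "\<bar>h z s\<bar> < \<epsilon>" if "s \<in> {0..1}" for s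
    proof -
      have "\<bar>z \<bullet> e\<bar> < \<epsilon>" using z by (simp add: cylinder_def)
      then have "h z s \<in> {-\<epsilon><..<\<epsilon>}" 
        using convexD[OF convex_real_interval(8)[of "-\<epsilon>" \<epsilon>], of "\<gamma> z" "z \<bullet> e" "1 - s" s] \<gamma>(2)[OF z] that
        by (auto simp: h_def abs_less_iff)
      then show ?thesis by (simp add: abs_less_iff)
    qed
    have "((\<lambda>s. f (\<pi> z + h z s *\<^sub>R e)) has_real_derivative ?Df (\<pi> z + h z s *\<^sub>R e) * (z \<bullet> e - \<gamma> z)) (at s)"
      if "s \<in> {0..1}" for s
    proof -
      have "((\<lambda>s. f (\<pi> z + s *\<^sub>R e)) has_real_derivative ?Df (\<pi> z + h z s *\<^sub>R e)) (at (h z s))"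
        using has_real_derivative_along_line smooth_on_has_derivative[OF f inN[OF z hlt[OF that]]] by blast
      moreover have "(h z has_real_derivative (z \<bullet> e - \<gamma> z)) (at s)"
        unfolding h_def[abs_def] by (auto intro!: derivative_eq_intros)
      ultimately show ?thesis by (rule DERIV_chain2)
    qed
    then have "((\<lambda>s. ?Df (\<pi> z + h z s *\<^sub>R e) * (z \<bullet> e - \<gamma> z)) has_integral
        f (\<pi> z + h z 1 *\<^sub>R e) - f (\<pi> z + h z 0 *\<^sub>R e)) {0..1}"
      by (intro fundamental_theorem_of_calculus)
        (auto simp: has_real_derivative_iff_has_vector_derivative[symmetric] intro: has_field_derivative_at_within)
    moreover have "f (\<pi> z + h z 0 *\<^sub>R e) = 0" using zero[OF z] by (simp add: h_def \<pi>_def)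
    moreover have "f (\<pi> z + h z 1 *\<^sub>R e) = f z" by (simp add: h_def z_eq)
    ultimately have "((\<lambda>s. ?Df (\<pi> z + h z s *\<^sub>R e) * (z \<bullet> e - \<gamma> z)) has_integral f z) {0..1}"
      by simp
    from integral_unique[OF this] show ?thesis by (simp add: g_def mult.commute)
  qed
  show "g z = ?Df z" if "z \<in> ?N" "z \<bullet> e = \<gamma> z" for z
  proof -
    have "h z s = z \<bullet> e" for s using that by (simp add: h_def algebra_simps)
    then show ?thesis by (simp add: g_def z_eq)
  qed
qed

lemma strict_mono_along_line:
  fixes t :: "'a::euclidean_space \<Rightarrow> real"
  assumes "convex S" "\<And>z. z \<in> S \<Longrightarrow> (t has_derivative t' z) (at z)" "\<And>z. z \<in> S \<Longrightarrow> t' z e > 0"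
    and "w + a *\<^sub>R e \<in> S" "w + b *\<^sub>R e \<in> S" "a < b"
  shows "t (w + a *\<^sub>R e) < t (w + b *\<^sub>R e)"
proof (rule DERIV_pos_imp_increasing[OF \<open>a < b\<close>, of "\<lambda>s. t (w + s *\<^sub>R e)"])
  fix s assume s: "a \<le> s" "s \<le> b"
  define l where "l = (s - a) / (b - a)"
  have l: "0 \<le> l" "l \<le> 1" using s \<open>a < b\<close> by (auto simp: l_def)
  have "s = a + l * (b - a)" using \<open>a < b\<close> by (simp add: l_def)
  then have "w + s *\<^sub>R e = (1 - l) *\<^sub>R (w + a *\<^sub>R e) + l *\<^sub>R (w + b *\<^sub>R e)"
    by (simp only:) (simp add: algebra_simps)
  then have "w + s *\<^sub>R e \<in> S" using convexD_alt[OF assms(1,4,5) l] by simp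
  then show "\<exists>y. ((\<lambda>s. t (w + s *\<^sub>R e)) has_real_derivative y) (at s) \<and> 0 < y"
    using has_real_derivative_along_line[OF assms(2)] assms(3) by blast
qed

lemma connected_nonzero_sign:
  fixes F :: "'a::topological_space \<Rightarrow> real"
  assumes "connected S" "continuous_on S F" "\<And>x. x \<in> S \<Longrightarrow> F x \<noteq> 0"
  shows "(\<forall>x\<in>S. F x > 0) \<or> (\<forall>x\<in>S. F x < 0)"
proof (rule ccontr)
  assume "\<not> ?thesis"
  then obtain x y where xy: "x \<in> S" "F x < 0" "y \<in> S" "F y > 0"
    using assms(3) by (meson linorder_neqE_linordered_idom)
  have "connected (F ` S)" using assms by (intro connected_continuous_image)
  then have "{F x..F y} \<subseteq> F ` S" using xy by (intro connected_contains_Icc) auto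
  then have "0 \<in> F ` S" using xy by (auto simp: subset_iff)
  then show False using assms(3) by auto
qed

lemma eventually_nhds_isCont:
  fixes f :: "'a::t2_space \<Rightarrow> real"
  assumes "isCont f a"
  shows "f a > c \<Longrightarrow> \<forall>\<^sub>F x in nhds a. f x > c" and "f a < c \<Longrightarrow> \<forall>\<^sub>F x in nhds a. f x < c"
  using assms order_tendstoD[of f "f a" "nhds a"]
  by (auto simp: isCont_def tendsto_at_iff_tendsto_nhds)

text \<open>A square root of a smooth function $A = P^2$ may have a kink where it vanishes, like $|x|$.
  It has none if it changes sign and \<open>A\<close> has a nondegenerate second derivative across the zero.

  Every zero of \<open>P\<close> minimises \<open>A\<close>, so it is a zero of $t = D_e A$.  As $D_e t > 0$ near the
  origin, each line in direction \<open>e\<close> contains at most one zero of \<open>t\<close>, and since \<open>P\<close> changes sign along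
  that line, it contains a zero of \<open>P\<close>.  So the zeros of \<open>P\<close> near the origin are the zeros of \<open>t\<close>, and these form a
  smooth graph $\zeta = 0$ with $\zeta(z) = z \cdot e - \Gamma(z)$.  Dividing twice by \<open>\<zeta>\<close> gives
  $A = \zeta^2 h$ with $h > 0$, and the signs of \<open>P\<close> on the two sides give $P = \zeta \sqrt h$.
  If $P Q$ is smooth too, it vanishes on the graph, so it equals $\zeta k$ with \<open>k\<close> smooth and
  $Q = k / \sqrt h$.\<close>

lemma smooth_at_sign_change_of_root:
  fixes P Q :: "'a::euclidean_space \<Rightarrow> real"
  assumes e: "norm e = 1" and U: "open U" "0 \<in> U"
    and P: "continuous_on U P" and Q: "continuous_on U Q"
    and PP: "smooth_on U (\<lambda>z. P z * P z)" and PQ: "smooth_on U (\<lambda>z. P z * Q z)"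
    and pos: "frechet_derivative (\<lambda>z. frechet_derivative (\<lambda>z. P z * P z) (at z) e) (at 0) e > 0"
    and sign: "\<forall>\<^sub>F s in at_right 0. P (s *\<^sub>R e) > 0 \<and> P (- s *\<^sub>R e) < 0"
  shows "\<exists>T. open T \<and> 0 \<in> T \<and> smooth_on T P \<and> smooth_on T Q"
proof -
  define A where "A z = P z * P z" for z
  define t where "t z = frechet_derivative A (at z) e" for z
  define dt where "dt z = frechet_derivative t (at z) e" for z
  have A: "smooth_on U A" using PP by (simp add: A_def[abs_def])
  have t: "smooth_on U t" unfolding t_def[abs_def] by (rule smooth_on_derivative[OF A])
  have dts: "smooth_on U dt" unfolding dt_def[abs_def] by (rule smooth_on_derivative[OF t])
  define m where "m = dt 0 / 2"
  have dt0: "dt 0 > 0" using pos by (simp add: dt_def t_def[abs_def] A_def[abs_def])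
  then have m: "m > 0" by (simp add: m_def)
  have "isCont dt 0"
    using smooth_on_imp_continuous_on[OF dts] U continuous_on_eq_continuous_at by blast
  then have "\<forall>\<^sub>F z in nhds 0. dt z > m"
    by (rule eventually_nhds_isCont) (use dt0 in \<open>simp add: m_def\<close>)
  moreover have "\<forall>\<^sub>F z in nhds 0. z \<in> U" using U eventually_nhds by blast
  ultimately have "\<forall>\<^sub>F z in nhds 0. z \<in> U \<and> dt z > m" by eventually_elim auto
  then obtain R where R: "R > 0" "\<And>z. norm z < R \<Longrightarrow> z \<in> U \<and> dt z > m"
    unfolding eventually_nhds_metric by (auto simp: dist_norm)

  obtain s0 where s0: "s0 > 0" "\<And>s. 0 < s \<Longrightarrow> s < s0 \<Longrightarrow> P (s *\<^sub>R e) > 0 \<and> P (- s *\<^sub>R e) < 0"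
    using sign unfolding eventually_at_right_field by auto
  define \<epsilon> where "\<epsilon> = min s0 R / 2"
  have \<epsilon>: "0 < \<epsilon>" "\<epsilon> < s0" "2 * \<epsilon> \<le> R" using s0 R by (auto simp: \<epsilon>_def)
  have end_signs: "P (\<epsilon> *\<^sub>R e) > 0" "P (- \<epsilon> *\<^sub>R e) < 0" using s0(2)[of \<epsilon>] \<epsilon> by auto
  have inU: "\<epsilon> *\<^sub>R e \<in> U" "- \<epsilon> *\<^sub>R e \<in> U" using R(2)[of "\<epsilon> *\<^sub>R e"] R(2)[of "- \<epsilon> *\<^sub>R e"] \<epsilon> e by auto
  have Pc: "isCont P z" if "z \<in> U" for z using P U(1) that continuous_on_eq_continuous_at by blast
  have "\<forall>\<^sub>F w in nhds 0. P (w + \<epsilon> *\<^sub>R e) > 0"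
  proof -
    have "isCont (\<lambda>w. P (w + \<epsilon> *\<^sub>R e)) 0" using Pc[OF inU(1)]
      by (intro continuous_at_compose[of _ "\<lambda>w. w + \<epsilon> *\<^sub>R e" P, unfolded o_def] continuous_intros) auto
    then show ?thesis using end_signs by (intro eventually_nhds_isCont) auto
  qed
  moreover have "\<forall>\<^sub>F w in nhds 0. P (w + (- \<epsilon>) *\<^sub>R e) < 0"
  proof -
    have "isCont (\<lambda>w. P (w + (- \<epsilon>) *\<^sub>R e)) 0" using Pc[OF inU(2)]
      by (intro continuous_at_compose[of _ "\<lambda>w. w + (- \<epsilon>) *\<^sub>R e" P, unfolded o_def] continuous_intros) auto
    then show ?thesis using end_signs by (intro eventually_nhds_isCont) auto
  qed
  ultimately have "\<forall>\<^sub>F w in nhds 0. P (w + \<epsilon> *\<^sub>R e) > 0 \<and> P (w + (- \<epsilon>) *\<^sub>R e) < 0"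
    by eventually_elim auto
  then obtain \<delta>0 where \<delta>0: "\<delta>0 > 0"
      "\<And>w. norm w < \<delta>0 \<Longrightarrow> P (w + \<epsilon> *\<^sub>R e) > 0 \<and> P (w + (- \<epsilon>) *\<^sub>R e) < 0"
    unfolding eventually_nhds_metric by (auto simp: dist_norm)
  define \<delta> where "\<delta> = min \<delta>0 (R / 2)"
  have \<delta>: "\<delta> > 0" "\<delta> \<le> \<delta>0" "\<delta> \<le> R / 2" using \<delta>0 R by (auto simp: \<delta>_def)

  let ?N = "cylinder e \<epsilon> \<delta>"
  note N = open_cylinder[of e \<epsilon> \<delta>]
  define \<pi> where "\<pi> = perp e"
  note z_eq = perp_add_axis[of e, folded \<pi>_def] and line_e = inner_on_line[OF e, folded \<pi>_def]
    and \<pi>\<pi> = perp_on_line[OF e, folded \<pi>_def] and inN = line_in_cylinder[OF e, folded \<pi>_def]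
  have N_iff: "z \<in> ?N \<longleftrightarrow> \<bar>z \<bullet> e\<bar> < \<epsilon> \<and> norm (\<pi> z) < \<delta>" for z by (simp add: cylinder_def \<pi>_def)
  have ball: "norm (\<pi> z + s *\<^sub>R e) < R" if "norm (\<pi> z) < \<delta>" "\<bar>s\<bar> \<le> \<epsilon>" for z s
    using norm_triangle_ineq[of "\<pi> z" "s *\<^sub>R e"] that \<delta> \<epsilon> e by simp
  have NR: "norm z < R" if "z \<in> ?N" for z using ball[of z "z \<bullet> e"] that by (simp add: N_iff z_eq)
  have NU: "?N \<subseteq> U" using NR R(2) by blast

  have t_mono: "t (w + a *\<^sub>R e) < t (w + b *\<^sub>R e)"
    if "norm (w + a *\<^sub>R e) < R" "norm (w + b *\<^sub>R e) < R" "a < b" for w a b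
    using that R(2) m smooth_on_has_derivative[OF t]
    by (intro strict_mono_along_line[of "ball 0 R" t "\<lambda>z. frechet_derivative t (at z)"])
      (force simp: dt_def)+
  have t_zero: "t z = 0" if "z \<in> U" "P z = 0" for z
  proof -
    have "frechet_derivative A (at z) = (\<lambda>v. 0)"
      by (rule differential_zero_maxmin[of z U A, OF that(1) U(1) smooth_on_has_derivative[OF A that(1)]])
        (simp add: A_def that(2))
    then show ?thesis by (simp add: t_def)
  qed

  have contP: "continuous_on {-\<epsilon>..\<epsilon>} (\<lambda>s. P (\<pi> z + s *\<^sub>R e))" if z: "norm (\<pi> z) < \<delta>" for z
  proof (rule continuous_on_compose2[OF P])
    show "(\<lambda>s. \<pi> z + s *\<^sub>R e) ` {-\<epsilon>..\<epsilon>} \<subseteq> U" using R(2)[OF ball[OF z]] by (auto simp: abs_le_iff)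
  qed (intro continuous_intros)
  have ends: "P (\<pi> z + \<epsilon> *\<^sub>R e) > 0" "P (\<pi> z + (- \<epsilon>) *\<^sub>R e) < 0" if "norm (\<pi> z) < \<delta>" for z
    using \<delta>0(2)[of "\<pi> z"] that \<delta> by auto
  have "\<exists>s. \<bar>s\<bar> < \<epsilon> \<and> P (\<pi> z + s *\<^sub>R e) = 0" if z: "norm (\<pi> z) < \<delta>" for z
  proof -
    obtain s where s: "-\<epsilon> \<le> s" "s \<le> \<epsilon>" "P (\<pi> z + s *\<^sub>R e) = 0"
      using IVT'[of "\<lambda>s. P (\<pi> z + s *\<^sub>R e)" "-\<epsilon>" 0 \<epsilon>] contP[OF z] ends[OF z] \<epsilon>(1) by auto
    moreover have "s \<noteq> \<epsilon>" "s \<noteq> -\<epsilon>" using s(3) ends[OF z] by auto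
    ultimately show ?thesis by (intro exI[of _ s]) auto
  qed
  then obtain \<Gamma> where \<Gamma>: "\<And>z. norm (\<pi> z) < \<delta> \<Longrightarrow> \<bar>\<Gamma> z\<bar> < \<epsilon> \<and> P (\<pi> z + \<Gamma> z *\<^sub>R e) = 0"
    by metis
  have \<Gamma>\<epsilon>: "\<bar>\<Gamma> z\<bar> < \<epsilon>" and P\<Gamma>: "P (\<pi> z + \<Gamma> z *\<^sub>R e) = 0" if "z \<in> ?N" for z using \<Gamma> that N_iff by auto
  have t\<Gamma>: "t (\<pi> z + \<Gamma> z *\<^sub>R e) = 0" if "z \<in> ?N" for z
    using t_zero P\<Gamma>[OF that] inN[OF that \<Gamma>\<epsilon>[OF that]] NU by blast
  have unique: "s = \<Gamma> z" if "z \<in> ?N" "\<bar>s\<bar> < \<epsilon>" "P (\<pi> z + s *\<^sub>R e) = 0" for z s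
  proof -
    have "t (\<pi> z + s *\<^sub>R e) = 0" using t_zero that inN NU by blast
    then show ?thesis
      using t_mono[of "\<pi> z" s "\<Gamma> z"] t_mono[of "\<pi> z" "\<Gamma> z" s] t\<Gamma>[OF that(1)]
        NR[OF inN[OF that(1,2)]] NR[OF inN[OF that(1) \<Gamma>\<epsilon>[OF that(1)]]]
      by (cases s "\<Gamma> z" rule: linorder_cases) auto
  qed
  have \<Gamma>s: "smooth_on ?N \<Gamma>"
  proof (rule smooth_on_implicit_function[OF e m smooth_on_subset[OF t NU]])
    show "m \<le> frechet_derivative t (at z) e" if "z \<in> ?N" for z
      using R(2)[OF NR[OF that]] by (simp add: dt_def)
    show "t (perp e z + \<Gamma> z *\<^sub>R e) = 0" if "z \<in> ?N" for z
      using t\<Gamma>[OF that] by (simp add: \<pi>_def)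
  qed (rule \<Gamma>\<epsilon>)
  note division = smooth_on_division[OF e _ \<Gamma>s \<Gamma>\<epsilon>]
  have A0: "A (perp e z + \<Gamma> z *\<^sub>R e) = 0" if "z \<in> ?N" for z
    using P\<Gamma>[OF that] by (simp add: A_def \<pi>_def)
  obtain g where g: "smooth_on ?N g" "\<And>z. z \<in> ?N \<Longrightarrow> A z = (z \<bullet> e - \<Gamma> z) * g z"
      "\<And>z. z \<in> ?N \<Longrightarrow> z \<bullet> e = \<Gamma> z \<Longrightarrow> g z = t z"
    using division[OF smooth_on_subset[OF A NU] _ A0] unfolding t_def by metis
  have \<Gamma>\<Gamma>: "\<Gamma> (\<pi> z + \<Gamma> z *\<^sub>R e) = \<Gamma> z" if "z \<in> ?N" for z
    using unique[OF inN[OF that \<Gamma>\<epsilon>[OF that]], of "\<Gamma> z"] P\<Gamma>[OF that] \<Gamma>\<epsilon>[OF that] by (simp add: \<pi>\<pi>)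
  \<comment> \<open>the first quotient is \<open>t = D\<^sub>e A\<close> on the graph, so it vanishes there and can be divided again\<close>
  have g0: "g (perp e z + \<Gamma> z *\<^sub>R e) = 0" if "z \<in> ?N" for z
  proof -
    let ?w = "\<pi> z + \<Gamma> z *\<^sub>R e"
    have "?w \<bullet> e = \<Gamma> ?w" using \<Gamma>\<Gamma>[OF that] by (simp add: line_e)
    then show ?thesis using g(3)[OF inN[OF that \<Gamma>\<epsilon>[OF that]]] t\<Gamma>[OF that] by (simp add: \<pi>_def)
  qed
  obtain h where h: "smooth_on ?N h" "\<And>z. z \<in> ?N \<Longrightarrow> g z = (z \<bullet> e - \<Gamma> z) * h z"
      "\<And>z. z \<in> ?N \<Longrightarrow> z \<bullet> e = \<Gamma> z \<Longrightarrow> h z = frechet_derivative g (at z) e"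
    using division[OF g(1) _ g0] by metis
  have PQ0: "P (perp e z + \<Gamma> z *\<^sub>R e) * Q (perp e z + \<Gamma> z *\<^sub>R e) = 0" if "z \<in> ?N" for z
    using P\<Gamma>[OF that] by (simp add: \<pi>_def)
  obtain k where k: "smooth_on ?N k" "\<And>z. z \<in> ?N \<Longrightarrow> P z * Q z = (z \<bullet> e - \<Gamma> z) * k z"
    using division[OF smooth_on_subset[OF PQ NU] _ PQ0] by metis
  have P_zero_iff: "P z = 0 \<longleftrightarrow> z \<bullet> e = \<Gamma> z" if "z \<in> ?N" for z
    using unique[OF that, of "z \<bullet> e"] P\<Gamma>[OF that] that z_eq[of z] by (auto simp: N_iff)

  have h_pos: "h z > 0" if zN: "z \<in> ?N" for z
  proof (cases "z \<bullet> e = \<Gamma> z")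
    case False
    have "A z = (z \<bullet> e - \<Gamma> z)\<^sup>2 * h z" using g(2) h(2) zN by (simp add: power2_eq_square)
    moreover have "A z > 0" using False P_zero_iff[OF zN] by (auto simp: A_def zero_less_mult_iff linorder_neq_iff)
    ultimately show ?thesis by (metis zero_less_mult_pos zero_less_power2 zero_less_mult_iff not_less_iff_gr_or_eq power2_less_0)
  next
    case True
    \<comment> \<open>on the graph, one differentiates \<open>A = \<zeta>\<^sup>2 h\<close> twice\<close>
    let ?f = "\<lambda>s. \<pi> z + s *\<^sub>R e"
    have on_line: "\<bar>s\<bar> < \<epsilon> \<Longrightarrow> \<Gamma> (?f s) = \<Gamma> z" for s
      using unique[OF inN[OF zN], of s "\<Gamma> z"] P\<Gamma>[OF zN] \<Gamma>\<epsilon>[OF zN] by (simp add: \<pi>\<pi>)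
    have zz: "?f (\<Gamma> z) = z" using True z_eq[of z] by simp
    have der: "((\<lambda>s. F (?f s)) has_real_derivative frechet_derivative F (at (?f s)) e) (at s)"
      if "smooth_on ?N F" "\<bar>s\<bar> < \<epsilon>" for F s
      using has_real_derivative_along_line smooth_on_has_derivative[OF that(1) inN[OF zN that(2)]] by blast
    have ev: "\<forall>\<^sub>F s in nhds (\<Gamma> z). \<bar>s\<bar> < \<epsilon>"
      using \<Gamma>\<epsilon>[OF zN] by (intro eventually_nhds_in_open[of "{s. \<bar>s\<bar> < \<epsilon>}", simplified] open_Collect_less continuous_intros) auto
    have t_eq: "t (?f s) = 2 * (s - \<Gamma> z) * h (?f s) + (s - \<Gamma> z)\<^sup>2 * frechet_derivative h (at (?f s)) e"
      if s: "\<bar>s\<bar> < \<epsilon>" for s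
    proof -
      have "((\<lambda>s. (s - \<Gamma> z)\<^sup>2 * h (?f s)) has_real_derivative
        2 * (s - \<Gamma> z) * h (?f s) + (s - \<Gamma> z)\<^sup>2 * frechet_derivative h (at (?f s)) e) (at s)"
        by (auto intro!: derivative_eq_intros der[OF h(1) s])
      moreover have "\<forall>\<^sub>F s in nhds s. (s - \<Gamma> z)\<^sup>2 * h (?f s) = A (?f s)"
      proof -
        have "\<forall>\<^sub>F s in nhds s. \<bar>s\<bar> < \<epsilon>"
          using s by (intro eventually_nhds_in_open[of "{s. \<bar>s\<bar> < \<epsilon>}", simplified] open_Collect_less continuous_intros) auto
        then show ?thesis
        proof eventually_elim
          case (elim s)
          have "?f s \<bullet> e = s" by (rule line_e)
          then show ?case using g(2)[OF inN[OF zN elim]] h(2)[OF inN[OF zN elim]] on_line[OF elim]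
            by (simp add: power2_eq_square)
        qed
      qed
      ultimately have "((\<lambda>s. A (?f s)) has_real_derivative
        2 * (s - \<Gamma> z) * h (?f s) + (s - \<Gamma> z)\<^sup>2 * frechet_derivative h (at (?f s)) e) (at s)"
        by (rule DERIV_cong_ev[OF refl _ refl, THEN iffD1, rotated])
      moreover have "((\<lambda>s. A (?f s)) has_real_derivative t (?f s)) (at s)"
        unfolding t_def by (rule der[OF smooth_on_subset[OF A NU] s])
      ultimately show ?thesis using DERIV_unique by blast
    qed
    have "((\<lambda>s. 2 * (s - \<Gamma> z) * h (?f s) + (s - \<Gamma> z)\<^sup>2 * frechet_derivative h (at (?f s)) e) has_real_derivative 2 * h z) (at (\<Gamma> z))"
      by (auto intro!: derivative_eq_intros der[OF h(1) \<Gamma>\<epsilon>[OF zN]] der[OF smooth_on_derivative[OF h(1)] \<Gamma>\<epsilon>[OF zN]] simp: zz)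
    moreover have "\<forall>\<^sub>F s in nhds (\<Gamma> z). 2 * (s - \<Gamma> z) * h (?f s) + (s - \<Gamma> z)\<^sup>2 * frechet_derivative h (at (?f s)) e = t (?f s)"
      using ev by eventually_elim (simp add: t_eq)
    ultimately have "((\<lambda>s. t (?f s)) has_real_derivative 2 * h z) (at (\<Gamma> z))"
      by (rule DERIV_cong_ev[OF refl _ refl, THEN iffD1, rotated])
    moreover have "((\<lambda>s. t (?f s)) has_real_derivative dt z) (at (\<Gamma> z))"
      using der[OF smooth_on_subset[OF t NU] \<Gamma>\<epsilon>[OF zN]] by (simp add: dt_def zz)
    ultimately have "2 * h z = dt z" using DERIV_unique by blast
    moreover have "dt z > m" using R(2)[OF NR[OF zN]] by simp
    ultimately show ?thesis using m by simp
  qed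

  have sign_above: "P z > 0" if zN: "z \<in> ?N" "z \<bullet> e > \<Gamma> z" for z
  proof -
    have n: "norm (\<pi> z) < \<delta>" and ze: "\<bar>z \<bullet> e\<bar> < \<epsilon>" using zN by (auto simp: N_iff)
    have sub: "{z \<bullet> e..\<epsilon>} \<subseteq> {-\<epsilon>..\<epsilon>}" using ze by (auto simp: abs_less_iff)
    have nz: "P (\<pi> z + s *\<^sub>R e) \<noteq> 0" if "s \<in> {z \<bullet> e..\<epsilon>}" for s
      using unique[OF zN(1), of s] ends[OF n] that zN(2) ze by (cases "s = \<epsilon>") (auto simp: abs_less_iff)
    from connected_nonzero_sign[OF connected_Icc continuous_on_subset[OF contP[OF n] sub] nz]
    have "(\<forall>s\<in>{z \<bullet> e..\<epsilon>}. P (\<pi> z + s *\<^sub>R e) > 0) \<or> (\<forall>s\<in>{z \<bullet> e..\<epsilon>}. P (\<pi> z + s *\<^sub>R e) < 0)"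
      .
    moreover have "z \<bullet> e \<in> {z \<bullet> e..\<epsilon>}" "\<epsilon> \<in> {z \<bullet> e..\<epsilon>}" using ze by auto
    ultimately show ?thesis using ends(1)[OF n] z_eq[of z] by (metis order_less_asym)
  qed
  have sign_below: "P z < 0" if zN: "z \<in> ?N" "z \<bullet> e < \<Gamma> z" for z
  proof -
    have n: "norm (\<pi> z) < \<delta>" and ze: "\<bar>z \<bullet> e\<bar> < \<epsilon>" using zN by (auto simp: N_iff)
    have sub: "{-\<epsilon>..z \<bullet> e} \<subseteq> {-\<epsilon>..\<epsilon>}" using ze by (auto simp: abs_less_iff)
    have nz: "P (\<pi> z + s *\<^sub>R e) \<noteq> 0" if "s \<in> {-\<epsilon>..z \<bullet> e}" for s
      using unique[OF zN(1), of s] ends[OF n] that zN(2) ze by (cases "s = -\<epsilon>") (auto simp: abs_less_iff)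
    from connected_nonzero_sign[OF connected_Icc continuous_on_subset[OF contP[OF n] sub] nz]
    have "(\<forall>s\<in>{-\<epsilon>..z \<bullet> e}. P (\<pi> z + s *\<^sub>R e) > 0) \<or> (\<forall>s\<in>{-\<epsilon>..z \<bullet> e}. P (\<pi> z + s *\<^sub>R e) < 0)"
      .
    moreover have "z \<bullet> e \<in> {-\<epsilon>..z \<bullet> e}" "-\<epsilon> \<in> {-\<epsilon>..z \<bullet> e}" using ze by auto
    ultimately show ?thesis using ends(2)[OF n] z_eq[of z] by (metis order_less_asym)
  qed
  have P_eq: "P z = (z \<bullet> e - \<Gamma> z) * sqrt (h z)" if zN: "z \<in> ?N" for z
  proof -
    have "(P z)\<^sup>2 = ((z \<bullet> e - \<Gamma> z) * sqrt (h z))\<^sup>2"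
      using g(2)[OF zN] h(2)[OF zN] h_pos[OF zN] by (simp add: A_def power2_eq_square algebra_simps)
    from arg_cong[OF this, of sqrt] have "\<bar>P z\<bar> = \<bar>z \<bullet> e - \<Gamma> z\<bar> * sqrt (h z)"
      using h_pos[OF zN] by (simp only: real_sqrt_abs abs_mult) simp
    then show ?thesis
      using sign_above[OF zN] sign_below[OF zN] P_zero_iff[OF zN]
      by (cases "z \<bullet> e" "\<Gamma> z" rule: linorder_cases) (auto simp: algebra_simps)
  qed
  have hq: "smooth_on ?N (\<lambda>z. sqrt (h z))" by (rule smooth_on_sqrt[OF N h(1) h_pos])
  have "smooth_on ?N (\<lambda>z. (z \<bullet> e - \<Gamma> z) * sqrt (h z))"
    by (intro smooth_on_mult smooth_on_diff N hq \<Gamma>s smooth_on_linear[OF N bounded_linear_inner_left])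
  from smooth_on_cong[OF N _ this] have Ps: "smooth_on ?N P" by (simp add: P_eq)
  have Q_eq: "Q z = k z / sqrt (h z)" if zN: "z \<in> ?N" for z
  proof -
    \<comment> \<open>off the graph one divides by \<open>\<zeta>\<close>; the graph is contained in the closure of its complement\<close>
    have off: "Q y = k y / sqrt (h y)" if "y \<in> ?N" "y \<bullet> e \<noteq> \<Gamma> y" for y
    proof -
      have "(y \<bullet> e - \<Gamma> y) * (sqrt (h y) * Q y) = (y \<bullet> e - \<Gamma> y) * k y"
        using k(2)[OF that(1)] unfolding P_eq[OF that(1)] by (simp add: mult.assoc)
      then have "sqrt (h y) * Q y = k y" using that(2) by simp
      then show ?thesis using h_pos[OF that(1)] by (simp add: field_simps)
    qed
    show ?thesis
    proof (cases "z \<bullet> e = \<Gamma> z")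
      case True
      let ?f = "\<lambda>s. \<pi> z + s *\<^sub>R e"
      have zz: "?f (\<Gamma> z) = z" using True z_eq[of z] by simp
      have cf: "isCont (\<lambda>s. F (?f s)) (\<Gamma> z)" if "continuous_on ?N F" for F :: "'a \<Rightarrow> real"
      proof -
        have "isCont F z" using that N zN continuous_on_eq_continuous_at by blast
        then show ?thesis
          by (intro continuous_at_compose[of _ ?f F, unfolded o_def] continuous_intros) (simp add: zz)
      qed
      have Qlim: "((\<lambda>s. Q (?f s)) \<longlongrightarrow> Q z) (at (\<Gamma> z))"
        using cf[OF continuous_on_subset[OF Q NU]] by (simp add: isCont_def zz)
      have klim: "((\<lambda>s. k (?f s) / sqrt (h (?f s))) \<longlongrightarrow> k z / sqrt (h z)) (at (\<Gamma> z))"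
        using cf[OF smooth_on_imp_continuous_on[OF k(1)]] cf[OF smooth_on_imp_continuous_on[OF hq]] h_pos[OF zN]
        by (intro tendsto_divide) (auto simp: isCont_def zz)
      have "\<forall>\<^sub>F s in at (\<Gamma> z). Q (?f s) = k (?f s) / sqrt (h (?f s))"
      proof -
        have "\<forall>\<^sub>F s in at (\<Gamma> z). \<bar>s\<bar> < \<epsilon>"
          using \<Gamma>\<epsilon>[OF zN] by (intro eventually_at_in_open'[of "{s. \<bar>s\<bar> < \<epsilon>}", simplified] open_Collect_less continuous_intros) auto
        moreover have "\<forall>\<^sub>F s in at (\<Gamma> z). s \<noteq> \<Gamma> z" by (simp add: eventually_at_filter)
        ultimately show ?thesis
        proof eventually_elim
          case (elim s)
          have "\<Gamma> (?f s) = \<Gamma> z"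
            using unique[OF inN[OF zN elim(1)], of "\<Gamma> z"] P\<Gamma>[OF zN] \<Gamma>\<epsilon>[OF zN] by (simp add: \<pi>\<pi>)
          moreover have "?f s \<bullet> e = s" by (rule line_e)
          ultimately show ?case using off[OF inN[OF zN elim(1)]] elim(2) by simp
        qed
      qed
      from tendsto_unique[OF at_neq_bot Qlim] tendsto_cong[OF this, THEN iffD2, OF klim]
      show ?thesis .
    qed (use off zN in auto)
  qed
  have "smooth_on ?N (\<lambda>z. k z / sqrt (h z))"
    by (rule smooth_on_divide[OF N k(1) hq]) (use h_pos in force)
  from smooth_on_cong[OF N _ this] have "smooth_on ?N Q" by (simp add: Q_eq)
  moreover have "0 \<in> ?N" using \<epsilon> \<delta> by (simp add: cylinder_def perp_def)
  ultimately show ?thesis using Ps N by blast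
qed

section \<open>Second derivatives\<close>

definition hessian :: "('a::real_normed_vector \<Rightarrow> real) \<Rightarrow> 'a \<Rightarrow> 'a \<Rightarrow> 'a \<Rightarrow> real" where
  "hessian f z v w = frechet_derivative (\<lambda>y. frechet_derivative f (at y) v) (at z) w"

lemma hessian_has_derivative:
  "smooth_on U f \<Longrightarrow> z \<in> U \<Longrightarrow> ((\<lambda>y. frechet_derivative f (at y) v) has_derivative hessian f z v) (at z)"
  unfolding hessian_def[abs_def] by (rule smooth_on_has_derivative[OF smooth_on_derivative])

lemma hessian_expand:
  fixes f :: "'a::euclidean_space \<Rightarrow> real"
  assumes U: "open U" "z \<in> U" and f: "smooth_on U f"
  shows "hessian f z v w = (\<Sum>i\<in>Basis. \<Sum>j\<in>Basis. (v \<bullet> i) * (w \<bullet> j) * hessian f z i j)"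
proof -
  have "((\<lambda>y. \<Sum>i\<in>Basis. (v \<bullet> i) * frechet_derivative f (at y) i) has_derivative
     (\<lambda>w. \<Sum>i\<in>Basis. (v \<bullet> i) * hessian f z i w)) (at z)"
    by (intro has_derivative_sum has_derivative_mult_right hessian_has_derivative[OF f U(2)])
  moreover have "(\<Sum>i\<in>Basis. (v \<bullet> i) * frechet_derivative f (at y) i) = frechet_derivative f (at y) v"
    if "y \<in> U" for y
  proof -
    interpret bounded_linear "frechet_derivative f (at y)"
      using smooth_on_has_derivative[OF f that] has_derivative_bounded_linear by blast
    show ?thesis
      by (subst (2) euclidean_representation[of v, symmetric]) (simp add: sum scale)
  qed
  ultimately have "((\<lambda>y. frechet_derivative f (at y) v) has_derivative
     (\<lambda>w. \<Sum>i\<in>Basis. (v \<bullet> i) * hessian f z i w)) (at z)"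
    by (rule has_derivative_transform_within_open[OF _ U])
  from has_derivative_unique[OF hessian_has_derivative[OF f U(2)] this]
  have *: "hessian f z v w = (\<Sum>i\<in>Basis. (v \<bullet> i) * hessian f z i w)" by metis
  have "hessian f z i w = (\<Sum>j\<in>Basis. (w \<bullet> j) * hessian f z i j)" for i
  proof -
    interpret bounded_linear "hessian f z i"
      using hessian_has_derivative[OF f U(2)] has_derivative_bounded_linear by blast
    show ?thesis
      by (subst (1) euclidean_representation[of w, symmetric]) (simp add: sum scale)
  qed
  then show ?thesis unfolding * by (simp add: sum_distrib_left mult.assoc)
qed

lemma smooth_on_hessian: "smooth_on U f \<Longrightarrow> smooth_on U (\<lambda>z. hessian f z v w)"
  unfolding hessian_def by (intro smooth_on_derivative)

lemma eventually_hessian_close: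
  assumes "open U" "z \<in> U" "smooth_on U f" "\<eta> > 0"
  shows "\<forall>\<^sub>F y in nhds z. \<bar>hessian f y v w - hessian f z v w\<bar> < \<eta>"
proof -
  have "isCont (\<lambda>y. hessian f y v w) z"
    using smooth_on_imp_continuous_on[OF smooth_on_hessian[OF assms(3)]] assms(1,2)
    by (simp add: continuous_on_eq_continuous_at)
  then have "isCont (\<lambda>y. \<bar>hessian f y v w - hessian f z v w\<bar>) z" by (intro continuous_intros)
  then show ?thesis using assms(4) by (intro eventually_nhds_isCont(2)) auto
qed

text \<open>Two applications of the mean value theorem, first in direction \<open>v\<close>, then in direction \<open>w\<close>.\<close>

lemma second_difference_eq:
  fixes f :: "'a::euclidean_space \<Rightarrow> real"
  assumes f: "smooth_on (ball z \<delta>) f" and h: "h > 0" "h * (norm v + norm w) < \<delta>"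
  shows "\<exists>y. norm (y - z) \<le> h * (norm v + norm w) \<and>
    f (z + h *\<^sub>R v + h *\<^sub>R w) - f (z + h *\<^sub>R v) - f (z + h *\<^sub>R w) + f z = h * h * hessian f y v w"
proof -
  have inb: "norm (a *\<^sub>R v + b *\<^sub>R w) \<le> h * (norm v + norm w)"
    if "0 \<le> a" "a \<le> h" "0 \<le> b" "b \<le> h" for a b
  proof -
    have "norm (a *\<^sub>R v + b *\<^sub>R w) \<le> a * norm v + b * norm w"
      using norm_triangle_ineq[of "a *\<^sub>R v" "b *\<^sub>R w"] that by simp
    also have "\<dots> \<le> h * norm v + h * norm w" using that by (intro add_mono mult_right_mono) auto
    finally show ?thesis by (simp add: algebra_simps)
  qed
  have inball: "z + b *\<^sub>R w + a *\<^sub>R v \<in> ball z \<delta>"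
    if "0 \<le> a" "a \<le> h" "0 \<le> b" "b \<le> h" for a b
    using inb[OF that] h(2) norm_minus_commute[of z "z + b *\<^sub>R w + a *\<^sub>R v"] by (simp add: dist_norm add.commute)
  let ?Df = "\<lambda>y. frechet_derivative f (at y) v"
  have d1: "((\<lambda>s. f (z + b *\<^sub>R w + s *\<^sub>R v)) has_real_derivative ?Df (z + b *\<^sub>R w + s *\<^sub>R v)) (at s)"
    if "0 \<le> s" "s \<le> h" "0 \<le> b" "b \<le> h" for s b
    by (rule has_real_derivative_along_line[OF smooth_on_has_derivative[OF f inball[OF that]]])
  define \<phi> where "\<phi> s = f (z + h *\<^sub>R w + s *\<^sub>R v) - f (z + 0 *\<^sub>R w + s *\<^sub>R v)" for s
  have "(\<phi> has_real_derivative ?Df (z + h *\<^sub>R w + s *\<^sub>R v) - ?Df (z + 0 *\<^sub>R w + s *\<^sub>R v)) (at s)"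
    if "0 \<le> s" "s \<le> h" for s
    unfolding \<phi>_def[abs_def] using that h(1) by (intro DERIV_diff d1) auto
  from MVT2[OF h(1), of \<phi>, OF this] obtain s where s: "0 < s" "s < h"
    "\<phi> h - \<phi> 0 = (h - 0) * (?Df (z + h *\<^sub>R w + s *\<^sub>R v) - ?Df (z + 0 *\<^sub>R w + s *\<^sub>R v))" by blast
  have d2: "((\<lambda>b. ?Df (z + s *\<^sub>R v + b *\<^sub>R w)) has_real_derivative hessian f (z + s *\<^sub>R v + b *\<^sub>R w) v w) (at b)"
    if "0 \<le> b" "b \<le> h" for b
    using inball[of s b] s that
    by (intro has_real_derivative_along_line hessian_has_derivative[OF f]) (simp add: algebra_simps)
  from MVT2[OF h(1), of "\<lambda>b. ?Df (z + s *\<^sub>R v + b *\<^sub>R w)", OF d2] obtain b where b: "0 < b" "b < h"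
    "?Df (z + s *\<^sub>R v + h *\<^sub>R w) - ?Df (z + s *\<^sub>R v + 0 *\<^sub>R w) = (h - 0) * hessian f (z + s *\<^sub>R v + b *\<^sub>R w) v w"
    by blast
  have "\<phi> h - \<phi> 0 = h * h * hessian f (z + s *\<^sub>R v + b *\<^sub>R w) v w"
    using s(3) b(3) by (simp add: algebra_simps)
  then show ?thesis using inb[of s b] s b
    by (intro exI[of _ "z + s *\<^sub>R v + b *\<^sub>R w"]) (simp add: \<phi>_def algebra_simps)
qed

text \<open>Schwarz's theorem: the second difference is symmetric in \<open>v\<close> and \<open>w\<close>.\<close>

lemma hessian_sym:
  fixes f :: "'a::euclidean_space \<Rightarrow> real"
  assumes U: "open U" "z \<in> U" and f: "smooth_on U f"
  shows "hessian f z v w = hessian f z w v"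
proof (rule ccontr)
  assume ne: "hessian f z v w \<noteq> hessian f z w v"
  define \<eta> where "\<eta> = \<bar>hessian f z v w - hessian f z w v\<bar> / 2"
  have \<eta>: "\<eta> > 0" using ne by (simp add: \<eta>_def)
  note near = eventually_hessian_close[OF U f \<eta>]
  have "\<forall>\<^sub>F y in nhds z. y \<in> U \<and> \<bar>hessian f y v w - hessian f z v w\<bar> < \<eta> \<and> \<bar>hessian f y w v - hessian f z w v\<bar> < \<eta>"
    using near[of v w] near[of w v] eventually_nhds_in_open[OF U] by eventually_elim auto
  then obtain \<delta> where \<delta>: "\<delta> > 0" "\<And>y. dist y z < \<delta> \<Longrightarrow> y \<in> U \<and> \<bar>hessian f y v w - hessian f z v w\<bar> < \<eta> \<and> \<bar>hessian f y w v - hessian f z w v\<bar> < \<eta>"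
    unfolding eventually_nhds_metric by auto
  have fb: "smooth_on (ball z \<delta>) f"
    using \<delta> by (intro smooth_on_subset[OF f]) (auto simp: dist_commute)
  define h where "h = \<delta> / (2 * (norm v + norm w + 1))"
  have h: "h > 0" "h * (norm v + norm w) < \<delta>"
  proof -
    have p: "norm v + norm w + 1 > 0" by (simp add: add_nonneg_pos)
    show "h > 0" using \<delta> p by (simp add: h_def)
    have "h * (norm v + norm w) < h * (2 * (norm v + norm w + 1))"
      using \<open>h > 0\<close> p by (intro mult_strict_left_mono) auto
    also have "\<dots> = \<delta>" using p by (simp add: h_def)
    finally show "h * (norm v + norm w) < \<delta>" .
  qed
  obtain y1 where y1: "norm (y1 - z) \<le> h * (norm v + norm w)"
    "f (z + h *\<^sub>R v + h *\<^sub>R w) - f (z + h *\<^sub>R v) - f (z + h *\<^sub>R w) + f z = h * h * hessian f y1 v w"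
    using second_difference_eq[OF fb h] by blast
  obtain y2 where y2: "norm (y2 - z) \<le> h * (norm w + norm v)"
    "f (z + h *\<^sub>R w + h *\<^sub>R v) - f (z + h *\<^sub>R w) - f (z + h *\<^sub>R v) + f z = h * h * hessian f y2 w v"
    using second_difference_eq[OF fb h(1), of w v] h(2) by (auto simp: add.commute)
  have "h * h * hessian f y1 v w = h * h * hessian f y2 w v"
    using y1(2) y2(2) by (simp add: algebra_simps)
  then have "hessian f y1 v w = hessian f y2 w v" using h by simp
  moreover have "\<bar>hessian f y1 v w - hessian f z v w\<bar> < \<eta>" "\<bar>hessian f y2 w v - hessian f z w v\<bar> < \<eta>"
    using \<delta>(2)[of y1] \<delta>(2)[of y2] y1(1) y2(1) h(2) by (auto simp: dist_norm add.commute)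
  ultimately show False unfolding \<eta>_def by (auto simp: abs_if split: if_splits)
qed

text \<open>Taylor's formula along the segment gives half the Hessian at an intermediate point; what matters
  is that its distance from the Hessian at \<open>z\<close> is uniform over all directions \<open>v\<close>, which follows from
  the continuity of the finitely many entries.\<close>

lemma second_order_expansion:
  fixes f :: "'a::euclidean_space \<Rightarrow> real"
  assumes U: "open U" "z \<in> U" and f: "smooth_on U f"
    and crit: "f z = 0" "\<And>v. frechet_derivative f (at z) v = 0" and \<eta>: "\<eta> > 0"
  shows "\<exists>\<delta>>0. \<forall>v. norm v < \<delta> \<longrightarrow> z + v \<in> U \<and> \<bar>f (z + v) - hessian f z v v / 2\<bar> \<le> \<eta> * (norm v)\<^sup>2"
proof -
  define N where "N = real DIM('a)"
  have N: "N > 0" by (simp add: N_def)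
  have near: "\<forall>\<^sub>F y in nhds z. \<bar>hessian f y a b - hessian f z a b\<bar> < \<eta> / (N * N)" for a b
    using \<eta> N by (intro eventually_hessian_close[OF U f]) simp
  have "\<forall>\<^sub>F y in nhds z. y \<in> U \<and> (\<forall>i\<in>Basis. \<forall>j\<in>Basis. \<bar>hessian f y i j - hessian f z i j\<bar> < \<eta> / (N * N))"
    using eventually_nhds_in_open[OF U] near by (simp add: eventually_conj_iff eventually_ball_finite_distrib)
  then obtain \<delta> where \<delta>: "\<delta> > 0" "\<And>y. dist y z < \<delta> \<Longrightarrow> y \<in> U \<and>
      (\<forall>i\<in>Basis. \<forall>j\<in>Basis. \<bar>hessian f y i j - hessian f z i j\<bar> < \<eta> / (N * N))"
    unfolding eventually_nhds_metric by auto
  have "z + v \<in> U \<and> \<bar>f (z + v) - hessian f z v v / 2\<bar> \<le> \<eta> * (norm v)\<^sup>2" if v: "norm v < \<delta>" for v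
  proof
    have ball: "z + s *\<^sub>R v \<in> U" "dist (z + s *\<^sub>R v) z < \<delta>" if "0 \<le> s" "s \<le> 1" for s
    proof -
      have "norm (s *\<^sub>R v) \<le> norm v" using that by (simp add: mult_left_le_one_le)
      then show "dist (z + s *\<^sub>R v) z < \<delta>" using v by (simp add: dist_norm)
      then show "z + s *\<^sub>R v \<in> U" using \<delta> by blast
    qed
    show "z + v \<in> U" using ball(1)[of 1] by simp
    define diff :: "nat \<Rightarrow> real \<Rightarrow> real" where "diff m s = (if m = 0 then f (z + s *\<^sub>R v) else if m = 1 then frechet_derivative f (at (z + s *\<^sub>R v)) v
       else hessian f (z + s *\<^sub>R v) v v)" for m s
    have "\<forall>m t. m < 2 \<and> 0 \<le> t \<and> t \<le> 1 \<longrightarrow> (diff m has_real_derivative diff (Suc m) t) (at t)"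
    proof (intro allI impI)
      fix m :: nat and t :: real assume a: "m < 2 \<and> 0 \<le> t \<and> t \<le> 1"
      then have zU: "z + t *\<^sub>R v \<in> U" using ball by blast
      from a consider "m = 0" | "m = 1" by linarith
      then show "(diff m has_real_derivative diff (Suc m) t) (at t)"
        using has_real_derivative_along_line[OF smooth_on_has_derivative[OF f zU]]
          has_real_derivative_along_line[OF hessian_has_derivative[OF f zU]]
        by cases (simp_all add: diff_def[abs_def])
    qed
    from Maclaurin[of 1 2 diff "diff 0", OF _ _ _ this]
    obtain t where t: "0 < t" "t < 1" "diff 0 1 = (\<Sum>m<2. diff m 0 / fact m * 1 ^ m) + diff 2 t / fact 2 * 1 ^ 2"
      by auto
    then have eq: "f (z + v) = hessian f (z + t *\<^sub>R v) v v / 2"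
      by (simp add: diff_def crit numeral_2_eq_2)
    have tU: "z + t *\<^sub>R v \<in> U" "dist (z + t *\<^sub>R v) z < \<delta>" using ball t by auto
    have "\<bar>f (z + v) - hessian f z v v / 2\<bar> = \<bar>hessian f (z + t *\<^sub>R v) v v - hessian f z v v\<bar> / 2"
      unfolding eq by (simp add: diff_divide_distrib[symmetric])
    also have "\<dots> \<le> \<bar>hessian f (z + t *\<^sub>R v) v v - hessian f z v v\<bar>" by simp
    also have "\<dots> = \<bar>\<Sum>i\<in>Basis. \<Sum>j\<in>Basis. (v \<bullet> i) * (v \<bullet> j) * (hessian f (z + t *\<^sub>R v) i j - hessian f z i j)\<bar>"
      unfolding hessian_expand[OF U f, of v v] hessian_expand[OF U(1) tU(1) f, of v v]
      by (simp add: sum_subtractf[symmetric] right_diff_distrib)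
    also have "\<dots> \<le> (\<Sum>i\<in>(Basis::'a set). \<Sum>j\<in>(Basis::'a set). norm v * norm v * (\<eta> / (N * N)))"
    proof (rule order_trans[OF sum_abs], rule sum_mono, rule order_trans[OF sum_abs], rule sum_mono)
      fix i j :: 'a assume ij: "i \<in> Basis" "j \<in> Basis"
      have "\<bar>(v \<bullet> i) * (v \<bullet> j)\<bar> \<le> norm v * norm v"
        using Basis_le_norm[OF ij(1), of v] Basis_le_norm[OF ij(2), of v] by (simp add: abs_mult mult_mono)
      moreover have "\<bar>hessian f (z + t *\<^sub>R v) i j - hessian f z i j\<bar> \<le> \<eta> / (N * N)" using \<delta>(2)[OF tU(2)] ij by force
      ultimately show "\<bar>(v \<bullet> i) * (v \<bullet> j) * (hessian f (z + t *\<^sub>R v) i j - hessian f z i j)\<bar> \<le> norm v * norm v * (\<eta> / (N * N))"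
        unfolding abs_mult[of "(v \<bullet> i) * (v \<bullet> j)"] by (intro mult_mono) auto
    qed
    also have "\<dots> = N * (N * (norm v * norm v * (\<eta> / (N * N))))" by (simp only: sum_constant N_def)
    also have "\<dots> = \<eta> * (norm v)\<^sup>2" using N by (simp add: power2_eq_square)
    finally show "\<bar>f (z + v) - hessian f z v v / 2\<bar> \<le> \<eta> * (norm v)\<^sup>2" .
  qed
  then show ?thesis using \<delta>(1) by (intro exI[of _ \<delta>]) simp
qed

lemma has_derivative_shift:
  assumes "(f has_derivative f') (at (a + x))"
  shows "((\<lambda>y. f (a + y)) has_derivative f') (at x)"
proof -
  have "((\<lambda>y. a + y) has_derivative (\<lambda>v. v)) (at x)"
    using has_derivative_add[OF has_derivative_const has_derivative_ident] by simp
  from has_derivative_compose[OF this assms] show ?thesis by simp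
qed

lemma frechet_derivative_shift:
  assumes "f differentiable (at (a + x))"
  shows "frechet_derivative (\<lambda>y. f (a + y)) (at x) = frechet_derivative f (at (a + x))"
  by (rule frechet_derivative_at[symmetric, OF has_derivative_shift])
    (use assms in \<open>simp add: frechet_derivative_works[symmetric]\<close>)

lemma smooth_on_shift:
  fixes f :: "'a::euclidean_space \<Rightarrow> 'b::real_normed_vector"
  assumes "open U" "smooth_on U f"
  shows "smooth_on ((\<lambda>x. x - a) ` U) (\<lambda>x. f (a + x))"
proof (rule smooth_on_compose[OF _ assms(1) _ _ assms(2)])
  show o: "open ((\<lambda>x. x - a) ` U)" using open_translation_subtract[OF assms(1)] by simp
  show "smooth_on ((\<lambda>x. x - a) ` U) (\<lambda>x. a + x)"
    by (intro smooth_on_add o smooth_on_const smooth_on_linear bounded_linear_ident)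
qed auto

lemma smooth_near_sign_change_of_root:
  fixes P Q :: "'a::euclidean_space \<Rightarrow> real"
  assumes e: "norm e = 1" and U: "open U" "z \<in> U"
    and P: "continuous_on U P" and Q: "continuous_on U Q"
    and PP: "smooth_on U (\<lambda>z. P z * P z)" and PQ: "smooth_on U (\<lambda>z. P z * Q z)"
    and pos: "hessian (\<lambda>z. P z * P z) z e e > 0"
    and sign: "\<forall>\<^sub>F s in at_right 0. P (z + s *\<^sub>R e) > 0 \<and> P (z - s *\<^sub>R e) < 0"
  shows "\<exists>T. open T \<and> z \<in> T \<and> smooth_on T P \<and> smooth_on T Q"
proof -
  let ?U = "(\<lambda>x. x - z) ` U" and ?A = "\<lambda>z. P z * P z"
  have oU: "open ?U" using open_translation_subtract[OF U(1)] by simp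
  have 1: "frechet_derivative (\<lambda>y. ?A (z + y)) (at x) e = frechet_derivative ?A (at (z + x)) e" if "x \<in> ?U" for x
  proof -
    have "z + x \<in> U" using that by auto
    from differentiableI[OF smooth_on_has_derivative[OF PP this]] show ?thesis
      by (simp add: frechet_derivative_shift[of ?A z x])
  qed
  have "frechet_derivative (\<lambda>x. frechet_derivative (\<lambda>y. ?A (z + y)) (at x) e) (at 0) =
      frechet_derivative (\<lambda>x. frechet_derivative ?A (at (z + x)) e) (at 0)"
  proof -
    have d: "(\<lambda>y. frechet_derivative ?A (at y) e) differentiable (at (z + 0))"
      using differentiableI[OF smooth_on_has_derivative[OF smooth_on_derivative[OF PP] U(2)]] by simp
    then have "((\<lambda>x. frechet_derivative ?A (at (z + x)) e) has_derivative
        frechet_derivative (\<lambda>y. frechet_derivative ?A (at y) e) (at (z + 0))) (at 0)"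
      by (intro has_derivative_shift) (simp add: frechet_derivative_works)
    then have "((\<lambda>x. frechet_derivative (\<lambda>y. ?A (z + y)) (at x) e) has_derivative
        frechet_derivative (\<lambda>y. frechet_derivative ?A (at y) e) (at (z + 0))) (at 0)"
      by (rule has_derivative_transform_within_open[OF _ oU]) (use U(2) 1 in auto)
    from frechet_derivative_at[OF this, symmetric] frechet_derivative_shift[OF d, symmetric]
    show ?thesis by (rule trans)
  qed
  also have "\<dots> = frechet_derivative (\<lambda>y. frechet_derivative ?A (at y) e) (at z)"
    using frechet_derivative_shift[of "\<lambda>y. frechet_derivative ?A (at y) e" z 0]
      differentiableI[OF smooth_on_has_derivative[OF smooth_on_derivative[OF PP] U(2)]] by simp
  finally have pos': "frechet_derivative (\<lambda>x. frechet_derivative (\<lambda>y. P (z + y) * P (z + y)) (at x) e) (at 0) e > 0"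
    using pos by (simp add: hessian_def)
  have c: "continuous_on ?U (\<lambda>x. F (z + x))" if "continuous_on U F" for F :: "'a \<Rightarrow> real"
    by (rule continuous_on_compose2[OF that]) (auto intro!: continuous_intros)
  have "\<exists>T. open T \<and> 0 \<in> T \<and> smooth_on T (\<lambda>x. P (z + x)) \<and> smooth_on T (\<lambda>x. Q (z + x))"
    by (rule smooth_at_sign_change_of_root[OF e oU _ c[OF P] c[OF Q] smooth_on_shift[OF U(1) PP]
          smooth_on_shift[OF U(1) PQ] pos']) (use U sign in auto)
  then obtain T where T: "open T" "0 \<in> T" "smooth_on T (\<lambda>x. P (z + x))" "smooth_on T (\<lambda>x. Q (z + x))" by blast
  have "open ((\<lambda>x. x - (- z)) ` T)" by (rule open_translation_subtract[OF T(1)])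
  moreover have "z \<in> (\<lambda>x. x - (- z)) ` T" using T(2) by (simp add: image_iff)
  moreover have "smooth_on ((\<lambda>x. x - (- z)) ` T) P" "smooth_on ((\<lambda>x. x - (- z)) ` T) Q"
    using smooth_on_shift[OF T(1,3), of "-z"] smooth_on_shift[OF T(1,4), of "-z"] by simp_all
  ultimately show ?thesis by blast
qed

section \<open>Gauss curvature of a metric in a chart\<close>

lemma partial_has_derivative:
  assumes "(f has_derivative f') (at p)"
  shows "has_partial i f (f' (axis i 1)) p" and "partial i f p = f' (axis i 1)"
proof -
  show *: "has_partial i f (f' (axis i 1)) p"
    unfolding has_partial_def using has_real_derivative_along_line[of f f' p 0] assms by simp
  then show "partial i f p = f' (axis i 1)"
    unfolding partial_def has_partial_def by (rule DERIV_imp_deriv)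
qed

lemma partial_cong:
  assumes "open U" "p \<in> U" "\<And>x. x \<in> U \<Longrightarrow> f x = g x"
  shows "partial i f p = partial i g p"
  unfolding partial_def
proof (rule deriv_cong_ev[OF _ refl])
  have "isCont (\<lambda>t. p + t *\<^sub>R axis i 1) (0::real)" by (intro continuous_intros)
  then have "((\<lambda>t. p + t *\<^sub>R axis i 1) \<longlongrightarrow> p) (nhds (0::real))"
    using tendsto_at_iff_tendsto_nhds[of "\<lambda>t. p + t *\<^sub>R axis i 1" "0::real"] by (simp add: isCont_def)
  from topological_tendstoD[OF this assms(1,2)]
  show "\<forall>\<^sub>F t in nhds 0. f (p + t *\<^sub>R axis i 1) = g (p + t *\<^sub>R axis i 1)"
    by eventually_elim (rule assms(3))
qed

lemma smooth_on_partial_eq: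
  "smooth_on U f \<Longrightarrow> p \<in> U \<Longrightarrow> partial i f p = frechet_derivative f (at p) (axis i 1)"
  using partial_has_derivative(2)[OF smooth_on_has_derivative] .

lemma smooth_on_partial:
  assumes "open U" "smooth_on U f" shows "smooth_on U (partial i f)"
  by (rule smooth_on_cong[OF assms(1) _ smooth_on_derivative[OF assms(2)]])
    (rule smooth_on_partial_eq[OF assms(2), symmetric])

lemma partial_partial_eq_hessian:
  assumes "open U" "smooth_on U f" "p \<in> U"
  shows "partial j (partial i f) p = hessian f p (axis i 1) (axis j 1)"
proof -
  have "partial j (partial i f) p = partial j (\<lambda>y. frechet_derivative f (at y) (axis i 1)) p"
    by (rule partial_cong[OF assms(1,3) smooth_on_partial_eq[OF assms(2)]])
  also have "\<dots> = hessian f p (axis i 1) (axis j 1)"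
    unfolding hessian_def by (rule smooth_on_partial_eq[OF smooth_on_derivative[OF assms(2)] assms(3)])
  finally show ?thesis .
qed

lemma partial_mult:
  assumes "smooth_on U f" "smooth_on U g" "p \<in> U"
  shows "partial i (\<lambda>x. f x * g x) p = partial i f p * g p + f p * partial i g p"
  using partial_has_derivative(2)[OF has_derivative_mult[OF smooth_on_has_derivative[OF assms(1,3)]
        smooth_on_has_derivative[OF assms(2,3)]], of i]
    smooth_on_partial_eq[OF assms(1,3), of i] smooth_on_partial_eq[OF assms(2,3), of i] by simp

lemma partial_add:
  assumes "smooth_on U f" "smooth_on U g" "p \<in> U"
  shows "partial i (\<lambda>x. f x + g x) p = partial i f p + partial i g p"
  using partial_has_derivative(2)[OF has_derivative_add[OF smooth_on_has_derivative[OF assms(1,3)]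
        smooth_on_has_derivative[OF assms(2,3)]], of i]
    smooth_on_partial_eq[OF assms(1,3), of i] smooth_on_partial_eq[OF assms(2,3), of i] by simp

lemma partial_diff:
  assumes "smooth_on U f" "smooth_on U g" "p \<in> U"
  shows "partial i (\<lambda>x. f x - g x) p = partial i f p - partial i g p"
  using partial_has_derivative(2)[OF has_derivative_diff[OF smooth_on_has_derivative[OF assms(1,3)]
        smooth_on_has_derivative[OF assms(2,3)]], of i]
    smooth_on_partial_eq[OF assms(1,3), of i] smooth_on_partial_eq[OF assms(2,3), of i] by simp

lemma partial_half:
  assumes "smooth_on U f" "p \<in> U"
  shows "partial i (\<lambda>x. f x / 2) p = partial i f p / 2"
  using partial_has_derivative(2)[OF bounded_linear.has_derivative[OF bounded_linear_divide smooth_on_has_derivative[OF assms]], of i 2]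
    smooth_on_partial_eq[OF assms, of i] by simp

lemma matrix_inv_2:
  fixes A :: "real^2^2"
  assumes "det A \<noteq> 0"
  shows "matrix_inv A = vector [vector [A$2$2 / det A, - A$1$2 / det A], vector [- A$2$1 / det A, A$1$1 / det A]]"
    (is "_ = ?B")
proof -
  have B: "A ** ?B = mat 1" "?B ** A = mat 1"
    using assms by (simp_all add: vec_eq_iff forall_2 matrix_matrix_mult_def sum_2 mat_def field_simps)
      (simp_all add: det_2 algebra_simps)
  then have "\<exists>A'. A ** A' = mat 1 \<and> A' ** A = mat 1" by blast
  then have C: "A ** matrix_inv A = mat 1 \<and> matrix_inv A ** A = mat 1"
    unfolding matrix_inv_def by (rule someI_ex)
  have "matrix_inv A = (matrix_inv A ** A) ** ?B" unfolding matrix_mul_assoc[symmetric] B(1) by simp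
  then show ?thesis using C by simp
qed

text \<open>The determinant is positive because the quadratic form is positive at $(1,0)$ and at $(-g_{12}, g_{11})$.\<close>

lemma riemannian_metric_entries:
  fixes g :: "real^2 \<Rightarrow> real^2^2"
  assumes U: "open U" and g: "riemannian_metric_on U g"
  shows "smooth_on U (\<lambda>q. g q $ i $ j)"
    and "q \<in> U \<Longrightarrow> g q $ 2 $ 1 = g q $ 1 $ 2"
    and "q \<in> U \<Longrightarrow> det (g q) > 0"
proof -
  have gs: "smooth_on U g" using g by (simp add: riemannian_metric_on_def)
  show "smooth_on U (\<lambda>q. g q $ i $ j)"
    by (rule smooth_on_compose_linear[OF U _ smooth_on_compose_linear[OF U _ gs]]) (rule bounded_linear_vec_nth)+
  assume q: "q \<in> U"
  have "transpose (g q) = g q" using g q by (simp add: riemannian_metric_on_def)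
  from arg_cong[OF this, of "\<lambda>M. M $ 1 $ 2"] show sym: "g q $ 2 $ 1 = g q $ 1 $ 2"
    by (simp add: transpose_def)
  have pos: "v \<noteq> 0 \<Longrightarrow> v \<bullet> (g q *v v) > 0" for v using g q by (simp add: riemannian_metric_on_def)
  have quad: "vector [x, y] \<bullet> (g q *v vector [x, y]) = x * x * g q$1$1 + 2 * x * y * g q$1$2 + y * y * g q$2$2" for x y
    by (simp add: inner_vec_def sum_2 matrix_vector_mult_def sym algebra_simps)
  have ne: "vector [x, y] \<noteq> (0::real^2)" if "x \<noteq> 0 \<or> y \<noteq> 0" for x y
    using that by (auto simp: vec_eq_iff forall_2)
  have a: "g q$1$1 > 0" using pos[OF ne[of 1 0]] by (simp add: quad)
  have "g q$1$1 * det (g q) > 0"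
    using pos[OF ne[of "- g q$1$2" "g q$1$1"]] a by (simp add: quad det_2 sym algebra_simps)
  then show "det (g q) > 0" using a by (simp add: zero_less_mult_iff)
qed

lemma smooth_on_christoffel:
  fixes g :: "real^2 \<Rightarrow> real^2^2"
  assumes U: "open U" and g: "riemannian_metric_on U g"
  shows "smooth_on U (\<lambda>p. matrix_inv (g p) $ k $ l)" and "smooth_on U (christoffel g k i j)"
proof -
  note e = riemannian_metric_entries[OF U g]
  have det: "smooth_on U (\<lambda>p. det (g p))"
    unfolding det_2 by (intro smooth_on_diff smooth_on_mult e(1) U)
  have *: "smooth_on U (\<lambda>p. (vector [vector [g p$2$2 / det (g p), - g p$1$2 / det (g p)],
      vector [- g p$2$1 / det (g p), g p$1$1 / det (g p)]] :: real^2^2) $ k $ l)" for k l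
    using exhaust_2[of k] exhaust_2[of l] e(3)
    by (auto intro!: smooth_on_divide[OF U _ det] smooth_on_uminus[OF U] e(1) simp: less_imp_neq[symmetric])
  have inv: "smooth_on U (\<lambda>p. matrix_inv (g p) $ k $ l)" for k l
    by (rule smooth_on_cong[OF U _ *]) (use e(3) in \<open>simp add: matrix_inv_2 less_imp_neq[symmetric]\<close>)
  then show "smooth_on U (\<lambda>p. matrix_inv (g p) $ k $ l)" .
  show "smooth_on U (christoffel g k i j)"
    unfolding christoffel_def[abs_def]
    by (intro smooth_on_divide[OF U] smooth_on_sum smooth_on_mult smooth_on_diff smooth_on_add smooth_on_const
        smooth_on_partial e(1) U inv) auto
qed

text \<open>Continuity carries the sign of the curvature from the punctured ball to the origin.\<close>

lemma smooth_on_gauss_curvature: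
  fixes g :: "real^2 \<Rightarrow> real^2^2"
  assumes U: "open U" and g: "riemannian_metric_on U g"
  shows "smooth_on U (gauss_curvature g)"
proof -
  note e = riemannian_metric_entries[OF U g] and c = smooth_on_christoffel(2)[OF U g]
  have det: "smooth_on U (\<lambda>p. det (g p))"
    unfolding det_2 by (intro smooth_on_diff smooth_on_mult e(1) U)
  have r: "smooth_on U (riemann g l k i j)" for l k i j
    unfolding riemann_def[abs_def]
    by (intro smooth_on_sum smooth_on_mult smooth_on_diff smooth_on_add smooth_on_partial c U)
  show ?thesis unfolding gauss_curvature_def[abs_def]
    by (intro smooth_on_divide[OF U _ det] smooth_on_sum smooth_on_mult e(1) r U) (use e(3) in force)
qed

text \<open>Where the first derivatives of the metric vanish, the Christoffel symbols vanish, the quadratic terms of the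
  curvature tensor drop out, and in the derivatives of the Christoffel symbols the inverse metric is
  not differentiated.\<close>

lemma gauss_curvature_at_critical_point:
  fixes g :: "real^2 \<Rightarrow> real^2^2"
  assumes U: "open U" "p \<in> U" and g: "riemannian_metric_on U g"
    and gp: "g p = mat 1" and crit: "\<And>i j l. partial i (\<lambda>q. g q $ j $ l) p = 0"
  shows "gauss_curvature g p = partial 1 (partial 2 (\<lambda>q. g q $ 1 $ 2)) p
     - partial 1 (partial 1 (\<lambda>q. g q $ 2 $ 2)) p / 2 - partial 2 (partial 2 (\<lambda>q. g q $ 1 $ 1)) p / 2"
proof -
  note e = riemannian_metric_entries[OF U(1) g] and inv = smooth_on_christoffel(1)[OF U(1) g]
  have det1: "det (g p) = 1" by (simp add: gp)
  have inv1: "matrix_inv (g p) $ k $ l = (if k = l then 1 else 0)" for k l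
    using exhaust_2[of k] exhaust_2[of l] by (auto simp: matrix_inv_2 det1) (auto simp: gp mat_def)
  define S where "S i j l q = partial i (\<lambda>q. g q $ j $ l) q + partial j (\<lambda>q. g q $ i $ l) q
         - partial l (\<lambda>q. g q $ i $ j) q" for i j l q
  have Ss: "smooth_on U (S i j l)" for i j l
    unfolding S_def[abs_def] by (intro smooth_on_diff smooth_on_add smooth_on_partial e(1) U)
  have S0: "S i j l p = 0" for i j l by (simp add: S_def crit)
  have chr: "christoffel g k i j = (\<lambda>q. (matrix_inv (g q) $ k $ 1 * S i j 1 q + matrix_inv (g q) $ k $ 2 * S i j 2 q) / 2)" for k i j
    by (simp add: christoffel_def[abs_def] sum_2 S_def)
  have chr0: "christoffel g k i j p = 0" for k i j by (simp add: chr S0)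
  have dchr: "partial a (christoffel g k i j) p = partial a (S i j k) p / 2" for a k i j
  proof -
    have m: "smooth_on U (\<lambda>q. matrix_inv (g q) $ k $ l * S i j l q)" for l
      by (intro smooth_on_mult inv Ss U)
    have pm: "partial a (\<lambda>q. matrix_inv (g q) $ k $ l * S i j l q) p = (if k = l then partial a (S i j l) p else 0)" for l
      using partial_mult[OF inv Ss U(2)] by (simp add: S0 inv1)
    have "partial a (christoffel g k i j) p =
      (partial a (\<lambda>q. matrix_inv (g q) $ k $ 1 * S i j 1 q) p + partial a (\<lambda>q. matrix_inv (g q) $ k $ 2 * S i j 2 q) p) / 2"
      unfolding chr partial_half[OF smooth_on_add[OF U(1) m m] U(2)] partial_add[OF m m U(2)] ..
    then show ?thesis using exhaust_2[of k] by (auto simp: pm)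
  qed
  have dS: "partial a (S i j l) p = partial a (partial i (\<lambda>q. g q $ j $ l)) p + partial a (partial j (\<lambda>q. g q $ i $ l)) p
     - partial a (partial l (\<lambda>q. g q $ i $ j)) p" for a i j l
    unfolding S_def[abs_def]
    by (simp add: partial_diff[OF smooth_on_add[OF U(1)] _ U(2)] partial_add[OF _ _ U(2)]
        smooth_on_partial e(1) U)
  have sym: "partial a (partial b (\<lambda>q. g q $ 2 $ 1)) p = partial a (partial b (\<lambda>q. g q $ 1 $ 2)) p" for a b
    by (rule partial_cong[OF U partial_cong[OF U(1)]]) (auto intro: e(2))
  have "gauss_curvature g p = riemann g 1 2 1 2 p"
    by (simp add: gauss_curvature_def det1 sum_2) (simp add: gp mat_def)
  also have "\<dots> = partial 1 (S 2 2 1) p / 2 - partial 2 (S 1 2 1) p / 2"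
    by (simp add: riemann_def chr0 dchr)
  finally show ?thesis by (simp add: dS sym field_simps)
qed

section \<open>Quadratic forms with $ac = b^2$\<close>

text \<open>Evaluation at five points: the three values $(1,1)$, $(1,-1)$, $(2,1)$ separate the mixed
  coefficients.\<close>

lemma quartic_coeffs_eq_0:
  fixes k0 :: real
  assumes "\<And>x y::real. k0 * x^4 + k1 * x^3 * y + k2 * x^2 * y^2 + k3 * x * y^3 + k4 * y^4 = 0"
  shows "k0 = 0" "k1 = 0" "k2 = 0" "k3 = 0" "k4 = 0"
  using assms[of 1 0] assms[of 0 1] assms[of 1 1] assms[of 1 "-1"] assms[of 2 1]
  by simp_all

lemma quadratic_form_product_coeffs:
  fixes a0 a1 a2 b0 b1 b2 c0 c1 c2 :: real
  assumes "\<And>x y. (a0 * x\<^sup>2 + 2 * a1 * x * y + a2 * y\<^sup>2) * (c0 * x\<^sup>2 + 2 * c1 * x * y + c2 * y\<^sup>2)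
     = (b0 * x\<^sup>2 + 2 * b1 * x * y + b2 * y\<^sup>2)\<^sup>2"
  shows "a0 * c0 = b0\<^sup>2" "a0 * c1 + a1 * c0 = 2 * b0 * b1"
    "a0 * c2 + 4 * a1 * c1 + a2 * c0 = 2 * b0 * b2 + 4 * b1\<^sup>2"
    "a1 * c2 + a2 * c1 = 2 * b1 * b2" "a2 * c2 = b2\<^sup>2"
proof -
  have "(a0 * c0 - b0\<^sup>2) * x^4 + (2 * (a0 * c1 + a1 * c0) - 4 * b0 * b1) * x^3 * y
     + (a0 * c2 + 4 * a1 * c1 + a2 * c0 - 2 * b0 * b2 - 4 * b1\<^sup>2) * x^2 * y^2
     + (2 * (a1 * c2 + a2 * c1) - 4 * b1 * b2) * x * y^3 + (a2 * c2 - b2\<^sup>2) * y^4 = 0" for x y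
    using assms[of x y] by algebra
  from quartic_coeffs_eq_0[OF this]
  show "a0 * c0 = b0\<^sup>2" "a0 * c1 + a1 * c0 = 2 * b0 * b1"
    "a0 * c2 + 4 * a1 * c1 + a2 * c0 = 2 * b0 * b2 + 4 * b1\<^sup>2"
    "a1 * c2 + a2 * c1 = 2 * b1 * b2" "a2 * c2 = b2\<^sup>2"
    by simp_all
qed

lemma psd_form_coeffs:
  fixes a0 a1 a2 :: real
  assumes "\<And>x y. a0 * x\<^sup>2 + 2 * a1 * x * y + a2 * y\<^sup>2 \<ge> 0"
  shows "a0 \<ge> 0" "a2 \<ge> 0" "a1\<^sup>2 \<le> a0 * a2"
proof -
  show a: "a0 \<ge> 0" "a2 \<ge> 0" using assms[of 1 0] assms[of 0 1] by simp_all
  show "a1\<^sup>2 \<le> a0 * a2"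
  proof (cases "a0 = 0")
    case True
    show ?thesis
    proof (rule ccontr)
      assume "\<not> ?thesis"
      then have "a1 \<noteq> 0" using True by auto
      then have "a0 * (- (a2 + 1) / (2 * a1))\<^sup>2 + 2 * a1 * (- (a2 + 1) / (2 * a1)) * 1 + a2 * 1\<^sup>2 = - 1"
        using True by (simp add: field_simps)
      then show False using assms[of "- (a2 + 1) / (2 * a1)" 1] by linarith
    qed
  next
    case False
    have "a0 * (- a1)\<^sup>2 + 2 * a1 * (- a1) * a0 + a2 * a0\<^sup>2 = a0 * (a0 * a2 - a1\<^sup>2)" by algebra
    then have "0 \<le> a0 * (a0 * a2 - a1\<^sup>2)" using assms[of "- a1" a0] by simp
    then show ?thesis using False a by (simp add: zero_le_mult_iff)
  qed
qed

text \<open>Over the reals a definite form \<open>a\<close> is irreducible, so $ac = b^2$ makes \<open>b\<close> a multiple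
  $\mu a$ and $c = \mu^2 a$; then $2 b_1 - a_2 - c_0 = - a(\mu,-1) < 0$.  The proportionality
  is obtained by hand: after a shear that makes \<open>a\<close> diagonal, comparing coefficients forces the
  mixed coefficient of \<open>b\<close> to vanish.\<close>

lemma degenerate_of_curvature_nonneg:
  fixes a0 a1 a2 b0 b1 b2 c0 c1 c2 :: real
  assumes a: "\<And>x y. a0 * x\<^sup>2 + 2 * a1 * x * y + a2 * y\<^sup>2 \<ge> 0"
    and prod: "\<And>x y. (a0 * x\<^sup>2 + 2 * a1 * x * y + a2 * y\<^sup>2) * (c0 * x\<^sup>2 + 2 * c1 * x * y + c2 * y\<^sup>2)
     = (b0 * x\<^sup>2 + 2 * b1 * x * y + b2 * y\<^sup>2)\<^sup>2"
    and curv: "2 * b1 - a2 - c0 \<ge> 0"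
  shows "a0 * a2 = a1\<^sup>2"
proof (rule ccontr)
  assume "\<not> ?thesis"
  with psd_form_coeffs[OF a] have lt: "a1\<^sup>2 < a0 * a2" "a0 \<ge> 0" by auto
  then have a0: "a0 > 0" by (metis less_eq_real_def mult_zero_left not_less zero_le_power2)
  define s where "s = a1 / a0"
  have s: "a1 = s * a0" using a0 by (simp add: s_def)
  \<comment> \<open>the shear \<open>x \<mapsto> x - s y\<close> makes the first form diagonal\<close>
  define d where "d = a2 - s\<^sup>2 * a0"
  define b1' b2' c1' c2' where "b1' = b1 - s * b0" and "b2' = b2 - 2 * s * b1 + s\<^sup>2 * b0"
    and "c1' = c1 - s * c0" and "c2' = c2 - 2 * s * c1 + s\<^sup>2 * c0"
  have "a0 * d = a0 * a2 - a1\<^sup>2" unfolding d_def s by algebra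
  then have "a0 * d > 0" using lt by simp
  then have d: "d > 0" using a0 by (simp add: zero_less_mult_iff)
  have "(a0 * x\<^sup>2 + 2 * 0 * x * y + d * y\<^sup>2) * (c0 * x\<^sup>2 + 2 * c1' * x * y + c2' * y\<^sup>2)
     = (b0 * x\<^sup>2 + 2 * b1' * x * y + b2' * y\<^sup>2)\<^sup>2" for x y
    using prod[of "x - s * y" y] unfolding d_def b1'_def b2'_def c1'_def c2'_def s by algebra
  note co = quadratic_form_product_coeffs[OF this]
  define \<delta> where "\<delta> = b0 / a0 - b2' / d"
  have c0: "c0 = b0\<^sup>2 / a0" and c2: "c2' = b2'\<^sup>2 / d" using co(1,5) a0 d by (simp_all add: field_simps)
  have c1: "c1' = 2 * b0 * b1' / a0" "c1' = 2 * b1' * b2' / d" using co(2,4) a0 d by (simp_all add: field_simps)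
  then have "2 * (b1' * (b0 / a0)) = 2 * (b1' * (b2' / d))" by (simp add: mult_ac)
  then have "b1' * \<delta> = 0" by (simp add: \<delta>_def right_diff_distrib)
  moreover have "a0 * d * \<delta>\<^sup>2 = 4 * b1'\<^sup>2"
  proof -
    have "a0 * d * \<delta>\<^sup>2 = a0 * (b2'\<^sup>2 / d) + d * (b0\<^sup>2 / a0) - 2 * b0 * b2'"
      using a0 d unfolding \<delta>_def by (simp add: field_simps power2_eq_square)
    then show ?thesis using co(3) c0 c2 by simp
  qed
  ultimately have "b1' = 0" using a0 d by auto
  then have b1: "b1 = s * b0" by (simp add: b1'_def)
  define \<mu> where "\<mu> = b0 / a0"
  have b0: "b0 = \<mu> * a0" using a0 by (simp add: \<mu>_def)
  have "c0 = \<mu>\<^sup>2 * a0" unfolding c0 b0 using a0 by (simp add: power2_eq_square)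
  then have "2 * b1 - a2 - c0 = - (a0 * (\<mu> - s)\<^sup>2 + d)" unfolding b1 b0 d_def by algebra
  moreover have "a0 * (\<mu> - s)\<^sup>2 \<ge> 0" using a0 by simp
  ultimately show False using curv d by linarith
qed

lemma rank_one_form:
  fixes a0 a1 a2 :: real
  assumes "a0 \<ge> 0" "a2 \<ge> 0" "a0 * a2 = a1\<^sup>2"
  shows "\<exists>l m. a0 = l\<^sup>2 \<and> a1 = l * m \<and> a2 = m\<^sup>2"
proof (cases "a0 = 0")
  case True
  then show ?thesis using assms by (intro exI[of _ 0] exI[of _ "sqrt a2"]) auto
next
  case False
  then show ?thesis using assms
    by (intro exI[of _ "sqrt a0"] exI[of _ "a1 / sqrt a0"]) (auto simp: power_divide field_simps)
qed

lemma quadratic_forms_no_zero_divisors: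
  fixes p0 p1 p2 q0 q1 q2 :: real
  assumes "p0 * q0 = 0" "p0 * q1 + p1 * q0 = 0" "p0 * q2 + p1 * q1 + p2 * q0 = 0"
    "p1 * q2 + p2 * q1 = 0" "p2 * q2 = 0"
  shows "p0 = 0 \<and> p1 = 0 \<and> p2 = 0 \<or> q0 = 0 \<and> q1 = 0 \<and> q2 = 0"
  using assms by (cases "p0 = 0"; cases "p1 = 0"; cases "p2 = 0"; auto)

text \<open>The forms are the 2-jets of \<open>p\<^sup>2\<close>, \<open>p q\<close>, \<open>q\<^sup>2\<close> at a common zero, and the last hypothesis says that
  the curvature is nonnegative there.  Both \<open>a\<close> and \<open>c\<close> are then squares of linear forms, by symmetry
  under exchanging \<open>a\<close> with \<open>c\<close> and $x$ with $y$; finally \<open>b\<close> is plus or minus the product of these linear forms, and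
  the sign can be absorbed in the second one.\<close>

lemma jets_factor:
  fixes a0 a1 a2 b0 b1 b2 c0 c1 c2 :: real
  assumes a: "\<And>x y. a0 * x\<^sup>2 + 2 * a1 * x * y + a2 * y\<^sup>2 \<ge> 0"
    and c: "\<And>x y. c0 * x\<^sup>2 + 2 * c1 * x * y + c2 * y\<^sup>2 \<ge> 0"
    and prod: "\<And>x y. (a0 * x\<^sup>2 + 2 * a1 * x * y + a2 * y\<^sup>2) * (c0 * x\<^sup>2 + 2 * c1 * x * y + c2 * y\<^sup>2)
     = (b0 * x\<^sup>2 + 2 * b1 * x * y + b2 * y\<^sup>2)\<^sup>2"
    and curv: "2 * b1 - a2 - c0 \<ge> 0"
  obtains l11 l12 l21 l22 where
    "a0 = l11\<^sup>2" "a1 = l11 * l12" "a2 = l12\<^sup>2"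
    "b0 = l11 * l21" "2 * b1 = l11 * l22 + l12 * l21" "b2 = l12 * l22"
    "c0 = l21\<^sup>2" "c1 = l21 * l22" "c2 = l22\<^sup>2"
proof -
  have "a0 * a2 = a1\<^sup>2" by (rule degenerate_of_curvature_nonneg[OF a prod curv])
  then obtain l m where lm: "a0 = l\<^sup>2" "a1 = l * m" "a2 = m\<^sup>2"
    using rank_one_form psd_form_coeffs[OF a] by metis
  have "c2 * c0 = c1\<^sup>2"
  proof (rule degenerate_of_curvature_nonneg)
    show "c2 * x\<^sup>2 + 2 * c1 * x * y + c0 * y\<^sup>2 \<ge> 0" for x y using c[of y x] by (simp add: algebra_simps)
    show "(c2 * x\<^sup>2 + 2 * c1 * x * y + c0 * y\<^sup>2) * (a2 * x\<^sup>2 + 2 * a1 * x * y + a0 * y\<^sup>2)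
     = (b2 * x\<^sup>2 + 2 * b1 * x * y + b0 * y\<^sup>2)\<^sup>2" for x y using prod[of y x] by algebra
    show "2 * b1 - c0 - a2 \<ge> 0" using curv by simp
  qed
  then obtain k n where kn: "c0 = k\<^sup>2" "c1 = k * n" "c2 = n\<^sup>2"
    using rank_one_form[of c0 c2 c1] psd_form_coeffs[OF c] by (auto simp: mult.commute)
  note co = quadratic_form_product_coeffs[OF prod, unfolded lm kn]
  have "b0 - l * k = 0 \<and> 2 * b1 - (l * n + m * k) = 0 \<and> b2 - m * n = 0 \<or>
      b0 + l * k = 0 \<and> 2 * b1 + (l * n + m * k) = 0 \<and> b2 + m * n = 0"
    by (rule quadratic_forms_no_zero_divisors) (use co in algebra)+
  then show thesis
  proof
    assume "b0 - l * k = 0 \<and> 2 * b1 - (l * n + m * k) = 0 \<and> b2 - m * n = 0"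
    then show thesis using lm kn by (intro that[of l m k n]) auto
  next
    assume "b0 + l * k = 0 \<and> 2 * b1 + (l * n + m * k) = 0 \<and> b2 + m * n = 0"
    then show thesis using lm kn by (intro that[of l m "-k" "-n"]) auto
  qed
qed

text \<open>A symmetric matrix of rank at most one is $c\, n n^T$ up to a sign: \<open>c\<close> is the absolute value of
  the trace.  The zero matrix is included, with \<open>c = 0\<close>.\<close>

lemma symmetric_rank_one:
  fixes l11 l12 l22 :: real
  assumes "l11 * l22 = l12\<^sup>2"
  obtains \<sigma> c n1 n2 where "\<sigma> = 1 \<or> \<sigma> = -1" "c \<ge> 0" "n1\<^sup>2 + n2\<^sup>2 = 1"
    "\<sigma> * l11 = c * n1\<^sup>2" "\<sigma> * l12 = c * n1 * n2" "\<sigma> * l22 = c * n2\<^sup>2"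
proof -
  define \<sigma> :: real where "\<sigma> = (if l11 + l22 \<ge> 0 then 1 else -1)"
  define c where "c = \<sigma> * (l11 + l22)"
  have s: "\<sigma> = 1 \<or> \<sigma> = -1" "\<sigma> * \<sigma> = 1" and c: "c \<ge> 0" by (auto simp: \<sigma>_def c_def)
  show thesis
  proof (cases "c = 0")
    case True
    then have "l22 = - l11" using s by (auto simp: c_def)
    then have "l11\<^sup>2 + l12\<^sup>2 = 0" using assms by algebra
    then have "l11 = 0" "l12 = 0" by (simp_all add: sum_power2_eq_zero_iff)
    then show thesis using \<open>l22 = - l11\<close> by (intro that[of 1 0 1 0]) auto
  next
    case False
    have prod: "(\<sigma> * l11) * (\<sigma> * l22) = (\<sigma> * l12)\<^sup>2" using assms s by (auto simp: power2_eq_square)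
    have "\<sigma> * l11 \<ge> 0 \<and> \<sigma> * l22 \<ge> 0"
    proof (rule ccontr)
      assume "\<not> ?thesis"
      moreover have "(\<sigma> * l11) * (\<sigma> * l22) \<ge> 0" unfolding prod by simp
      ultimately have "\<sigma> * l11 + \<sigma> * l22 \<le> 0" by (auto simp: zero_le_mult_iff)
      then show False using False c by (simp add: c_def algebra_simps)
    qed
    then have "\<exists>l m. \<sigma> * l11 / c = l\<^sup>2 \<and> \<sigma> * l12 / c = l * m \<and> \<sigma> * l22 / c = m\<^sup>2"
      using c prod by (intro rank_one_form) (auto simp: power_divide power2_eq_square)
    then obtain l m where lm: "\<sigma> * l11 / c = l\<^sup>2" "\<sigma> * l12 / c = l * m" "\<sigma> * l22 / c = m\<^sup>2" by blast
    have "l\<^sup>2 + m\<^sup>2 = 1" unfolding lm[symmetric] using False by (simp add: c_def add_divide_distrib[symmetric] ring_distribs(1)[symmetric])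
    then show thesis using lm False s c by (intro that[of \<sigma> c l m]) (auto simp: field_simps)
  qed
qed

section \<open>A quantitative maximum principle\<close>

lemma second_derivative_nonpos_at_max:
  fixes \<phi> \<psi> :: "real \<Rightarrow> real"
  assumes d: "d > 0" and \<phi>: "\<And>t. \<bar>t\<bar> < d \<Longrightarrow> (\<phi> has_real_derivative \<psi> t) (at t)"
    and \<psi>: "(\<psi> has_real_derivative a) (at 0)" and max: "\<And>t. \<bar>t\<bar> < d \<Longrightarrow> \<phi> t \<le> \<phi> 0"
  shows "a \<le> 0"
proof (rule ccontr)
  assume "\<not> a \<le> 0"
  have "\<psi> 0 = 0" by (rule DERIV_local_max[OF \<phi> d]) (use d max in auto)
  obtain d' where d': "d' > 0" "\<And>h. 0 < h \<Longrightarrow> h < d' \<Longrightarrow> \<psi> 0 < \<psi> h"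
    using DERIV_pos_inc_right[OF \<psi>] \<open>\<not> a \<le> 0\<close> by auto
  define h where "h = min d d' / 2"
  have h: "0 < h" "h < d" "h < d'" using d d' by (auto simp: h_def)
  obtain \<xi> where "0 < \<xi>" "\<xi> < h" "\<phi> h - \<phi> 0 = (h - 0) * \<psi> \<xi>"
    using MVT2[OF h(1), of \<phi> \<psi>] \<phi> h by auto
  moreover have "\<psi> \<xi> > 0" using d'(2)[of \<xi>] h \<open>\<psi> 0 = 0\<close> \<open>0 < \<xi>\<close> \<open>\<xi> < h\<close> by auto
  ultimately have "\<phi> h > \<phi> 0" using h by (metis diff_gt_0_iff_gt diff_zero mult_pos_pos)
  then show False using max[of h] h by auto
qed

text \<open>If the gradient $(p,q)$ of \<open>u\<close> were exactly $\tau (n \cdot z) n$, the Laplacian would be $\tau \le 0$.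
  So closeness of the gradient to this field limits how positive the Laplacian can be, although nothing
  is assumed about the difference of the derivatives.  Subtract
  $\frac{\tau}{2} (n \cdot z)^2 + \frac C8 |z - z_c|^2$ from \<open>u\<close>: the remaining function has positive Laplacian,
  hence its maximum over the disc is on the boundary, where the second term costs $C R^2 / 8$ compared with
  the centre; the variation of \<open>u\<close> minus the first term is at most $2 \eta R$.\<close>

lemma maximum_principle_estimate:
  fixes u p q :: "real^2 \<Rightarrow> real" and zc n :: "real^2"
  assumes R: "R > 0" and C: "C > 0" and n: "norm n = 1" and \<tau>: "\<tau> \<le> 0"
    and du: "\<And>z. z \<in> cball zc R \<Longrightarrow> (u has_derivative (\<lambda>h. p z * h $ 1 + q z * h $ 2)) (at z)"
    and lap: "\<And>z. z \<in> cball zc R \<Longrightarrow> \<exists>a b. has_partial 1 p a z \<and> has_partial 2 q b z \<and> a + b \<ge> C"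
    and close: "\<And>z. z \<in> cball zc R \<Longrightarrow> \<bar>p z - \<tau> * (n \<bullet> z) * n $ 1\<bar> \<le> \<eta>"
       "\<And>z. z \<in> cball zc R \<Longrightarrow> \<bar>q z - \<tau> * (n \<bullet> z) * n $ 2\<bar> \<le> \<eta>"
  shows "C * R / 16 \<le> \<eta>"
proof -
  define v where "v z = u z - \<tau> / 2 * (n \<bullet> z)\<^sup>2" for z
  define w where "w z = v z - C / 8 * ((z - zc) \<bullet> (z - zc))" for z
  have n1: "(n $ 1)\<^sup>2 + (n $ 2)\<^sup>2 = 1"
    using n by (simp add: norm_eq_1 inner_vec_def sum_2 power2_eq_square)
  have inner2: "n \<bullet> h = n $ 1 * h $ 1 + n $ 2 * h $ 2" for h :: "real^2" by (simp add: inner_vec_def sum_2)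
  have dn: "((\<lambda>z. \<tau> / 2 * (n \<bullet> z)\<^sup>2) has_derivative (\<lambda>h. \<tau> * (n \<bullet> z) * (n \<bullet> h))) (at z)" for z
    by (auto intro!: derivative_eq_intros simp: fun_eq_iff)
  have dc: "((\<lambda>z. C / 8 * ((z - zc) \<bullet> (z - zc))) has_derivative (\<lambda>h. C / 4 * ((z - zc) \<bullet> h))) (at z)" for z
    by (auto intro!: derivative_eq_intros simp: fun_eq_iff inner_commute)
  have dv: "(v has_derivative (\<lambda>h. (p z - \<tau> * (n \<bullet> z) * n $ 1) * h $ 1 + (q z - \<tau> * (n \<bullet> z) * n $ 2) * h $ 2)) (at z)"
    if "z \<in> cball zc R" for z
    unfolding v_def[abs_def]
    by (rule has_derivative_eq_rhs[OF has_derivative_diff[OF du[OF that] dn]])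
      (simp add: fun_eq_iff inner2[of h for h] algebra_simps)
  define w1 where "w1 i z = (if i = 1 then p z else q z) - \<tau> * (n \<bullet> z) * n $ i - C / 4 * (z - zc) $ i" for i :: 2 and z
  have dw: "(w has_derivative (\<lambda>h. w1 1 z * h $ 1 + w1 2 z * h $ 2)) (at z)" if "z \<in> cball zc R" for z
    unfolding w_def[abs_def]
    by (rule has_derivative_eq_rhs[OF has_derivative_diff[OF dv[OF that] dc]])
      (simp add: fun_eq_iff w1_def inner_vec_def sum_2 algebra_simps)
  have "continuous_on (cball zc R) w"
    using has_derivative_continuous[OF dw] by (simp add: continuous_at_imp_continuous_on)
  then obtain zm where zm: "zm \<in> cball zc R" "\<And>z. z \<in> cball zc R \<Longrightarrow> w z \<le> w zm"
    using continuous_attains_sup[of "cball zc R" w] R by auto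
  have "zm \<notin> ball zc R"
  proof
    assume "zm \<in> ball zc R"
    define d where "d = R - dist zc zm"
    have d: "d > 0" using \<open>zm \<in> ball zc R\<close> by (simp add: d_def)
    have near: "zm + t *\<^sub>R axis i 1 \<in> cball zc R" if "\<bar>t\<bar> < d" for t and i :: 2
    proof -
      have "dist zm (zm + t *\<^sub>R axis i 1) = \<bar>t\<bar>" by (simp add: dist_norm)
      then show ?thesis using dist_triangle[of zc "zm + t *\<^sub>R axis i 1" zm] that by (simp add: d_def)
    qed
    have nonpos: "a \<le> 0" if "((\<lambda>t. w1 i (zm + t *\<^sub>R axis i 1)) has_real_derivative a) (at 0)" for a i
    proof (rule second_derivative_nonpos_at_max[OF d _ that])
      show "((\<lambda>t. w (zm + t *\<^sub>R axis i 1)) has_real_derivative w1 i (zm + t *\<^sub>R axis i 1)) (at t)" if "\<bar>t\<bar> < d" for t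
      proof -
        have "w1 1 y * axis i 1 $ 1 + w1 2 y * axis i 1 $ 2 = w1 i y" for y
          using exhaust_2[of i] by (auto simp: axis_def)
        then show ?thesis using has_real_derivative_along_line[OF dw[OF near[OF that, of i]]] by simp
      qed
      show "w (zm + t *\<^sub>R axis i 1) \<le> w (zm + 0 *\<^sub>R axis i 1)" if "\<bar>t\<bar> < d" for t
        using zm(2)[OF near[OF that]] by simp
    qed
    obtain a b where ab: "has_partial 1 p a zm" "has_partial 2 q b zm" "a + b \<ge> C" using lap[OF zm(1)] by blast
    have "((\<lambda>t. w1 1 (zm + t *\<^sub>R axis 1 1)) has_real_derivative a - \<tau> * (n $ 1)\<^sup>2 - C / 4) (at 0)"
      unfolding w1_def using ab(1)[unfolded has_partial_def]
      by (auto intro!: derivative_eq_intros simp: inner2 axis_def power2_eq_square)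
    from nonpos[OF this] have 1: "a - \<tau> * (n $ 1)\<^sup>2 - C / 4 \<le> 0" .
    have "((\<lambda>t. w1 2 (zm + t *\<^sub>R axis 2 1)) has_real_derivative b - \<tau> * (n $ 2)\<^sup>2 - C / 4) (at 0)"
      unfolding w1_def using ab(2)[unfolded has_partial_def]
      by (auto intro!: derivative_eq_intros simp: inner2 axis_def power2_eq_square)
    from nonpos[OF this] have 2: "b - \<tau> * (n $ 2)\<^sup>2 - C / 4 \<le> 0" .
    have "\<tau> * (n $ 1)\<^sup>2 + \<tau> * (n $ 2)\<^sup>2 = \<tau>" using n1 by (simp add: distrib_left[symmetric])
    then show False using 1 2 ab(3) \<tau> C by linarith
  qed
  then have dist: "norm (zm - zc) = R" using zm(1) by (simp add: dist_norm norm_minus_commute)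
  have "w zc \<le> w zm" using zm(2) R by simp
  then have "C / 8 * R\<^sup>2 \<le> v zm - v zc"
    using dist by (simp add: w_def power2_norm_eq_inner[symmetric])
  also have "\<dots> \<le> norm (v zm - v zc)" by simp
  also have "\<dots> \<le> 2 * \<eta> * norm (zm - zc)"
  proof (rule differentiable_bound[of "cball zc R" v
      "\<lambda>z h. (p z - \<tau> * (n \<bullet> z) * n $ 1) * h $ 1 + (q z - \<tau> * (n \<bullet> z) * n $ 2) * h $ 2"])
    show "(v has_derivative (\<lambda>h. (p z - \<tau> * (n \<bullet> z) * n $ 1) * h $ 1 + (q z - \<tau> * (n \<bullet> z) * n $ 2) * h $ 2)) (at z within cball zc R)"
      if "z \<in> cball zc R" for z using dv[OF that] by (rule has_derivative_at_withinI)
    show "onorm (\<lambda>h :: real^2. (p z - \<tau> * (n \<bullet> z) * n $ 1) * h $ 1 + (q z - \<tau> * (n \<bullet> z) * n $ 2) * h $ 2) \<le> 2 * \<eta>"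
      if z: "z \<in> cball zc R" for z
    proof (rule onorm_le)
      fix h :: "real^2"
      have "\<bar>(p z - \<tau> * (n \<bullet> z) * n $ 1) * h $ 1\<bar> \<le> \<eta> * norm h" "\<bar>(q z - \<tau> * (n \<bullet> z) * n $ 2) * h $ 2\<bar> \<le> \<eta> * norm h"
        using mult_mono[OF close(1)[OF z] component_le_norm_cart[of h 1]] mult_mono[OF close(2)[OF z] component_le_norm_cart[of h 2]]
          close(1)[OF z] by (auto simp: abs_mult)
      then show "norm ((p z - \<tau> * (n \<bullet> z) * n $ 1) * h $ 1 + (q z - \<tau> * (n \<bullet> z) * n $ 2) * h $ 2) \<le> 2 * \<eta> * norm h"
        unfolding real_norm_def by linarith
    qed
  qed (use zm(1) R in auto)
  finally have "C / 8 * R\<^sup>2 \<le> 2 * \<eta> * R" by (simp add: dist)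
  then show ?thesis using R by (simp add: power2_eq_square field_simps)
qed

section \<open>Functions with smooth products\<close>

lemma differentiable_min_zero:
  fixes f :: "'a::euclidean_space \<Rightarrow> real"
  assumes "open U" "z \<in> U" "smooth_on U f" "f z = 0" "\<And>x. x \<in> U \<Longrightarrow> f x \<ge> 0"
  shows "frechet_derivative f (at z) = (\<lambda>v. 0)"
  by (rule differential_zero_maxmin[of z U f, OF assms(2,1) smooth_on_has_derivative[OF assms(3,2)]])
    (use assms(4,5) in auto)

lemma hessian_limit:
  fixes f :: "'a::euclidean_space \<Rightarrow> real"
  assumes U: "open U" "z \<in> U" and f: "smooth_on U f"
    and crit: "f z = 0" "\<And>v. frechet_derivative f (at z) v = 0"
  shows "((\<lambda>s. f (z + s *\<^sub>R v) / s\<^sup>2) \<longlongrightarrow> hessian f z v v / 2) (at_right 0)"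
proof (rule tendstoI)
  fix \<eta> :: real assume \<eta>: "\<eta> > 0"
  define k where "k = (norm v)\<^sup>2 + 1"
  have k: "k > 0" "(norm v)\<^sup>2 < k" by (simp_all add: k_def add_nonneg_pos)
  obtain \<delta> where \<delta>: "\<delta> > 0" "\<And>w. norm w < \<delta> \<Longrightarrow> \<bar>f (z + w) - hessian f z w w / 2\<bar> \<le> \<eta> / k * (norm w)\<^sup>2"
    using second_order_expansion[OF U f crit, of "\<eta> / k"] \<eta> k by auto
  have hs: "hessian f z (s *\<^sub>R v) (s *\<^sub>R v) = s\<^sup>2 * hessian f z v v" for s
    unfolding hessian_expand[OF U f, of "s *\<^sub>R v"] hessian_expand[OF U f, of v]
    by (simp add: sum_distrib_left power2_eq_square mult_ac)
  show "\<forall>\<^sub>F s in at_right 0. dist (f (z + s *\<^sub>R v) / s\<^sup>2) (hessian f z v v / 2) < \<eta>"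
    unfolding eventually_at_right_field
  proof (intro exI[of _ "\<delta> / (norm v + 1)"] conjI allI impI)
    show "0 < \<delta> / (norm v + 1)" using \<delta> by (simp add: add_nonneg_pos)
    fix s assume s: "0 < s" "s < \<delta> / (norm v + 1)"
    have "s * norm v \<le> s * (norm v + 1)" using s by simp
    also have "\<dots> < \<delta>" using s by (simp add: pos_less_divide_eq add_nonneg_pos)
    finally have "norm (s *\<^sub>R v) < \<delta>" using s by simp
    from \<delta>(2)[OF this] have "\<bar>f (z + s *\<^sub>R v) - s\<^sup>2 * hessian f z v v / 2\<bar> \<le> \<eta> / k * (norm v)\<^sup>2 * s\<^sup>2"
      by (simp add: hs power_mult_distrib mult_ac)
    moreover have "dist (f (z + s *\<^sub>R v) / s\<^sup>2) (hessian f z v v / 2) = \<bar>f (z + s *\<^sub>R v) - s\<^sup>2 * hessian f z v v / 2\<bar> / s\<^sup>2"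
    proof -
      have "f (z + s *\<^sub>R v) / s\<^sup>2 - hessian f z v v / 2 = (f (z + s *\<^sub>R v) - s\<^sup>2 * hessian f z v v / 2) / s\<^sup>2"
        using s by (simp add: field_simps)
      then show ?thesis by (simp add: dist_real_def)
    qed
    ultimately have "dist (f (z + s *\<^sub>R v) / s\<^sup>2) (hessian f z v v / 2) \<le> \<eta> / k * (norm v)\<^sup>2"
      using s by (simp add: pos_divide_le_eq)
    also have "\<dots> < \<eta> / k * k" using k \<eta> by (intro mult_strict_left_mono) auto
    finally show "dist (f (z + s *\<^sub>R v) / s\<^sup>2) (hessian f z v v / 2) < \<eta>" using k by simp
  qed
qed

lemma Basis_real2: "(Basis :: (real^2) set) = {axis 1 1, axis 2 1}"
  unfolding Basis_vec_def by (auto simp: UNIV_2)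

lemma hessian_real2:
  fixes f :: "real^2 \<Rightarrow> real"
  assumes U: "open U" "z \<in> U" and f: "smooth_on U f"
  shows "hessian f z v v = hessian f z (axis 1 1) (axis 1 1) * (v $ 1)\<^sup>2
    + 2 * hessian f z (axis 1 1) (axis 2 1) * v $ 1 * v $ 2 + hessian f z (axis 2 1) (axis 2 1) * (v $ 2)\<^sup>2"
proof -
  have ne: "axis 1 1 \<noteq> (axis 2 1 :: real^2)" by (simp add: axis_eq_axis)
  show ?thesis
    unfolding hessian_expand[OF U f, of v v] Basis_real2
    using hessian_sym[OF U f, of "axis 2 1" "axis 1 1"] ne
    by (simp add: inner_axis power2_eq_square algebra_simps)
qed

text \<open>With $V = (p,q)$ and $W = (l,m)$ the left-hand side is $|V - W|^2 |V + W|^2$.  It equals twice the squared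
  Frobenius norm of $V V^T - W W^T$ minus $(|V|^2 - |W|^2)^2$.  So closeness of the products makes \<open>V\<close> close to
  \<open>W\<close> or to \<open>-W\<close>.\<close>

lemma rank_one_difference_bound:
  fixes p q l m d :: real
  assumes "\<bar>p * p - l * l\<bar> \<le> d" "\<bar>p * q - l * m\<bar> \<le> d" "\<bar>q * q - m * m\<bar> \<le> d"
  shows "((p - l)\<^sup>2 + (q - m)\<^sup>2) * ((p + l)\<^sup>2 + (q + m)\<^sup>2) \<le> 8 * d\<^sup>2"
proof -
  have sq: "x\<^sup>2 \<le> d\<^sup>2" if "\<bar>x\<bar> \<le> d" for x using that by (metis abs_le_square_iff abs_ge_self abs_of_nonneg order_trans abs_ge_zero)
  have "((p - l)\<^sup>2 + (q - m)\<^sup>2) * ((p + l)\<^sup>2 + (q + m)\<^sup>2) + (p\<^sup>2 + q\<^sup>2 - l\<^sup>2 - m\<^sup>2)\<^sup>2 =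
     2 * ((p * p - l * l)\<^sup>2 + 2 * (p * q - l * m)\<^sup>2 + (q * q - m * m)\<^sup>2)" by algebra
  moreover have "(p\<^sup>2 + q\<^sup>2 - l\<^sup>2 - m\<^sup>2)\<^sup>2 \<ge> 0" by simp
  moreover have "X \<le> 8 * D" if "X + S = 2 * (a + 2 * b + c)" "0 \<le> S" "a \<le> D" "b \<le> D" "c \<le> D"
    for X S a b c D :: real using that by argo
  ultimately show ?thesis using sq[OF assms(1)] sq[OF assms(2)] sq[OF assms(3)] by blast
qed

lemma smooth_near_nonzero:
  fixes P Q :: "'a::euclidean_space \<Rightarrow> real"
  assumes U: "open U" "z \<in> U" and P: "continuous_on U P" "P z \<noteq> 0"
    and PP: "smooth_on U (\<lambda>z. P z * P z)" and PQ: "smooth_on U (\<lambda>z. P z * Q z)"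
  shows "\<exists>T. open T \<and> z \<in> T \<and> smooth_on T P \<and> smooth_on T Q"
proof -
  define \<sigma> where "\<sigma> = sgn (P z)"
  have "isCont (\<lambda>z. \<sigma> * P z) z" using P(1) U continuous_on_eq_continuous_at by (intro continuous_intros) blast
  moreover have "\<sigma> * P z > 0" using P(2) by (simp add: \<sigma>_def sgn_if)
  ultimately have "\<forall>\<^sub>F x in nhds z. \<sigma> * P x > 0" by (rule eventually_nhds_isCont(1))
  then have "\<forall>\<^sub>F x in nhds z. x \<in> U \<and> \<sigma> * P x > 0"
    using eventually_nhds_in_open[OF U] by eventually_elim auto
  then obtain T where T: "open T" "z \<in> T" "\<And>x. x \<in> T \<Longrightarrow> x \<in> U \<and> \<sigma> * P x > 0"
    unfolding eventually_nhds by auto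
  have TU: "T \<subseteq> U" using T by auto
  have s: "\<sigma> = 1 \<or> \<sigma> = -1" using P(2) by (auto simp: \<sigma>_def sgn_if)
  have nz: "P x * P x > 0" if "x \<in> T" for x using T(3)[OF that] s by (auto simp: zero_less_mult_iff)
  have r: "smooth_on T (\<lambda>x. sqrt (P x * P x))"
    by (rule smooth_on_sqrt[OF T(1) smooth_on_subset[OF PP TU] nz])
  have "smooth_on T (\<lambda>x. \<sigma> * sqrt (P x * P x))"
    by (rule smooth_on_mult[OF T(1) smooth_on_const[OF T(1)] r])
  from smooth_on_cong[OF T(1) _ this, of P] have sP: "smooth_on T P" using T(3) s by force
  have "smooth_on T (\<lambda>x. (P x * Q x) / P x)"
    by (rule smooth_on_divide[OF T(1) smooth_on_subset[OF PQ TU] sP]) (use nz in force)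
  from smooth_on_cong[OF T(1) _ this, of Q] have "smooth_on T Q" using nz by force
  then show ?thesis using T sP by blast
qed

text \<open>The situation of a gradient $(p,q)$ for which the metric $dx^2 + dy^2 + (p\,dx + q\,dy)^2$ is smooth.\<close>

locale smooth_products =
  fixes p q :: "real^2 \<Rightarrow> real" and U :: "(real^2) set"
  assumes U: "open U" and p: "continuous_on U p" and q: "continuous_on U q"
    and pp: "smooth_on U (\<lambda>z. p z * p z)" and pq: "smooth_on U (\<lambda>z. p z * q z)"
    and qq: "smooth_on U (\<lambda>z. q z * q z)"
begin

lemma smooth_near_noncritical:
  assumes "z \<in> U" "p z \<noteq> 0 \<or> q z \<noteq> 0"
  shows "\<exists>T. open T \<and> z \<in> T \<and> smooth_on T p \<and> smooth_on T q"
  using assms(2)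
proof
  assume "p z \<noteq> 0"
  from smooth_near_nonzero[OF U assms(1) p this pp pq] show ?thesis .
next
  assume "q z \<noteq> 0"
  have "smooth_on U (\<lambda>z. q z * p z)" using pq by (simp add: mult.commute)
  from smooth_near_nonzero[OF U assms(1) q \<open>q z \<noteq> 0\<close> qq this] show ?thesis by blast
qed

lemma smooth_combination:
  "smooth_on U (\<lambda>z. \<alpha> * (p z * p z) + \<beta> * (p z * q z) + \<gamma> * (q z * q z))"
  by (intro smooth_on_add smooth_on_mult smooth_on_const U pp pq qq)

text \<open>The squares have a minimum at \<open>z\<close>, and so has $(p + q)^2$, which gives the mixed product.\<close>

lemma critical_products:
  assumes z: "z \<in> U" "p z = 0" "q z = 0"
  shows "frechet_derivative (\<lambda>z. p z * p z) (at z) = (\<lambda>v. 0)"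
    "frechet_derivative (\<lambda>z. p z * q z) (at z) = (\<lambda>v. 0)"
    "frechet_derivative (\<lambda>z. q z * q z) (at z) = (\<lambda>v. 0)"
proof -
  show 1: "frechet_derivative (\<lambda>z. p z * p z) (at z) = (\<lambda>v. 0)"
    by (rule differentiable_min_zero[OF U z(1) pp]) (auto simp: z)
  show 2: "frechet_derivative (\<lambda>z. q z * q z) (at z) = (\<lambda>v. 0)"
    by (rule differentiable_min_zero[OF U z(1) qq]) (auto simp: z)
  \<comment> \<open>the square of \<open>p + q\<close>, written as a combination of the products\<close>
  let ?S = "\<lambda>z. 1 * (p z * p z) + 2 * (p z * q z) + 1 * (q z * q z)"
  have "?S x = (p x + q x)\<^sup>2" for x by algebra
  then have 3: "frechet_derivative ?S (at z) = (\<lambda>v. 0)"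
    by (intro differentiable_min_zero[OF U z(1) smooth_combination]) (auto simp: z)
  have "((\<lambda>x. (?S x - p x * p x - q x * q x) * (1/2)) has_derivative (\<lambda>v. (0 - 0 - 0) * (1/2))) (at z)"
    using smooth_on_has_derivative[OF pp z(1)] smooth_on_has_derivative[OF qq z(1)]
      smooth_on_has_derivative[OF smooth_combination z(1), of 1 2 1]
    unfolding 1 2 3 by (intro has_derivative_mult_left has_derivative_diff)
  moreover have "(\<lambda>x. (?S x - p x * p x - q x * q x) * (1/2)) = (\<lambda>x. p x * q x)" by (auto simp: fun_eq_iff)
  ultimately have "((\<lambda>x. p x * q x) has_derivative (\<lambda>v. 0)) (at z)" by simp
  from frechet_derivative_at[OF this] show "frechet_derivative (\<lambda>z. p z * q z) (at z) = (\<lambda>v. 0)" by simp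
qed

lemma product_limits:
  assumes z: "z \<in> U" "p z = 0" "q z = 0"
  shows "((\<lambda>s. p (z + s *\<^sub>R v) * p (z + s *\<^sub>R v) / s\<^sup>2) \<longlongrightarrow> hessian (\<lambda>z. p z * p z) z v v / 2) (at_right 0)"
    "((\<lambda>s. p (z + s *\<^sub>R v) * q (z + s *\<^sub>R v) / s\<^sup>2) \<longlongrightarrow> hessian (\<lambda>z. p z * q z) z v v / 2) (at_right 0)"
    "((\<lambda>s. q (z + s *\<^sub>R v) * q (z + s *\<^sub>R v) / s\<^sup>2) \<longlongrightarrow> hessian (\<lambda>z. q z * q z) z v v / 2) (at_right 0)"
  using hessian_limit[OF U z(1) pp] hessian_limit[OF U z(1) pq] hessian_limit[OF U z(1) qq]
    critical_products[OF z] z by auto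

text \<open>To second order at \<open>z\<close>, the matrix of products of $(p,q)$ is $(L v)(L v)^T$ for the matrix \<open>L\<close> with rows
  $(l_{11}, l_{12})$ and $(l_{21}, l_{22})$.\<close>

definition product_jets :: "real^2 \<Rightarrow> real \<Rightarrow> real \<Rightarrow> real \<Rightarrow> real \<Rightarrow> bool" where
  "product_jets z l11 l12 l21 l22 \<longleftrightarrow>
     (\<forall>v. hessian (\<lambda>z. p z * p z) z v v / 2 = (l11 * v $ 1 + l12 * v $ 2) * (l11 * v $ 1 + l12 * v $ 2)) \<and>
     (\<forall>v. hessian (\<lambda>z. p z * q z) z v v / 2 = (l11 * v $ 1 + l12 * v $ 2) * (l21 * v $ 1 + l22 * v $ 2)) \<and>
     (\<forall>v. hessian (\<lambda>z. q z * q z) z v v / 2 = (l21 * v $ 1 + l22 * v $ 2) * (l21 * v $ 1 + l22 * v $ 2))"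

text \<open>The 2-jets inherit $p^2 \cdot q^2 = (pq)^2$ and the signs as limits along rays.  The number \<open>K\<close> is
  the Gauss curvature at \<open>z\<close> of the metric $dx^2 + dy^2 + (p\,dx + q\,dy)^2$.  In terms of the
  linear map \<open>L\<close> with the coefficients obtained here, \<open>(p, q)\<close> is to first order $\pm L$, where the sign may still depend on
  the point, and \<open>L\<close> need not be symmetric a priori.\<close>

lemma jets:
  assumes z: "z \<in> U" "p z = 0" "q z = 0"
    and curv: "partial 1 (partial 2 (\<lambda>z. p z * q z)) z - partial 1 (partial 1 (\<lambda>z. q z * q z)) z / 2
       - partial 2 (partial 2 (\<lambda>z. p z * p z)) z / 2 = K" "K \<ge> 0"
  obtains l11 l12 l21 l22 where
    "product_jets z l11 l12 l21 l22" "K = (l11 * l22 - l12 * l21) - (l12 - l21)\<^sup>2"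
proof -
  let ?H = "\<lambda>f i j. hessian f z (axis i 1) (axis j 1) / 2"
  let ?A = "\<lambda>z. p z * p z" and ?B = "\<lambda>z. p z * q z" and ?C = "\<lambda>z. q z * q z"
  have form: "hessian f z v v / 2 = ?H f 1 1 * (v $ 1)\<^sup>2 + 2 * ?H f 1 2 * v $ 1 * v $ 2 + ?H f 2 2 * (v $ 2)\<^sup>2"
    if "smooth_on U f" for f v using hessian_real2[OF U z(1) that, of v] by simp
  note lim = product_limits[OF z]
  let ?v = "\<lambda>x y. vector [x, y] :: real^2"
  have a: "hessian ?A z v v / 2 \<ge> 0" for v
    by (rule tendsto_lowerbound[OF lim(1)]) (auto intro!: always_eventually)
  have c: "hessian ?C z v v / 2 \<ge> 0" for v
    by (rule tendsto_lowerbound[OF lim(3)]) (auto intro!: always_eventually)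
  have ac: "hessian ?A z v v / 2 * (hessian ?C z v v / 2) = (hessian ?B z v v / 2)\<^sup>2" for v
  proof (rule tendsto_unique[OF _ tendsto_mult[OF lim(1) lim(3)]])
    show "((\<lambda>s. p (z + s *\<^sub>R v) * p (z + s *\<^sub>R v) / s\<^sup>2 * (q (z + s *\<^sub>R v) * q (z + s *\<^sub>R v) / s\<^sup>2)) \<longlongrightarrow>
       (hessian ?B z v v / 2)\<^sup>2) (at_right 0)"
      using tendsto_power[OF lim(2)[of v], of 2] by (simp add: power2_eq_square mult_ac)
  qed simp
  have K: "K = ?H ?B 1 2 * 2 - ?H ?C 1 1 - ?H ?A 2 2"
    using curv(1) hessian_sym[OF U z(1) pq, of "axis 2 1" "axis 1 1"]
    by (simp add: partial_partial_eq_hessian[OF U _ z(1)] pp pq qq)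
  have 1: "?H ?A 1 1 * x\<^sup>2 + 2 * ?H ?A 1 2 * x * y + ?H ?A 2 2 * y\<^sup>2 \<ge> 0" for x y
    using a[of "?v x y"] unfolding form[OF pp, of "?v x y"] by (simp only: vector_2)
  have 2: "?H ?C 1 1 * x\<^sup>2 + 2 * ?H ?C 1 2 * x * y + ?H ?C 2 2 * y\<^sup>2 \<ge> 0" for x y
    using c[of "?v x y"] unfolding form[OF qq, of "?v x y"] by (simp only: vector_2)
  have 3: "(?H ?A 1 1 * x\<^sup>2 + 2 * ?H ?A 1 2 * x * y + ?H ?A 2 2 * y\<^sup>2) * (?H ?C 1 1 * x\<^sup>2 + 2 * ?H ?C 1 2 * x * y + ?H ?C 2 2 * y\<^sup>2)
    = (?H ?B 1 1 * x\<^sup>2 + 2 * ?H ?B 1 2 * x * y + ?H ?B 2 2 * y\<^sup>2)\<^sup>2" for x y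
    using ac[of "?v x y"]
    unfolding form[OF qq, of "?v x y"] form[OF pp, of "?v x y"] form[OF pq, of "?v x y"] by (simp only: vector_2)
  have 4: "2 * ?H ?B 1 2 - ?H ?A 2 2 - ?H ?C 1 1 \<ge> 0" using K curv(2) by simp
  obtain l11 l12 l21 l22 where l:
    "?H ?A 1 1 = l11\<^sup>2" "?H ?A 1 2 = l11 * l12" "?H ?A 2 2 = l12\<^sup>2"
    "?H ?B 1 1 = l11 * l21" "2 * ?H ?B 1 2 = l11 * l22 + l12 * l21" "?H ?B 2 2 = l12 * l22"
    "?H ?C 1 1 = l21\<^sup>2" "?H ?C 1 2 = l21 * l22" "?H ?C 2 2 = l22\<^sup>2"
    by (rule jets_factor[OF 1 2 3 4])
  show thesis
  proof
    have "hessian ?A z v v / 2 = (l11 * v $ 1 + l12 * v $ 2) * (l11 * v $ 1 + l12 * v $ 2)" for v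
      unfolding form[OF pp, of v] l by algebra
    moreover have "hessian ?B z v v / 2 = (l11 * v $ 1 + l12 * v $ 2) * (l21 * v $ 1 + l22 * v $ 2)" for v
      unfolding form[OF pq, of v] l by algebra
    moreover have "hessian ?C z v v / 2 = (l21 * v $ 1 + l22 * v $ 2) * (l21 * v $ 1 + l22 * v $ 2)" for v
      unfolding form[OF qq, of v] l by algebra
    ultimately show "product_jets z l11 l12 l21 l22" unfolding product_jets_def by blast
    show "K = (l11 * l22 - l12 * l21) - (l12 - l21)\<^sup>2"
      unfolding K mult.commute[of "?H ?B 1 2" 2] l by algebra
  qed
qed

lemma products_expansion:
  assumes z: "z \<in> U" "p z = 0" "q z = 0" and \<eta>: "\<eta> > 0"
  shows "\<exists>\<delta>>0. \<forall>v. norm v < \<delta> \<longrightarrow> z + v \<in> U \<and>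
     \<bar>p (z + v) * p (z + v) - hessian (\<lambda>z. p z * p z) z v v / 2\<bar> \<le> \<eta> * (norm v)\<^sup>2 \<and>
     \<bar>p (z + v) * q (z + v) - hessian (\<lambda>z. p z * q z) z v v / 2\<bar> \<le> \<eta> * (norm v)\<^sup>2 \<and>
     \<bar>q (z + v) * q (z + v) - hessian (\<lambda>z. q z * q z) z v v / 2\<bar> \<le> \<eta> * (norm v)\<^sup>2"
proof -
  note cr = critical_products[OF z]
  obtain d1 where 1: "d1 > 0" "\<And>v. norm v < d1 \<Longrightarrow> z + v \<in> U \<and> \<bar>p (z + v) * p (z + v) - hessian (\<lambda>z. p z * p z) z v v / 2\<bar> \<le> \<eta> * (norm v)\<^sup>2"
    using second_order_expansion[OF U z(1) pp _ _ \<eta>] cr z by auto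
  obtain d2 where 2: "d2 > 0" "\<And>v. norm v < d2 \<Longrightarrow> \<bar>p (z + v) * q (z + v) - hessian (\<lambda>z. p z * q z) z v v / 2\<bar> \<le> \<eta> * (norm v)\<^sup>2"
    using second_order_expansion[OF U z(1) pq _ _ \<eta>] cr z by auto
  obtain d3 where 3: "d3 > 0" "\<And>v. norm v < d3 \<Longrightarrow> \<bar>q (z + v) * q (z + v) - hessian (\<lambda>z. q z * q z) z v v / 2\<bar> \<le> \<eta> * (norm v)\<^sup>2"
    using second_order_expansion[OF U z(1) qq _ _ \<eta>] cr z by auto
  show ?thesis using 1 2 3 by (intro exI[of _ "min d1 (min d2 d3)"]) simp
qed

text \<open>After a rotation and scaling of $(p,q)$, this is the sign change of the component in the direction
  $(m_1, m_2)$; the component orthogonal to it plays the part of the second function.\<close>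

lemma smooth_near_sign_change:
  assumes z: "z \<in> U" "p z = 0" "q z = 0" and e: "norm e = 1" 
    and m: "m1\<^sup>2 + m2\<^sup>2 \<noteq> 0"
    and H: "hessian (\<lambda>z. p z * p z) z e e / 2 = l * l" "hessian (\<lambda>z. p z * q z) z e e / 2 = l * k"
       "hessian (\<lambda>z. q z * q z) z e e / 2 = k * k" and nz: "m1 * l + m2 * k \<noteq> 0"
    and sign: "\<forall>\<^sub>F s in at_right 0. m1 * p (z + s *\<^sub>R e) + m2 * q (z + s *\<^sub>R e) > 0 \<and>
        m1 * p (z - s *\<^sub>R e) + m2 * q (z - s *\<^sub>R e) < 0"
  shows "\<exists>T. open T \<and> z \<in> T \<and> smooth_on T p \<and> smooth_on T q"
proof -
  define P Q where "P x = m1 * p x + m2 * q x" and "Q x = m1 * q x - m2 * p x" for x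
  have PP: "smooth_on U (\<lambda>x. P x * P x)"
    by (rule smooth_on_cong[OF U _ smooth_combination[of "m1\<^sup>2" "2 * m1 * m2" "m2\<^sup>2"]])
      (simp add: P_def power2_eq_square algebra_simps)
  have PQ: "smooth_on U (\<lambda>x. P x * Q x)"
    by (rule smooth_on_cong[OF U _ smooth_combination[of "- (m1 * m2)" "m1\<^sup>2 - m2\<^sup>2" "m1 * m2"]])
      (simp add: P_def Q_def power2_eq_square algebra_simps)
  have PPz: "frechet_derivative (\<lambda>x. P x * P x) (at z) = (\<lambda>v. 0)"
    by (rule differentiable_min_zero[OF U z(1) PP]) (auto simp: P_def z)
  have "((\<lambda>s. P (z + s *\<^sub>R e) * P (z + s *\<^sub>R e) / s\<^sup>2) \<longlongrightarrow> hessian (\<lambda>x. P x * P x) z e e / 2) (at_right 0)"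
    by (rule hessian_limit[OF U z(1) PP]) (simp_all add: PPz, simp add: P_def z)
  moreover have "((\<lambda>s. P (z + s *\<^sub>R e) * P (z + s *\<^sub>R e) / s\<^sup>2) \<longlongrightarrow> (m1 * l + m2 * k)\<^sup>2) (at_right 0)"
  proof -
    have "((\<lambda>s. m1\<^sup>2 * (p (z + s *\<^sub>R e) * p (z + s *\<^sub>R e) / s\<^sup>2) + 2 * m1 * m2 * (p (z + s *\<^sub>R e) * q (z + s *\<^sub>R e) / s\<^sup>2)
        + m2\<^sup>2 * (q (z + s *\<^sub>R e) * q (z + s *\<^sub>R e) / s\<^sup>2)) \<longlongrightarrow> m1\<^sup>2 * (l * l) + 2 * m1 * m2 * (l * k) + m2\<^sup>2 * (k * k)) (at_right 0)"
      using product_limits[OF z, of e] unfolding H by (intro tendsto_intros)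
    moreover have "m1\<^sup>2 * (l * l) + 2 * m1 * m2 * (l * k) + m2\<^sup>2 * (k * k) = (m1 * l + m2 * k)\<^sup>2" by algebra
    moreover have "m1\<^sup>2 * (a * a / s) + 2 * m1 * m2 * (a * b / s) + m2\<^sup>2 * (b * b / s) = (m1 * a + m2 * b) * (m1 * a + m2 * b) / s" for a b s :: real
      by (simp add: add_divide_distrib[symmetric] power2_eq_square algebra_simps)
    ultimately show ?thesis by (simp add: P_def)
  qed
  ultimately have "hessian (\<lambda>x. P x * P x) z e e / 2 = (m1 * l + m2 * k)\<^sup>2"
    using tendsto_unique[OF trivial_limit_at_right_real] by blast
  then have pos: "hessian (\<lambda>x. P x * P x) z e e > 0" using nz zero_less_power2[of "m1 * l + m2 * k"] by linarith
  have cP: "continuous_on U P" and cQ: "continuous_on U Q"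
    unfolding P_def Q_def using p q by (auto intro!: continuous_intros)
  have "\<forall>\<^sub>F s in at_right 0. P (z + s *\<^sub>R e) > 0 \<and> P (z - s *\<^sub>R e) < 0" using sign by (simp add: P_def)
  from smooth_near_sign_change_of_root[OF e U z(1) cP cQ PP PQ pos this]
  obtain T where T: "open T" "z \<in> T" "smooth_on T P" "smooth_on T Q" by blast
  have "smooth_on T (\<lambda>x. (m1 * P x - m2 * Q x) / (m1\<^sup>2 + m2\<^sup>2))"
    by (rule smooth_on_divide smooth_on_diff smooth_on_mult smooth_on_const T m)+
  moreover have "(m1 * P x - m2 * Q x) / (m1\<^sup>2 + m2\<^sup>2) = p x" for x
  proof -
    have "m1 * P x - m2 * Q x = p x * (m1\<^sup>2 + m2\<^sup>2)" unfolding P_def Q_def by algebra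
    then show ?thesis by (simp only: nonzero_mult_div_cancel_right[OF m])
  qed
  ultimately have sp: "smooth_on T p" by (simp only:)
  have "smooth_on T (\<lambda>x. (m2 * P x + m1 * Q x) / (m1\<^sup>2 + m2\<^sup>2))"
    by (rule smooth_on_divide smooth_on_add smooth_on_mult smooth_on_const T m)+
  moreover have "(m2 * P x + m1 * Q x) / (m1\<^sup>2 + m2\<^sup>2) = q x" for x
  proof -
    have "m2 * P x + m1 * Q x = q x * (m1\<^sup>2 + m2\<^sup>2)" unfolding P_def Q_def by algebra
    then show ?thesis by (simp only: nonzero_mult_div_cancel_right[OF m])
  qed
  ultimately have sq: "smooth_on T q" by (simp only:)
  show ?thesis using T sp sq by blast
qed

end

lemma norm_real2: "(norm v)\<^sup>2 = (v $ 1)\<^sup>2 + (v $ 2)\<^sup>2" for v :: "real^2"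
  unfolding power2_norm_eq_inner by (simp add: inner_vec_def sum_2 power2_eq_square)

lemma inner_real2: "v \<bullet> w = v $ 1 * w $ 1 + v $ 2 * w $ 2" for v w :: "real^2"
  by (simp add: inner_vec_def sum_2)

text \<open>Cauchy--Schwarz for the adjugate matrix, in the form of a sum of squares.\<close>

lemma nondegenerate_lower_bound:
  fixes l11 l12 l21 l22 x y :: real
  shows "(l11 * l22 - l12 * l21)\<^sup>2 * (x\<^sup>2 + y\<^sup>2) \<le>
    (l11\<^sup>2 + l12\<^sup>2 + l21\<^sup>2 + l22\<^sup>2) * ((l11 * x + l12 * y)\<^sup>2 + (l21 * x + l22 * y)\<^sup>2)"
proof -
  have "(l11\<^sup>2 + l12\<^sup>2 + l21\<^sup>2 + l22\<^sup>2) * ((l11 * x + l12 * y)\<^sup>2 + (l21 * x + l22 * y)\<^sup>2)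
     - (l11 * l22 - l12 * l21)\<^sup>2 * (x\<^sup>2 + y\<^sup>2) =
     (l22 * (l21 * x + l22 * y) + l12 * (l11 * x + l12 * y))\<^sup>2 + (l21 * (l21 * x + l22 * y) + l11 * (l11 * x + l12 * y))\<^sup>2"
    by algebra
  then show ?thesis by (smt (verit) zero_le_power2)
qed

lemma combination_lower_bound:
  fixes x y A B C a b d :: real
  assumes "\<bar>A - a * a\<bar> \<le> d" "\<bar>B - a * b\<bar> \<le> d" "\<bar>C - b * b\<bar> \<le> d"
  shows "(x * a + y * b)\<^sup>2 - 2 * d * (x\<^sup>2 + y\<^sup>2) \<le> x\<^sup>2 * A + 2 * (x * y) * B + y\<^sup>2 * C"
proof -
  have "x\<^sup>2 * (a * a - A) \<le> x\<^sup>2 * d" "y\<^sup>2 * (b * b - C) \<le> y\<^sup>2 * d"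
    using assms by (intro mult_left_mono; simp add: abs_le_iff)+
  moreover have "2 * (x * y) * (a * b - B) \<le> (x\<^sup>2 + y\<^sup>2) * d"
  proof -
    have "2 * \<bar>x * y\<bar> \<le> x\<^sup>2 + y\<^sup>2" using sum_squares_bound[of "\<bar>x\<bar>" "\<bar>y\<bar>"] by (simp add: abs_mult)
    have "2 * (x * y) * (a * b - B) \<le> \<bar>2 * (x * y)\<bar> * \<bar>a * b - B\<bar>" by (metis abs_ge_self abs_mult)
    also have "\<dots> \<le> (x\<^sup>2 + y\<^sup>2) * d"
      using \<open>2 * \<bar>x * y\<bar> \<le> x\<^sup>2 + y\<^sup>2\<close> assms(2) by (intro mult_mono) (auto simp: abs_mult abs_minus_commute)
    finally show ?thesis .
  qed
  ultimately show ?thesis by (simp add: power2_eq_square algebra_simps)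
qed

text \<open>On a disc of radius \<open>\<epsilon> / 4\<close> about \<open>\<epsilon> \<nu>\<close> both sides of the maximum principle estimate scale
  like \<open>\<epsilon>\<close>, so a gradient that is $\tau (\nu \cdot z) \nu$ up to $o(|z|)$ in a sector around
  \<open>\<nu>\<close> contradicts a positive lower bound of the Laplacian.  The sector $|v| < 2\, v \cdot \nu$ contains
  these discs.\<close>

lemma no_nonpositive_sector:
  fixes u p q :: "real^2 \<Rightarrow> real" and \<nu> :: "real^2"
  assumes C: "C > 0" and \<rho>: "\<rho> > 0" and \<nu>: "norm \<nu> = 1" and \<tau>: "\<tau> \<le> 0"
    and du: "\<And>z. z \<in> ball 0 \<rho> - {0} \<Longrightarrow> (u has_derivative (\<lambda>h. p z * h $ 1 + q z * h $ 2)) (at z)"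
    and lap: "\<And>z. z \<in> ball 0 \<rho> - {0} \<Longrightarrow> \<exists>a b. has_partial 1 p a z \<and> has_partial 2 q b z \<and> a + b \<ge> C"
    and close: "\<And>\<eta>. \<eta> > 0 \<Longrightarrow> \<exists>\<delta>>0. \<forall>v. norm v < \<delta> \<and> norm v < 2 * (v \<bullet> \<nu>) \<longrightarrow>
       \<bar>p v - \<tau> * (\<nu> \<bullet> v) * \<nu> $ 1\<bar> \<le> \<eta> * norm v \<and> \<bar>q v - \<tau> * (\<nu> \<bullet> v) * \<nu> $ 2\<bar> \<le> \<eta> * norm v"
  shows False
proof -
  obtain \<delta> where \<delta>: "\<delta> > 0" "\<And>v. norm v < \<delta> \<Longrightarrow> norm v < 2 * (v \<bullet> \<nu>) \<Longrightarrow>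
       \<bar>p v - \<tau> * (\<nu> \<bullet> v) * \<nu> $ 1\<bar> \<le> C / 100 * norm v \<and> \<bar>q v - \<tau> * (\<nu> \<bullet> v) * \<nu> $ 2\<bar> \<le> C / 100 * norm v"
    using close[of "C / 100"] C by auto
  define \<epsilon> where "\<epsilon> = min \<delta> \<rho> / 2"
  have \<epsilon>: "\<epsilon> > 0" "5 / 4 * \<epsilon> < \<delta>" "5 / 4 * \<epsilon> < \<rho>" using \<delta> \<rho> by (auto simp: \<epsilon>_def min_def)
  have sector: "norm v \<le> 5 / 4 * \<epsilon>" "3 / 4 * \<epsilon> \<le> v \<bullet> \<nu>" if "v \<in> cball (\<epsilon> *\<^sub>R \<nu>) (\<epsilon> / 4)" for v
  proof -
    have d: "norm (v - \<epsilon> *\<^sub>R \<nu>) \<le> \<epsilon> / 4" using that by (simp add: dist_norm norm_minus_commute)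
    then show "norm v \<le> 5 / 4 * \<epsilon>" using norm_triangle_sub[of v "\<epsilon> *\<^sub>R \<nu>"] \<nu> \<epsilon> by simp
    have "\<bar>(v - \<epsilon> *\<^sub>R \<nu>) \<bullet> \<nu>\<bar> \<le> \<epsilon> / 4" using Cauchy_Schwarz_ineq2[of "v - \<epsilon> *\<^sub>R \<nu>" \<nu>] d \<nu> by simp
    moreover have "(v - \<epsilon> *\<^sub>R \<nu>) \<bullet> \<nu> = v \<bullet> \<nu> - \<epsilon>" using \<nu> by (simp add: inner_diff_left norm_eq_1)
    ultimately show "3 / 4 * \<epsilon> \<le> v \<bullet> \<nu>" by linarith
  qed
  have D: "v \<in> ball 0 \<rho> - {0}" if "v \<in> cball (\<epsilon> *\<^sub>R \<nu>) (\<epsilon> / 4)" for v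
    using sector[OF that] \<epsilon> by auto
  have cl: "\<bar>p v - \<tau> * (\<nu> \<bullet> v) * \<nu> $ 1\<bar> \<le> C / 100 * (5 / 4 * \<epsilon>) \<and> \<bar>q v - \<tau> * (\<nu> \<bullet> v) * \<nu> $ 2\<bar> \<le> C / 100 * (5 / 4 * \<epsilon>)"
    if v: "v \<in> cball (\<epsilon> *\<^sub>R \<nu>) (\<epsilon> / 4)" for v
  proof -
    have "C / 100 * norm v \<le> C / 100 * (5 / 4 * \<epsilon>)" using sector(1)[OF v] C by (intro mult_left_mono) auto
    then show ?thesis using \<delta>(2)[of v] sector[OF v] \<epsilon> by force
  qed
  have "C * (\<epsilon> / 4) / 16 \<le> C / 100 * (5 / 4 * \<epsilon>)"
    by (rule maximum_principle_estimate[OF _ C \<nu> \<tau> du[OF D] lap[OF D]]) (use \<epsilon> cl in auto)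
  then show False using C \<epsilon> by (simp add: field_simps)
qed

context smooth_products begin

text \<open>If \<open>L\<close> is invertible, the scalar product of $(p,q)$ with \<open>L v\<close> has no zero for small
  \<open>v \<noteq> 0\<close>.  The punctured disc is connected, so this product has a constant sign there; since \<open>L\<close>
  is odd, the component of $(p,q)$ along \<open>L e\<close> changes sign on the line through \<open>z\<close> in direction \<open>e\<close>.\<close>

lemma smooth_near_nondegenerate:
  assumes z: "z \<in> U" "p z = 0" "q z = 0"
    and jets: "product_jets z l11 l12 l21 l22" and det: "l11 * l22 - l12 * l21 \<noteq> 0"
  shows "\<exists>T. open T \<and> z \<in> T \<and> smooth_on T p \<and> smooth_on T q"
proof -
  define l1 l2 where "l1 v = l11 * v $ 1 + l12 * v $ 2" and "l2 v = l21 * v $ 1 + l22 * v $ 2" for v :: "real^2"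
  note H = jets[unfolded product_jets_def, THEN conjunct1, rule_format]
    jets[unfolded product_jets_def, THEN conjunct2, THEN conjunct1, rule_format]
    jets[unfolded product_jets_def, THEN conjunct2, THEN conjunct2, rule_format]
  note H' = H[folded l1_def l2_def]
  define S where "S = l11\<^sup>2 + l12\<^sup>2 + l21\<^sup>2 + l22\<^sup>2"
  have "l11 \<noteq> 0 \<or> l12 \<noteq> 0" using det by auto
  then have "l11\<^sup>2 + l12\<^sup>2 > 0" by (simp add: sum_power2_gt_zero_iff)
  then have S: "S > 0" unfolding S_def by (simp add: add_pos_nonneg)
  define \<kappa> where "\<kappa> = (l11 * l22 - l12 * l21)\<^sup>2 / S"
  have \<kappa>: "\<kappa> > 0" using det S by (simp add: \<kappa>_def)
  have lower: "\<kappa> * (norm v)\<^sup>2 \<le> (l1 v)\<^sup>2 + (l2 v)\<^sup>2" for v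
    using nondegenerate_lower_bound[of l11 l22 l12 l21 "v $ 1" "v $ 2"] S
    by (simp add: \<kappa>_def l1_def l2_def norm_real2 S_def[symmetric] pos_divide_le_eq mult.commute)
  obtain \<delta> where \<delta>: "\<delta> > 0" "\<And>v. norm v < \<delta> \<Longrightarrow> z + v \<in> U \<and>
     \<bar>p (z + v) * p (z + v) - l1 v * l1 v\<bar> \<le> \<kappa> / 4 * (norm v)\<^sup>2 \<and>
     \<bar>p (z + v) * q (z + v) - l1 v * l2 v\<bar> \<le> \<kappa> / 4 * (norm v)\<^sup>2 \<and>
     \<bar>q (z + v) * q (z + v) - l2 v * l2 v\<bar> \<le> \<kappa> / 4 * (norm v)\<^sup>2"
    using products_expansion[OF z, of "\<kappa> / 4"] \<kappa> unfolding H' by auto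
  define F where "F v = l1 v * p (z + v) + l2 v * q (z + v)" for v
  have F_ne: "F v \<noteq> 0" if v: "v \<in> ball 0 \<delta> - {0}" for v
  proof
    assume "F v = 0"
    define W where "W = (l1 v)\<^sup>2 + (l2 v)\<^sup>2"
    have nv: "(norm v)\<^sup>2 > 0" using v by simp
    have "W\<^sup>2 - 2 * (\<kappa> / 4 * (norm v)\<^sup>2) * W \<le> (F v)\<^sup>2"
    proof -
      have "(l1 v * l1 v + l2 v * l2 v)\<^sup>2 - 2 * (\<kappa> / 4 * (norm v)\<^sup>2) * ((l1 v)\<^sup>2 + (l2 v)\<^sup>2) \<le>
         (l1 v)\<^sup>2 * (p (z + v) * p (z + v)) + 2 * (l1 v * l2 v) * (p (z + v) * q (z + v)) + (l2 v)\<^sup>2 * (q (z + v) * q (z + v))"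
        by (rule combination_lower_bound) (use \<delta>(2)[of v] v in auto)
      also have "\<dots> = (F v)\<^sup>2" unfolding F_def by algebra
      finally show ?thesis by (simp add: W_def power2_eq_square)
    qed
    then have "W * (W - \<kappa> / 2 * (norm v)\<^sup>2) \<le> 0" using \<open>F v = 0\<close> by (simp add: power2_eq_square algebra_simps)
    moreover have "W \<ge> \<kappa> * (norm v)\<^sup>2" using lower[of v] by (simp add: W_def)
    moreover have "\<kappa> * (norm v)\<^sup>2 > 0" using \<kappa> nv by simp
    ultimately show False by (simp add: mult_le_0_iff)
  qed
  have contF: "continuous_on (ball 0 \<delta> - {0}) F"
  proof -
    have "continuous_on (ball 0 \<delta> - {0}) (\<lambda>v. f (z + v))" if "continuous_on U f" for f :: "real^2 \<Rightarrow> real"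
      by (rule continuous_on_compose2[OF that]) (use \<delta>(2) in \<open>auto intro!: continuous_intros\<close>)
    note c = this[OF p] this[OF q]
    show ?thesis unfolding F_def l1_def l2_def by (intro continuous_intros c)
  qed
  have "connected (ball (0::real^2) \<delta> - {0})"
    by (rule connected_punctured_convex) (use \<delta>(1) in \<open>auto simp: aff_dim_open\<close>)
  from connected_nonzero_sign[OF this contF F_ne]
  have F_sign: "(\<forall>v\<in>ball 0 \<delta> - {0}. F v > 0) \<or> (\<forall>v\<in>ball 0 \<delta> - {0}. F v < 0)" .
  define \<sigma> :: real where "\<sigma> = (if \<forall>v\<in>ball 0 \<delta> - {0}. F v > 0 then 1 else -1)"
  have \<sigma>: "\<sigma> = 1 \<or> \<sigma> = -1" "\<And>v. v \<in> ball 0 \<delta> - {0} \<Longrightarrow> \<sigma> * F v > 0"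
    using F_sign by (auto simp: \<sigma>_def)
  define e where "e = (axis 1 1 :: real^2)"
  have e: "norm e = 1" "e \<noteq> 0" by (simp_all add: e_def axis_eq_0_iff)
  have pos: "(l1 e)\<^sup>2 + (l2 e)\<^sup>2 > 0" using lower[of e] \<kappa> e by simp
  have lin: "l1 (s *\<^sub>R e) = s * l1 e" "l2 (s *\<^sub>R e) = s * l2 e" for s by (simp_all add: l1_def l2_def algebra_simps)
  show ?thesis
  proof (rule smooth_near_sign_change[OF z e(1) _ H'(1)[of e] H'(2)[of e] H'(3)[of e], of "\<sigma> * l1 e" "\<sigma> * l2 e"])
    show "(\<sigma> * l1 e)\<^sup>2 + (\<sigma> * l2 e)\<^sup>2 \<noteq> 0" using pos \<sigma>(1) by auto
    have "\<sigma> * l1 e * l1 e + \<sigma> * l2 e * l2 e = \<sigma> * ((l1 e)\<^sup>2 + (l2 e)\<^sup>2)" by algebra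
    then show "\<sigma> * l1 e * l1 e + \<sigma> * l2 e * l2 e \<noteq> 0" using pos \<sigma>(1) by auto
    show "\<forall>\<^sub>F s in at_right 0. \<sigma> * l1 e * p (z + s *\<^sub>R e) + \<sigma> * l2 e * q (z + s *\<^sub>R e) > 0 \<and>
        \<sigma> * l1 e * p (z - s *\<^sub>R e) + \<sigma> * l2 e * q (z - s *\<^sub>R e) < 0"
      unfolding eventually_at_right_field
    proof (intro exI[of _ \<delta>] conjI allI impI \<delta>(1))
      fix s assume s: "0 < s" "s < \<delta>"
      have "\<sigma> * F (s *\<^sub>R e) > 0" "\<sigma> * F ((-s) *\<^sub>R e) > 0" using \<sigma>(2)[of "s *\<^sub>R e"] \<sigma>(2)[of "(-s) *\<^sub>R e"] s e by auto
      moreover have "\<sigma> * F (s *\<^sub>R e) = s * (\<sigma> * l1 e * p (z + s *\<^sub>R e) + \<sigma> * l2 e * q (z + s *\<^sub>R e))"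
        unfolding F_def lin by algebra
      moreover have "\<sigma> * F ((-s) *\<^sub>R e) = - (s * (\<sigma> * l1 e * p (z - s *\<^sub>R e) + \<sigma> * l2 e * q (z - s *\<^sub>R e)))"
        unfolding F_def lin by (simp add: algebra_simps)
      ultimately have "s * (\<sigma> * l1 e * p (z + s *\<^sub>R e) + \<sigma> * l2 e * q (z + s *\<^sub>R e)) > 0"
        "s * (\<sigma> * l1 e * p (z - s *\<^sub>R e) + \<sigma> * l2 e * q (z - s *\<^sub>R e)) < 0" by simp_all
      then show "\<sigma> * l1 e * p (z + s *\<^sub>R e) + \<sigma> * l2 e * q (z + s *\<^sub>R e) > 0"
        "\<sigma> * l1 e * p (z - s *\<^sub>R e) + \<sigma> * l2 e * q (z - s *\<^sub>R e) < 0"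
        using s(1) by (simp_all only: zero_less_mult_iff mult_less_0_iff) simp_all
    qed
  qed
qed

text \<open>Here $L = c\, n n^T$, and nothing said so far excludes that $(p,q)$ behaves like
  $|n \cdot v|\, n$, the gradient of a $C^{1,1}$ function with a kink in its derivative.  In a
  sector around \<open>\<nu> = n\<close> or \<open>\<nu> = - n\<close> the field $(p,q)$ is $\pm c\, (n \cdot v) n$ up to $o(|v|)$ with a
  constant sign; the negative sign, and also \<open>c = 0\<close>, are excluded by the Laplacian.  So the
  component along \<open>n\<close> has the sign of \<open>n \<bullet> v\<close> on both sides.\<close>

lemma smooth_near_degenerate:
  fixes u :: "real^2 \<Rightarrow> real"
  assumes z: "0 \<in> U" "p 0 = 0" "q 0 = 0"
    and jets: "product_jets 0 l11 l12 l12 l22" and det: "l11 * l22 = l12\<^sup>2"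
    and C: "C > 0" and \<rho>: "\<rho> > 0"
    and du: "\<And>z. z \<in> ball 0 \<rho> - {0} \<Longrightarrow> (u has_derivative (\<lambda>h. p z * h $ 1 + q z * h $ 2)) (at z)"
    and lap: "\<And>z. z \<in> ball 0 \<rho> - {0} \<Longrightarrow> \<exists>a b. has_partial 1 p a z \<and> has_partial 2 q b z \<and> a + b \<ge> C"
  shows "\<exists>T. open T \<and> 0 \<in> T \<and> smooth_on T p \<and> smooth_on T q"
proof -
  note H = jets[unfolded product_jets_def, THEN conjunct1, rule_format]
    jets[unfolded product_jets_def, THEN conjunct2, THEN conjunct1, rule_format]
    jets[unfolded product_jets_def, THEN conjunct2, THEN conjunct2, rule_format]
  obtain \<sigma> c n1 n2 where n: "\<sigma> = 1 \<or> \<sigma> = -1" "c \<ge> 0" "n1\<^sup>2 + n2\<^sup>2 = 1"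
    "\<sigma> * l11 = c * n1\<^sup>2" "\<sigma> * l12 = c * n1 * n2" "\<sigma> * l22 = c * n2\<^sup>2"
    by (rule symmetric_rank_one[OF det])
  define n where "n = (vector [n1, n2] :: real^2)"
  have n12: "n $ 1 = n1" "n $ 2 = n2" by (simp_all add: n_def)
  have "(norm n)\<^sup>2 = 1" unfolding norm_real2 n12 by (rule n(3))
  then have norm_n: "norm n = 1" using norm_ge_zero[of n] by (auto simp: power2_eq_1_iff)
  define l1 l2 where "l1 v = c * (n \<bullet> v) * n1" and "l2 v = c * (n \<bullet> v) * n2" for v
  have H': "hessian (\<lambda>z. p z * p z) 0 v v / 2 = l1 v * l1 v" "hessian (\<lambda>z. p z * q z) 0 v v / 2 = l1 v * l2 v"
    "hessian (\<lambda>z. q z * q z) 0 v v / 2 = l2 v * l2 v" for v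
  proof -
    have *: "\<sigma> * (l11 * v $ 1 + l12 * v $ 2) = l1 v" "\<sigma> * (l12 * v $ 1 + l22 * v $ 2) = l2 v"
      using n(4-6) unfolding l1_def l2_def inner_real2 n12 by algebra+
    have **: "\<sigma> * \<sigma> = 1" using n(1) by auto
    let ?a = "l11 * v $ 1 + l12 * v $ 2" and ?b = "l12 * v $ 1 + l22 * v $ 2"
    have sq: "x * y = (\<sigma> * x) * (\<sigma> * y)" for x y using ** by algebra
    have "hessian (\<lambda>z. p z * p z) 0 v v / 2 = l1 v * l1 v" using H(1)[of v] sq[of ?a ?a] unfolding * by (rule trans)
    moreover have "hessian (\<lambda>z. p z * q z) 0 v v / 2 = l1 v * l2 v" using H(2)[of v] sq[of ?a ?b] unfolding * by (rule trans)
    moreover have "hessian (\<lambda>z. q z * q z) 0 v v / 2 = l2 v * l2 v" using H(3)[of v] sq[of ?b ?b] unfolding * by (rule trans)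
    ultimately show "hessian (\<lambda>z. p z * p z) 0 v v / 2 = l1 v * l1 v" "hessian (\<lambda>z. p z * q z) 0 v v / 2 = l1 v * l2 v"
      "hessian (\<lambda>z. q z * q z) 0 v v / 2 = l2 v * l2 v" by blast+
  qed
  have expansion: "\<exists>\<delta>>0. \<forall>v. norm v < \<delta> \<longrightarrow> v \<in> U \<and> \<bar>p v * p v - l1 v * l1 v\<bar> \<le> \<eta> * (norm v)\<^sup>2 \<and>
     \<bar>p v * q v - l1 v * l2 v\<bar> \<le> \<eta> * (norm v)\<^sup>2 \<and> \<bar>q v * q v - l2 v * l2 v\<bar> \<le> \<eta> * (norm v)\<^sup>2" if "\<eta> > 0" for \<eta>
    using products_expansion[OF z that] unfolding H' by simp
  note no_sector = no_nonpositive_sector[OF C \<rho> _ _ du lap]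

  \<comment> \<open>for \<open>c = 0\<close> the gradient is \<open>o(|v|)\<close>, that is, \<open>\<tau> = 0\<close>\<close>
  have "c \<noteq> 0"
  proof
    assume c0: "c = 0"
    show False
    proof (rule no_sector[OF norm_n, of 0])
      fix \<eta> :: real assume \<eta>: "\<eta> > 0"
      obtain \<delta> where \<delta>: "\<delta> > 0" "\<And>v. norm v < \<delta> \<Longrightarrow> \<bar>p v * p v\<bar> \<le> \<eta>\<^sup>2 * (norm v)\<^sup>2 \<and> \<bar>q v * q v\<bar> \<le> \<eta>\<^sup>2 * (norm v)\<^sup>2"
        using expansion[of "\<eta>\<^sup>2"] \<eta> by (auto simp: l1_def l2_def c0)
      have root: "\<bar>x\<bar> \<le> \<eta> * norm v" if "\<bar>x * x\<bar> \<le> \<eta>\<^sup>2 * (norm v)\<^sup>2" for x and v :: "real^2"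
      proof -
        have "x\<^sup>2 \<le> (\<eta> * norm v)\<^sup>2" using that by (simp add: power2_eq_square mult_ac)
        then have "\<bar>x\<bar> \<le> \<bar>\<eta> * norm v\<bar>" by (simp only: abs_le_square_iff)
        then show ?thesis using \<eta> by simp
      qed
      have "\<bar>p v\<bar> \<le> \<eta> * norm v \<and> \<bar>q v\<bar> \<le> \<eta> * norm v" if "norm v < \<delta>" for v
        using root \<delta>(2)[OF that] by blast
      then show "\<exists>\<delta>>0. \<forall>v. norm v < \<delta> \<and> norm v < 2 * (v \<bullet> n) \<longrightarrow>
         \<bar>p v - 0 * (n \<bullet> v) * n $ 1\<bar> \<le> \<eta> * norm v \<and> \<bar>q v - 0 * (n \<bullet> v) * n $ 2\<bar> \<le> \<eta> * norm v"
        using \<delta>(1) by (intro exI[of _ \<delta>]) (simp only: mult_zero_left diff_zero, simp)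
    qed (simp)
  qed
  then have c: "c > 0" using n(2) by simp

  define P where "P v = n1 * p v + n2 * q v" for v
  \<comment> \<open>in the sector around \<open>\<nu> = \<plusminus>n\<close> the function \<open>(n \<bullet> v) P v\<close> is positive\<close>
  have sector: "\<exists>\<delta>>0. \<forall>v. norm v < \<delta> \<and> norm v < 2 * (v \<bullet> \<nu>) \<longrightarrow> (n \<bullet> v) * P v > 0" if \<nu>: "\<nu> = n \<or> \<nu> = - n" for \<nu>
  proof -
    have norm_\<nu>: "norm \<nu> = 1" using \<nu> norm_n by auto
    have n\<nu>: "(n \<bullet> v)\<^sup>2 = (v \<bullet> \<nu>)\<^sup>2" for v using \<nu> by (auto simp: inner_commute)
    have half: "(norm v)\<^sup>2 < 4 * (n \<bullet> v)\<^sup>2" if "norm v < 2 * (v \<bullet> \<nu>)" for v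
      using power_strict_mono[OF that norm_ge_zero, of 2] by (simp add: n\<nu> power_mult_distrib)
    obtain \<delta> where \<delta>: "\<delta> > 0" "\<And>v. norm v < \<delta> \<Longrightarrow> v \<in> U \<and> \<bar>p v * p v - l1 v * l1 v\<bar> \<le> c\<^sup>2 / 16 * (norm v)\<^sup>2 \<and>
     \<bar>p v * q v - l1 v * l2 v\<bar> \<le> c\<^sup>2 / 16 * (norm v)\<^sup>2 \<and> \<bar>q v * q v - l2 v * l2 v\<bar> \<le> c\<^sup>2 / 16 * (norm v)\<^sup>2"
      using expansion[of "c\<^sup>2 / 16"] c by auto
    define K where "K = {v. norm v < \<delta> \<and> norm v < 2 * (v \<bullet> \<nu>)}"
    have "convex K"
      unfolding convex_def K_def
    proof (intro ballI allI impI)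
      fix x y :: "real^2" and a b :: real
      assume xy: "x \<in> {v. norm v < \<delta> \<and> norm v < 2 * (v \<bullet> \<nu>)}" "y \<in> {v. norm v < \<delta> \<and> norm v < 2 * (v \<bullet> \<nu>)}"
        and ab: "0 \<le> a" "0 \<le> b" "a + b = 1"
      have tri: "norm (a *\<^sub>R x + b *\<^sub>R y) \<le> a * norm x + b * norm y"
        using norm_triangle_ineq[of "a *\<^sub>R x" "b *\<^sub>R y"] ab by simp
      have "a * norm x + b * norm y < \<delta>" using convex_bound_lt[of "norm x" \<delta> "norm y" a b] xy ab by simp
      moreover have "a * (norm x - 2 * (x \<bullet> \<nu>)) + b * (norm y - 2 * (y \<bullet> \<nu>)) < 0"
        using convex_bound_lt[of "norm x - 2 * (x \<bullet> \<nu>)" 0 "norm y - 2 * (y \<bullet> \<nu>)" a b] xy ab by simp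
      ultimately show "a *\<^sub>R x + b *\<^sub>R y \<in> {v. norm v < \<delta> \<and> norm v < 2 * (v \<bullet> \<nu>)}"
        using tri by (simp add: inner_add_left algebra_simps)
    qed
    define F where "F v = (n \<bullet> v) * P v" for v
    have F_ne: "F v \<noteq> 0" if v: "v \<in> K" for v
    proof
      assume "F v = 0"
      have h: "(norm v)\<^sup>2 < 4 * (n \<bullet> v)\<^sup>2" using half v by (simp add: K_def)
      then have "n \<bullet> v \<noteq> 0" by auto
      then have "P v = 0" using \<open>F v = 0\<close> by (simp add: F_def)
      have "(n1 * l1 v + n2 * l2 v)\<^sup>2 - 2 * (c\<^sup>2 / 16 * (norm v)\<^sup>2) * (n1\<^sup>2 + n2\<^sup>2)
         \<le> n1\<^sup>2 * (p v * p v) + 2 * (n1 * n2) * (p v * q v) + n2\<^sup>2 * (q v * q v)"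
        by (rule combination_lower_bound) (use \<delta>(2)[of v] v in \<open>auto simp: K_def\<close>)
      also have "\<dots> = (P v)\<^sup>2" unfolding P_def by algebra
      also have "n1 * l1 v + n2 * l2 v = c * (n \<bullet> v) * (n1\<^sup>2 + n2\<^sup>2)" unfolding l1_def l2_def by algebra
      finally have "c\<^sup>2 * ((n \<bullet> v)\<^sup>2 - (norm v)\<^sup>2 / 8) \<le> 0"
        using \<open>P v = 0\<close> n(3) by (simp add: power_mult_distrib algebra_simps)
      then have "(n \<bullet> v)\<^sup>2 * 8 \<le> (norm v)\<^sup>2" using c by (simp add: mult_le_0_iff)
      then show False using h zero_le_power2[of "n \<bullet> v"] by linarith
    qed
    have contF: "continuous_on K F"
    proof -
      have KU: "K \<subseteq> U" using \<delta>(2) by (auto simp: K_def)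
      show ?thesis unfolding F_def P_def
        by (intro continuous_intros continuous_on_subset[OF p KU] continuous_on_subset[OF q KU])
    qed
    from connected_nonzero_sign[OF convex_connected[OF \<open>convex K\<close>] contF F_ne]
    consider "\<forall>v\<in>K. F v > 0" | "\<forall>v\<in>K. F v < 0" by blast
    then show ?thesis
    proof cases
      case 1
      then show ?thesis using \<delta>(1) by (intro exI[of _ \<delta>]) (auto simp: K_def F_def)
    next
      case 2
      have \<nu>\<nu>: "(\<nu> \<bullet> v) * \<nu> $ i = (n \<bullet> v) * n $ i" for v i using \<nu> by auto
      have False
      proof (rule no_sector[OF norm_\<nu>, of "- c"])
        show "- c \<le> 0" using c by simp
        fix \<eta> :: real assume \<eta>: "\<eta> > 0"
        \<comment> \<open>the factor \<open>1 / 6\<close> is small enough because \<open>8 / 36 \<le> 1 / 4\<close>\<close>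
        have d0: "c * \<eta> / 6 > 0" using c \<eta> by simp
        obtain \<delta>' where \<delta>': "\<delta>' > 0" "\<And>v. norm v < \<delta>' \<Longrightarrow> \<bar>p v * p v - l1 v * l1 v\<bar> \<le> c * \<eta> / 6 * (norm v)\<^sup>2 \<and>
           \<bar>p v * q v - l1 v * l2 v\<bar> \<le> c * \<eta> / 6 * (norm v)\<^sup>2 \<and> \<bar>q v * q v - l2 v * l2 v\<bar> \<le> c * \<eta> / 6 * (norm v)\<^sup>2"
          using expansion[OF d0] by auto
        have main: "(p v + l1 v)\<^sup>2 + (q v + l2 v)\<^sup>2 \<le> (\<eta> * norm v)\<^sup>2"
          if v: "norm v < \<delta>" "norm v < \<delta>'" "norm v < 2 * (v \<bullet> \<nu>)" for v
        proof -
          define N where "N = (norm v)\<^sup>2"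
          have h: "N < 4 * (n \<bullet> v)\<^sup>2" using half[OF v(3)] by (simp add: N_def)
          have "norm v > 0" using v(3) by auto
          then have N: "N > 0" by (simp add: N_def)
          have W: "(l1 v)\<^sup>2 + (l2 v)\<^sup>2 = c\<^sup>2 * (n \<bullet> v)\<^sup>2"
          proof -
            have "(l1 v)\<^sup>2 + (l2 v)\<^sup>2 = c\<^sup>2 * (n \<bullet> v)\<^sup>2 * (n1\<^sup>2 + n2\<^sup>2)" unfolding l1_def l2_def by algebra
            then show ?thesis using n(3) by simp
          qed
          have "v \<in> K" using v by (simp add: K_def)
          then have "c * F v \<le> 0" using 2 c by (simp add: mult_le_0_iff order_less_imp_le)
          moreover have "c * F v = p v * l1 v + q v * l2 v" unfolding F_def P_def l1_def l2_def by algebra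
          moreover have "(p v - l1 v)\<^sup>2 + (q v - l2 v)\<^sup>2 =
              (p v)\<^sup>2 + (q v)\<^sup>2 + ((l1 v)\<^sup>2 + (l2 v)\<^sup>2) - 2 * (p v * l1 v + q v * l2 v)" by algebra
          ultimately have "(l1 v)\<^sup>2 + (l2 v)\<^sup>2 \<le> (p v - l1 v)\<^sup>2 + (q v - l2 v)\<^sup>2"
            using zero_le_power2[of "p v"] zero_le_power2[of "q v"] by argo
          then have "c\<^sup>2 * N / 4 \<le> (p v - l1 v)\<^sup>2 + (q v - l2 v)\<^sup>2"
            using mult_left_mono[OF order_less_imp_le[OF h] zero_le_power2[of c]] W by simp
          then have "c\<^sup>2 * N / 4 * ((p v + l1 v)\<^sup>2 + (q v + l2 v)\<^sup>2) \<le>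
              ((p v - l1 v)\<^sup>2 + (q v - l2 v)\<^sup>2) * ((p v + l1 v)\<^sup>2 + (q v + l2 v)\<^sup>2)"
            by (intro mult_right_mono) auto
          also have "\<dots> \<le> 8 * (c * \<eta> / 6 * N)\<^sup>2"
            unfolding N_def by (rule rank_one_difference_bound) (use \<delta>'(2)[OF v(2)] in auto)
          also have "\<dots> \<le> c\<^sup>2 * N / 4 * (\<eta>\<^sup>2 * N)"
            using N \<eta> c by (simp add: power2_eq_square)
          finally have "c\<^sup>2 * N / 4 * ((p v + l1 v)\<^sup>2 + (q v + l2 v)\<^sup>2) \<le> c\<^sup>2 * N / 4 * (\<eta>\<^sup>2 * N)" .
          moreover have "c\<^sup>2 * N / 4 > 0" using N c by simp
          ultimately have "(p v + l1 v)\<^sup>2 + (q v + l2 v)\<^sup>2 \<le> \<eta>\<^sup>2 * N" by (simp only: mult_le_cancel_left_pos)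
          then show ?thesis by (simp only: N_def power_mult_distrib)
        qed
        show "\<exists>\<delta>>0. \<forall>v. norm v < \<delta> \<and> norm v < 2 * (v \<bullet> \<nu>) \<longrightarrow>
          \<bar>p v - - c * (\<nu> \<bullet> v) * \<nu> $ 1\<bar> \<le> \<eta> * norm v \<and> \<bar>q v - - c * (\<nu> \<bullet> v) * \<nu> $ 2\<bar> \<le> \<eta> * norm v"
        proof (intro exI[of _ "min \<delta> \<delta>'"] conjI allI impI)
          show "min \<delta> \<delta>' > 0" using \<delta>(1) \<delta>'(1) by simp
          fix v assume v: "norm v < min \<delta> \<delta>' \<and> norm v < 2 * (v \<bullet> \<nu>)"
          have l: "p v - - c * (\<nu> \<bullet> v) * \<nu> $ 1 = p v + l1 v" "q v - - c * (\<nu> \<bullet> v) * \<nu> $ 2 = q v + l2 v"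
            using \<nu>\<nu>[of v 1] \<nu>\<nu>[of v 2] by (simp_all add: l1_def l2_def n12 mult.assoc)
          have m: "(p v + l1 v)\<^sup>2 + (q v + l2 v)\<^sup>2 \<le> (\<eta> * norm v)\<^sup>2" by (rule main) (use v in auto)
          have "(p v + l1 v)\<^sup>2 \<le> (\<eta> * norm v)\<^sup>2" "(q v + l2 v)\<^sup>2 \<le> (\<eta> * norm v)\<^sup>2"
            using m zero_le_power2[of "p v + l1 v"] zero_le_power2[of "q v + l2 v"] by linarith+
          then have "\<bar>p v + l1 v\<bar> \<le> \<bar>\<eta> * norm v\<bar>" "\<bar>q v + l2 v\<bar> \<le> \<bar>\<eta> * norm v\<bar>"
            by (simp_all only: abs_le_square_iff)
          moreover have "\<bar>\<eta> * norm v\<bar> = \<eta> * norm v" using \<eta> by simp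
          ultimately show "\<bar>p v - - c * (\<nu> \<bullet> v) * \<nu> $ 1\<bar> \<le> \<eta> * norm v" "\<bar>q v - - c * (\<nu> \<bullet> v) * \<nu> $ 2\<bar> \<le> \<eta> * norm v"
            unfolding l by (simp_all only:)
        qed
      qed
      then show ?thesis ..
    qed
  qed
  obtain \<delta>1 where \<delta>1: "\<delta>1 > 0" "\<And>v. norm v < \<delta>1 \<Longrightarrow> norm v < 2 * (v \<bullet> n) \<Longrightarrow> (n \<bullet> v) * P v > 0"
    using sector[of n] by auto
  obtain \<delta>2 where \<delta>2: "\<delta>2 > 0" "\<And>v. norm v < \<delta>2 \<Longrightarrow> norm v < 2 * (v \<bullet> (- n)) \<Longrightarrow> (n \<bullet> v) * P v > 0"
    using sector[of "- n"] by auto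
  have nn: "n \<bullet> n = 1" using norm_n by (simp add: norm_eq_1)
  show ?thesis
  proof (rule smooth_near_sign_change[OF z norm_n _ H'(1)[of n] H'(2)[of n] H'(3)[of n], of n1 n2])
    show "n1\<^sup>2 + n2\<^sup>2 \<noteq> 0" using n(3) by simp
    have "n1 * l1 n + n2 * l2 n = c * (n1\<^sup>2 + n2\<^sup>2)" unfolding l1_def l2_def nn by algebra
    then show "n1 * l1 n + n2 * l2 n \<noteq> 0" using n(3) c by simp
    show "\<forall>\<^sub>F s in at_right 0. n1 * p (0 + s *\<^sub>R n) + n2 * q (0 + s *\<^sub>R n) > 0 \<and>
        n1 * p (0 - s *\<^sub>R n) + n2 * q (0 - s *\<^sub>R n) < 0"
      unfolding eventually_at_right_field
    proof (intro exI[of _ "min \<delta>1 \<delta>2"] conjI allI impI)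
      show "min \<delta>1 \<delta>2 > 0" using \<delta>1(1) \<delta>2(1) by simp
      fix s assume s: "0 < s" "s < min \<delta>1 \<delta>2"
      show "n1 * p (0 + s *\<^sub>R n) + n2 * q (0 + s *\<^sub>R n) > 0"
        using \<delta>1(2)[of "s *\<^sub>R n"] s norm_n by (simp add: nn P_def zero_less_mult_iff)
      show "n1 * p (0 - s *\<^sub>R n) + n2 * q (0 - s *\<^sub>R n) < 0"
        using \<delta>2(2)[of "- (s *\<^sub>R n)"] s norm_n by (simp add: nn P_def mult_less_0_iff)
    qed
  qed
qed

end

section \<open>Smoothness of the embedding\<close>

lemma partial_const_add:
  assumes "smooth_on U f" "x \<in> U"
  shows "partial i (\<lambda>x. c + f x) x = partial i f x"
proof -
  have "((\<lambda>x. c + f x) has_derivative frechet_derivative f (at x)) (at x)"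
    using has_derivative_add[OF has_derivative_const smooth_on_has_derivative[OF assms]] by simp
  then show ?thesis using partial_has_derivative(2) smooth_on_partial_eq[OF assms] by metis
qed

text \<open>The open set where the inequality fails is a null set, hence empty.\<close>

lemma AE_gt_imp_ge:
  fixes f :: "'a::euclidean_space \<Rightarrow> real"
  assumes S: "open S" and f: "continuous_on S f" and ae: "AE z in lborel. z \<in> S \<longrightarrow> f z > c" and z: "z \<in> S"
  shows "f z \<ge> c"
proof (rule ccontr)
  assume "\<not> f z \<ge> c"
  let ?T = "S \<inter> f -` {..<c}"
  have "open ?T" by (rule continuous_open_preimage[OF f S open_lessThan])
  obtain N where N: "N \<in> null_sets lborel" "{z \<in> space lborel. \<not> (z \<in> S \<longrightarrow> f z > c)} \<subseteq> N"
    using ae by (auto simp: eventually_ae_filter)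
  have "N \<in> null_sets lebesgue" using N(1) by (rule null_sets_completionI)
  then have "negligible N" by (simp add: negligible_iff_null_sets)
  moreover have "?T \<subseteq> N" using N(2) by auto
  ultimately have "negligible ?T" using negligible_subset by blast
  moreover have "?T \<noteq> {}" using z \<open>\<not> f z \<ge> c\<close> by auto
  ultimately show False using open_not_negligible \<open>open ?T\<close> by blast
qed

theorem corollary1p2:
  fixes r \<rho> C\<^sub>0 :: real
    and g :: "real^2 \<Rightarrow> real^2^2"
    and u :: "real^2 \<Rightarrow> real"
    and X :: "real^2 \<Rightarrow> real^3"
  assumes "r > 0"
    and "riemannian_metric_on (ball 0 r) g"
    and "\<forall>p \<in> ball 0 r - {0}. gauss_curvature g p > 0"
    and "\<forall>p \<in> ball 0 r. X p = vector [p $ 1, p $ 2, u p]"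
    and "C11_on (ball 0 r) X"
    and "isometric_embedding_on (ball 0 r) g X"
    and "u 0 = 0"
    and "partial 1 u 0 = 0" and "partial 2 u 0 = 0"
    and "C\<^sub>0 > 0" and "0 < \<rho>" and "\<rho> < r"
    and "laplacian_gt_on (ball 0 \<rho> - {0}) u C\<^sub>0"
  shows "smooth_on (ball 0 r) X"
proof -
  let ?B = "ball (0::real^2) r"
  note r = assms(1) and g = assms(2) and curv = assms(3) and C = assms(10) and \<rho> = assms(11,12)
  have X: "X z = vector [z $ 1, z $ 2, u z]" if "z \<in> ?B" for z using assms(4) that by blast
  have oB: "open ?B" by simp
  have CX: "Ck_on (Suc 0) ?B X" using assms(5) by (simp add: C11_on_def)
  define D where "D z = frechet_derivative X (at z)" for z
  have DX: "(X has_derivative D z) (at z)" if "z \<in> ?B" for z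
    unfolding D_def by (rule Ck_on_SucE(1)[OF CX that])
  have DXi: "((\<lambda>z. X z $ i) has_derivative (\<lambda>h. D z h $ i)) (at z)" if "z \<in> ?B" for z i
    by (rule bounded_linear.has_derivative[OF bounded_linear_vec_nth DX[OF that]])
  have D12: "D z h $ 1 = h $ 1" "D z h $ 2 = h $ 2" if z: "z \<in> ?B" for z h
  proof -
    have "((\<lambda>z. z $ 1) has_derivative (\<lambda>h. D z h $ 1)) (at z)"
      by (rule has_derivative_transform_within_open[OF DXi[OF z] oB z]) (simp add: X)
    from has_derivative_unique[OF this bounded_linear_imp_has_derivative[OF bounded_linear_vec_nth]]
    show "D z h $ 1 = h $ 1" by (rule fun_cong)
    have "((\<lambda>z. z $ 2) has_derivative (\<lambda>h. D z h $ 2)) (at z)"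
      by (rule has_derivative_transform_within_open[OF DXi[OF z] oB z]) (simp add: X)
    from has_derivative_unique[OF this bounded_linear_imp_has_derivative[OF bounded_linear_vec_nth]]
    show "D z h $ 2 = h $ 2" by (rule fun_cong)
  qed
  have du: "(u has_derivative (\<lambda>h. D z h $ 3)) (at z)" if z: "z \<in> ?B" for z
    by (rule has_derivative_transform_within_open[OF DXi[OF z] oB z]) (simp add: X)
  define p q where "p = partial 1 u" and "q = partial 2 u"
  have p_eq: "p z = D z (axis 1 1) $ 3" and q_eq: "q z = D z (axis 2 1) $ 3" if "z \<in> ?B" for z
    using partial_has_derivative(2)[OF du[OF that]] by (simp_all add: p_def q_def)
  have D3: "D z h $ 3 = p z * h $ 1 + q z * h $ 2" if z: "z \<in> ?B" for z h
  proof -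
    interpret bounded_linear "D z" using has_derivative_bounded_linear[OF DX[OF z]] .
    have "h = h $ 1 *\<^sub>R axis 1 1 + h $ 2 *\<^sub>R axis 2 1"
      by (simp add: vec_eq_iff forall_2 axis_def)
    then have "D z h = h $ 1 *\<^sub>R D z (axis 1 1) + h $ 2 *\<^sub>R D z (axis 2 1)" by (metis add scale)
    then show ?thesis by (simp add: p_eq[OF z] q_eq[OF z])
  qed
  have du': "(u has_derivative (\<lambda>h. p z * h $ 1 + q z * h $ 2)) (at z)" if "z \<in> ?B" for z
    using du[OF that] unfolding D3[OF that] .
  have cont: "continuous_on ?B (\<lambda>z. D z v $ 3)" for v
  proof -
    have "continuous_on ?B (\<lambda>z. D z v)" using Ck_on_SucE(2)[OF CX, of v] by (simp add: D_def)
    then show ?thesis by (intro continuous_intros)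
  qed
  have p: "continuous_on ?B p" using cont by (rule continuous_on_eq) (simp add: p_eq)
  have q: "continuous_on ?B q" using cont by (rule continuous_on_eq) (simp add: q_eq)

  \<comment> \<open>\<open>g = 1 + V V\<^sup>T\<close> for \<open>V = (p, q)\<close>, the gradient of \<open>u\<close>\<close>
  have metric: "g z $ i $ j = D z (axis i 1) \<bullet> D z (axis j 1)" if "z \<in> ?B" for z i j
  proof -
    have "D z (axis i 1) \<bullet> D z (axis j 1) = axis i 1 \<bullet> (g z *v axis j 1)"
      using assms(6) that by (simp add: isometric_embedding_on_def D_def)
    then show ?thesis by (simp add: inner_axis' matrix_vector_mul_component inner_axis column_def)
  qed
  have g_eq: "g z $ 1 $ 1 = 1 + p z * p z" "g z $ 1 $ 2 = p z * q z" "g z $ 2 $ 1 = p z * q z" "g z $ 2 $ 2 = 1 + q z * q z"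
    if z: "z \<in> ?B" for z
    by (simp_all add: metric[OF z] inner_vec_def sum_3 D12[OF z] D3[OF z]) (simp_all add: axis_def)
  note e = riemannian_metric_entries(1)[OF oB g]
  interpret smooth_products p q ?B
  proof
    have "smooth_on ?B (\<lambda>z. g z $ 1 $ 1 - 1)" by (intro smooth_on_diff smooth_on_const oB e)
    then show "smooth_on ?B (\<lambda>z. p z * p z)" by (rule smooth_on_cong[OF oB, rotated]) (simp add: g_eq)
    have "smooth_on ?B (\<lambda>z. g z $ 2 $ 2 - 1)" by (intro smooth_on_diff smooth_on_const oB e)
    then show "smooth_on ?B (\<lambda>z. q z * q z)" by (rule smooth_on_cong[OF oB, rotated]) (simp add: g_eq)
    show "smooth_on ?B (\<lambda>z. p z * q z)" by (rule smooth_on_cong[OF oB _ e[of 1 2]]) (simp add: g_eq)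
  qed (use p q in auto)

  \<comment> \<open>constants do not matter: the second derivatives of the metric are those of the products\<close>
  have K: "gauss_curvature g z = partial 1 (partial 2 (\<lambda>z. p z * q z)) z - partial 1 (partial 1 (\<lambda>z. q z * q z)) z / 2
       - partial 2 (partial 2 (\<lambda>z. p z * p z)) z / 2" if z: "z \<in> ?B" "p z = 0" "q z = 0" for z
  proof -
    have d11: "partial i (\<lambda>z. g z $ 1 $ 1) x = partial i (\<lambda>z. p z * p z) x" if x: "x \<in> ?B" for i x
      using partial_cong[OF oB x g_eq(1)] partial_const_add[OF pp x] by simp
    have d22: "partial i (\<lambda>z. g z $ 2 $ 2) x = partial i (\<lambda>z. q z * q z) x" if x: "x \<in> ?B" for i x
      using partial_cong[OF oB x g_eq(4)] partial_const_add[OF qq x] by simp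
    have d12: "partial i (\<lambda>z. g z $ 1 $ 2) x = partial i (\<lambda>z. p z * q z) x" if x: "x \<in> ?B" for i x
      by (rule partial_cong[OF oB x g_eq(2)])
    have d21: "partial i (\<lambda>z. g z $ 2 $ 1) x = partial i (\<lambda>z. p z * q z) x" if x: "x \<in> ?B" for i x
      by (rule partial_cong[OF oB x g_eq(3)])
    have zero: "partial i (\<lambda>z. p z * p z) z = 0" "partial i (\<lambda>z. p z * q z) z = 0" "partial i (\<lambda>z. q z * q z) z = 0" for i
      using smooth_on_partial_eq[OF pp z(1)] smooth_on_partial_eq[OF pq z(1)] smooth_on_partial_eq[OF qq z(1)]
      by (simp_all add: critical_products[OF z])
    have "gauss_curvature g z = partial 1 (partial 2 (\<lambda>z. g z $ 1 $ 2)) z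
       - partial 1 (partial 1 (\<lambda>z. g z $ 2 $ 2)) z / 2 - partial 2 (partial 2 (\<lambda>z. g z $ 1 $ 1)) z / 2"
    proof (rule gauss_curvature_at_critical_point[OF oB z(1) g])
      show "g z = mat 1" using g_eq[OF z(1)] z by (simp add: vec_eq_iff forall_2 mat_def)
      show "partial i (\<lambda>q. g q $ j $ l) z = 0" for i j l
        using exhaust_2[of j] exhaust_2[of l] d11[OF z(1)] d12[OF z(1)] d21[OF z(1)] d22[OF z(1)] zero by auto
    qed
    also have "partial 1 (partial 2 (\<lambda>z. g z $ 1 $ 2)) z = partial 1 (partial 2 (\<lambda>z. p z * q z)) z"
      by (rule partial_cong[OF oB z(1) d12])
    also have "partial 1 (partial 1 (\<lambda>z. g z $ 2 $ 2)) z = partial 1 (partial 1 (\<lambda>z. q z * q z)) z"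
      by (rule partial_cong[OF oB z(1) d22])
    also have "partial 2 (partial 2 (\<lambda>z. g z $ 1 $ 1)) z = partial 2 (partial 2 (\<lambda>z. p z * p z)) z"
      by (rule partial_cong[OF oB z(1) d11])
    finally show ?thesis .
  qed

  have away: "\<exists>T. open T \<and> z \<in> T \<and> smooth_on T p \<and> smooth_on T q" if z: "z \<in> ?B - {0}" for z
  proof (cases "p z = 0 \<and> q z = 0")
    case False
    then show ?thesis using smooth_near_noncritical z by blast
  next
    case True
    then have z': "z \<in> ?B" "p z = 0" "q z = 0" using z by auto
    have pos: "gauss_curvature g z > 0" using curv z by blast
    show ?thesis
    proof (rule jets[OF z' K[OF z', symmetric] order_less_imp_le[OF pos]])
      fix l11 l12 l21 l22
      assume l: "product_jets z l11 l12 l21 l22"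
        and Kl: "gauss_curvature g z = (l11 * l22 - l12 * l21) - (l12 - l21)\<^sup>2"
      have "l11 * l22 - l12 * l21 \<noteq> 0" using Kl pos zero_le_power2[of "l12 - l21"] by linarith
      from smooth_near_nondegenerate[OF z' l this] show ?thesis .
    qed
  qed

  have at0: "\<exists>T. open T \<and> 0 \<in> T \<and> smooth_on T p \<and> smooth_on T q"
  proof -
    have z: "0 \<in> ?B" "p 0 = 0" "q 0 = 0" using r assms(8,9) by (auto simp: p_def q_def)
    have K0: "gauss_curvature g 0 \<ge> 0"
    proof (rule tendsto_lowerbound)
      have "isCont (gauss_curvature g) 0"
        using smooth_on_imp_continuous_on[OF smooth_on_gauss_curvature[OF oB g]] z(1) oB
        by (simp add: continuous_on_eq_continuous_at)
      then show "(gauss_curvature g \<longlongrightarrow> gauss_curvature g 0) (at 0)" by (simp add: isCont_def)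
      show "\<forall>\<^sub>F z in at 0. gauss_curvature g z \<ge> 0"
        unfolding eventually_at_topological using curv z(1) oB
        by (intro exI[of _ ?B]) (auto intro: order_less_imp_le)
    qed simp
    show ?thesis
    proof (rule jets[OF z K[OF z, symmetric] K0])
      fix l11 l12 l21 l22
      assume l: "product_jets 0 l11 l12 l21 l22"
        and Kl: "gauss_curvature g 0 = (l11 * l22 - l12 * l21) - (l12 - l21)\<^sup>2"
      show ?thesis
      proof (cases "l11 * l22 - l12 * l21 = 0")
        case False
        from smooth_near_nondegenerate[OF z l False] show ?thesis .
      next
        case True
        then have "(l12 - l21)\<^sup>2 \<le> 0" using Kl K0 by simp
        then have sym: "l21 = l12" by simp
        have det: "l11 * l22 = l12\<^sup>2" using True by (simp add: sym power2_eq_square)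
        let ?S = "ball (0::real^2) \<rho> - {0}"
        have S: "open ?S" by (simp add: open_delete)
        have SB: "?S \<subseteq> ?B - {0}" using \<rho> by auto
        have ps: "smooth_on ?S p" and qs: "smooth_on ?S q"
          by (rule smooth_on_local; use away SB in blast)+
        have hp: "has_partial 1 p (partial 1 p z) z" "has_partial 2 q (partial 2 q z) z" if "z \<in> ?S" for z
          using partial_has_derivative[OF smooth_on_has_derivative[OF ps that]]
            partial_has_derivative[OF smooth_on_has_derivative[OF qs that]] by auto
        \<comment> \<open>the Laplacian is continuous away from the origin, where smoothness is already known\<close>
        have ge: "partial 1 p z + partial 2 q z \<ge> C\<^sub>0" if "z \<in> ?S" for z
        proof (rule AE_gt_imp_ge[OF S _ _ that])
          show "continuous_on ?S (\<lambda>z. partial 1 p z + partial 2 q z)"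
            by (intro continuous_on_add smooth_on_imp_continuous_on smooth_on_partial S ps qs)
          have uniq: "d = partial i f z" if "has_partial i f d z" for i f d and z :: "real^2"
            using DERIV_imp_deriv[OF that[unfolded has_partial_def]] by (simp add: partial_def)
          show "AE z in lborel. z \<in> ?S \<longrightarrow> C\<^sub>0 < partial 1 p z + partial 2 q z"
            using assms(13) unfolding laplacian_gt_on_def p_def[symmetric] q_def[symmetric]
            by eventually_elim (use uniq in blast)
        qed
        show ?thesis
        proof (rule smooth_near_degenerate[OF z l[unfolded sym] det C \<rho>(1)])
          show "(u has_derivative (\<lambda>h. p z * h $ 1 + q z * h $ 2)) (at z)" if "z \<in> ?S" for z
            by (rule du') (use that SB in blast)
          show "\<exists>a b. has_partial 1 p a z \<and> has_partial 2 q b z \<and> C\<^sub>0 \<le> a + b" if "z \<in> ?S" for z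
            using hp[OF that] ge[OF that] by blast
        qed
      qed
    qed
  qed

  have sp: "smooth_on ?B p" and sq: "smooth_on ?B q"
    by (rule smooth_on_local; use away at0 in blast)+
  have "Ck_on n ?B u" for n
  proof -
    have "Ck_on (Suc n) ?B u"
    proof (rule Ck_on_SucI[OF oB du'])
      fix v :: "real^2"
      have "smooth_on ?B (\<lambda>z. p z * v $ 1 + q z * v $ 2)"
        by (intro smooth_on_add smooth_on_mult smooth_on_const oB sp sq)
      then show "Ck_on n ?B (\<lambda>z. p z * v $ 1 + q z * v $ 2)" by (simp add: smooth_on_def)
    qed
    then show ?thesis by (rule Ck_on_SucD)
  qed
  then have us: "smooth_on ?B u" by (simp add: smooth_on_def)
  have "smooth_on ?B (\<lambda>z. (z $ 1) *\<^sub>R axis 1 1 + (z $ 2) *\<^sub>R axis 2 1 + u z *\<^sub>R axis 3 1 :: real^3)"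
    by (intro smooth_on_add smooth_on_scaleR smooth_on_const oB us smooth_on_linear[OF oB bounded_linear_vec_nth])
  then show ?thesis
    by (rule smooth_on_cong[OF oB, rotated]) (simp add: X vec_eq_iff forall_3 axis_def)
qed

end
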